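(* Let $\mathcal{X}$, $\mathcal{Y}$, $\hat{\mathcal{X}}$ be finite sets, let $P_{XY}$ be a PMF on $\mathcal{X}\times\mathcal{Y}$ whose marginals $P_X$ and $P_Y$ are strictly positive, let $d\colon \mathcal{X}\times\hat{\mathcal{X}}\to\mathbb{R}_{\ge 0}$ be a distortion function, let $D>0$, let $R\ge 0$ and let $\rho>0$. Assume that for every $n\ge1$ and every $x^n\in\mathcal{X}^n$ there exists $\hat{x}^n\in\hat{\mathcal{X}}^n$ with $\bar d(x^n,\hat x^n)\le D$. Let $(X_1,Y_1),\dots,(X_n,Y_n)$ be IID according to $P_{XY}$. Then the limit $$\lim_{n\to\infty}\frac1n\log\Big(\min_{f_n}\min_{\mathcal{G}_n}\mathbb{E}\big[G_n(X^n\mid f_n(Y^n))^\rho\big]\Big),$$ where the minima are over all helpers $f_n\colon\mathcal{Y}^n\to\{0,1\}^{nR}$ and all guessing strategies $\mathcal{G}_n$, exists and equals $$\sup_{Q_Y}\ \inf_{Q_{U\mid Y}:\ I(Q_{Y;U})\le R}\ \sup_{Q_{X\mid YU}}\Big(\rho\, R_D(Q_{X\mid U})-D\big(Q_{XYU}\,\|\,P_{XY}Q_{U\mid Y}\big)\Big),$$ where the optimization is over $Q_Y\in\mathcal{P}(\mathcal{Y})$, the choice of a finite set $\mathcal{U}$, $Q_{U\mid Y}\in\mathcal{P}(\mathcal{U}\mid\mathcal{Y})$ and $Q_{X\mid YU}\in\mathcal{P}(\mathcal{X}\mid\mathcal{Y}\times\mathcal{U})$; all quantities are evaluated with respect to $Q_{XYU}=Q_YQ_{U\mid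 Y}Q_{X\mid YU}$; $I(Q_{Y;U})$ is the mutual information between $Y$ and $U$; $D(\cdot\|\cdot)$ is relative entropy; and $P_{XY}Q_{U\mid Y}$ denotes the PMF $(x,y,u)\mapsto P_{XY}(x,y)Q_{U\mid Y}(u\mid y)$.
   Context: All logarithms are base 2. For $x^n\in\mathcal{X}^n$, $\hat x^n\in\hat{\mathcal{X}}^n$, $\bar d(x^n,\hat x^n)=\frac1n\sum_{i=1}^n d(x_i,\hat x_i)$. $\mathcal{P}(\mathcal{V})$ is the set of PMFs on a finite set $\mathcal{V}$ and $\mathcal{P}(\mathcal{V}\mid\mathcal{W})$ the set of conditional PMFs on $\mathcal{V}$ indexed by $\mathcal{W}$. A helper (of rate $R$) is any map $f_n\colon\mathcal{Y}^n\to\{0,1\}^{nR}$. A guessing strategy $\mathcal{G}_n$ assigns to each possible description $m$ a bijection $\mathcal{G}_n(\cdot\mid m)\colon\{1,\dots,|\hat{\mathcal{X}}|^n\}\to\hat{\mathcal{X}}^n$ (the ordered list of guesses), and the number of guesses is $G_n(x^n\mid m)=\min\{i\ge1:\bar d(x^n,\mathcal{G}_n(i\mid m))\le D\}$. The conditional rate–distortion function is $R_D(Q_{X\mid U})=\min_{Q_{\hat X\mid XU}:\ \mathbb{E}[d(X,\hat X)]\le D} I(X;\hat X\mid U)$, evaluated under $Q_{\hat X\mid XU}Q_{XU}$ where $Q_{XU}$ is the $(X,U)$-marginal of $Q_YQ_{U\mid Y}Q_{X\mid YU}$. *)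

theory Defs
  imports "HOL-Analysis.Analysis" "HOL-Library.Extended_Real"
begin

text \<open>All logarithms are base 2; the convention 0 log(0/..) = 0 is built in.
  PMFs on finite sets are represented as real-valued functions.\<close>

definition pmf_on :: "'a set \<Rightarrow> ('a \<Rightarrow> real) \<Rightarrow> bool" where
  "pmf_on A p \<longleftrightarrow> (\<forall>a. 0 \<le> p a) \<and> (\<forall>a. a \<notin> A \<longrightarrow> p a = 0) \<and> sum p A = 1"

definition mutual_info :: "'a set \<Rightarrow> 'b set \<Rightarrow> ('a \<Rightarrow> 'b \<Rightarrow> real) \<Rightarrow> real" where
  "mutual_info A B p =
     (\<Sum>a\<in>A. \<Sum>b\<in>B. if p a b = 0 then 0
        else p a b * log 2 (p a b / ((\<Sum>b'\<in>B. p a b') * (\<Sum>a'\<in>A. p a' b))))"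

definition cond_mutual_info ::
  "'a set \<Rightarrow> 'b set \<Rightarrow> 'c set \<Rightarrow> ('a \<Rightarrow> 'b \<Rightarrow> 'c \<Rightarrow> real) \<Rightarrow> real" where
  "cond_mutual_info A B C p =
     (\<Sum>a\<in>A. \<Sum>b\<in>B. \<Sum>c\<in>C. if p a b c = 0 then 0
        else p a b c * log 2 (p a b c * (\<Sum>a'\<in>A. \<Sum>b'\<in>B. p a' b' c)
                 / ((\<Sum>b'\<in>B. p a b' c) * (\<Sum>a'\<in>A. p a' b c))))"

definition rel_entropy :: "'a set \<Rightarrow> ('a \<Rightarrow> real) \<Rightarrow> ('a \<Rightarrow> real) \<Rightarrow> ereal" where
  "rel_entropy A q p =
     (if \<exists>a\<in>A. q a > 0 \<and> p a = 0 then \<infinity>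
      else ereal (\<Sum>a\<in>A. if q a = 0 then 0 else q a * log 2 (q a / p a)))"

definition cond_rd :: "('x::finite \<Rightarrow> 'xh::finite \<Rightarrow> real) \<Rightarrow> real \<Rightarrow> nat set
    \<Rightarrow> ('x \<Rightarrow> nat \<Rightarrow> real) \<Rightarrow> ereal" where
  "cond_rd d D U qXU =
     (INF W \<in> {W :: 'x \<Rightarrow> nat \<Rightarrow> 'xh \<Rightarrow> real.
                 (\<forall>x. \<forall>u\<in>U. pmf_on UNIV (W x u)) \<and>
                 (\<Sum>x\<in>UNIV. \<Sum>u\<in>U. \<Sum>xh\<in>UNIV. qXU x u * W x u xh * d x xh) \<le> D}.
        ereal (cond_mutual_info UNIV UNIV U (\<lambda>x xh u. qXU x u * W x u xh)))"

definition dbar :: "('x \<Rightarrow> 'xh \<Rightarrow> real) \<Rightarrow> 'x list \<Rightarrow> 'xh list \<Rightarrow> real" where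
  "dbar d xs ys = (\<Sum>i<length xs. d (xs ! i) (ys ! i)) / real (length xs)"

definition num_desc :: "nat \<Rightarrow> real \<Rightarrow> nat" where
  "num_desc n R = 2 ^ nat \<lfloor>real n * R\<rfloor>"

definition is_helper :: "nat \<Rightarrow> real \<Rightarrow> ('y list \<Rightarrow> nat) \<Rightarrow> bool" where
  "is_helper n R f \<longleftrightarrow> (\<forall>ys. length ys = n \<longrightarrow> f ys < num_desc n R)"

definition is_guessing_strategy :: "nat \<Rightarrow> real \<Rightarrow> (nat \<Rightarrow> nat \<Rightarrow> 'xh::finite list) \<Rightarrow> bool" where
  "is_guessing_strategy n R g \<longleftrightarrow>
     (\<forall>m < num_desc n R. bij_betw (g m) {1..card (UNIV :: 'xh set) ^ n} {xs. length xs = n})"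

definition num_guesses ::
  "('x \<Rightarrow> 'xh \<Rightarrow> real) \<Rightarrow> real \<Rightarrow> (nat \<Rightarrow> nat \<Rightarrow> 'xh list) \<Rightarrow> 'x list \<Rightarrow> nat \<Rightarrow> nat" where
  "num_guesses d D g xs m = (LEAST i. 1 \<le> i \<and> dbar d xs (g m i) \<le> D)"

definition guess_moment ::
  "('x::finite \<times> 'y::finite \<Rightarrow> real) \<Rightarrow> ('x \<Rightarrow> 'xh \<Rightarrow> real) \<Rightarrow> real \<Rightarrow> real \<Rightarrow> nat
    \<Rightarrow> ('y list \<Rightarrow> nat) \<Rightarrow> (nat \<Rightarrow> nat \<Rightarrow> 'xh list) \<Rightarrow> real" where
  "guess_moment P d D \<rho> n f g =
     (\<Sum>xs\<in>{xs. length xs = n}. \<Sum>ys\<in>{ys. length ys = n}.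
        (\<Prod>i<n. P (xs ! i, ys ! i)) * real (num_guesses d D g xs (f ys)) powr \<rho>)"

definition opt_guess_moment ::
  "('x::finite \<times> 'y::finite \<Rightarrow> real) \<Rightarrow> ('x \<Rightarrow> 'xh::finite \<Rightarrow> real) \<Rightarrow> real \<Rightarrow> real \<Rightarrow> real
    \<Rightarrow> nat \<Rightarrow> real" where
  "opt_guess_moment P d D R \<rho> n =
     Inf {guess_moment P d D \<rho> n f g | f g. is_helper n R f \<and> is_guessing_strategy n R g}"

end

theory Submission
  imports Defs "HOL-Real_Asymp.Real_Asymp"
begin

text \<open>Converse, for every blocklength. Draw \<open>Y\<^sub>i\<close> IID from \<open>QY\<close>, let \<open>M\<close> be the description,
  \<open>U\<^sub>i = (i, M, Y\<^sub>1 \<dots> Y\<^sub>i\<^sub>-\<^sub>1)\<close>, and draw \<open>X\<^sub>i\<close> from \<open>W(\<cdot> | Y\<^sub>i, U\<^sub>i)\<close>. The Donsker--Varadhan inequality bounds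
  the logarithm of the moment from below by \<open>\<rho> E[log G]\<close> minus a divergence that single-letterizes exactly.
  As a positive integer of expected logarithm \<open>E[log G]\<close> determines the reconstruction given \<open>M\<close>,
  \<open>E[log G]\<close> dominates, up to \<open>O(log n)\<close>, the conditional entropy of the reconstruction given \<open>M\<close>, which is at
  least the sum of the \<open>I(X\<^sub>i; X'\<^sub>i | U\<^sub>i)\<close> because \<open>X\<^sub>i\<close> is independent of \<open>X\<^sub>1 \<dots> X\<^sub>i\<^sub>-\<^sub>1\<close> given \<open>U\<^sub>i\<close>.

  Achievability, by the method of types. For each type of \<open>y\<close> the helper describes a word \<open>u\<close> of a covering
  code of size \<open>2\<close> to the \<open>n I(Y;U) + o(n)\<close>, and the guesser interleaves, over all joint types with \<open>u\<close>, minimal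
  coverings of the conditional type classes. If some exponent above the claimed one fails for infinitely many
  \<open>n\<close>, compactness gives a limiting type of \<open>y\<close>, then a limiting joint type, and the bounds for finite \<open>n\<close> pass to
  the limit and contradict the choice of \<open>Q\<^bsub>U|Y\<^esub>\<close> for the limiting type. Only the upper semicontinuity of
  \<open>R\<^sub>D\<close> is used, and no cardinality bound on \<open>U\<close>.\<close>

text \<open>The infimum over Q_{U|Y} precedes the supremum over Q_{X|YU}. In the converse U_i may
  therefore contain the description and the past of Y, but not the past of X: its law must be fixed
  by the helper and \<open>QY\<close> before \<open>W\<close> is known. The past of X, which the
  chain rule needs, has to be inserted at no loss, and this is where the conditional independence
  enters. The divergence single-letterizes exactly because Q_{U|Y} cancels from the ratio of Q_{XYU}
  to P_{XY} Q_{U|Y}; what remains is a product along the word. In the direct part the helper adapts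
  its code to the type of y, matching the outer supremum over Q_Y, but does not send that type; the
  guesser pays a factor polynomial in n for not knowing it. The chosen Q_{U|Y} meets the rate
  constraint for the limiting type only, so at finite n the codebook may be too large for the
  descriptions; likewise a distortion constraint met with equality in the limit may fail at finite
  n. The first excess is turned into additional guesses, the second is removed by moving a vanishing
  share of the mass to best reconstruction letters.\<close>

definition guess_exponent ::
  "('x::finite \<times> 'y::finite \<Rightarrow> real) \<Rightarrow> ('x \<Rightarrow> 'xh::finite \<Rightarrow> real) \<Rightarrow> real \<Rightarrow> real \<Rightarrow> ('y \<Rightarrow> real) \<Rightarrow>
    nat \<Rightarrow> ('y \<Rightarrow> nat \<Rightarrow> real) \<Rightarrow> ('y \<Rightarrow> nat \<Rightarrow> 'x \<Rightarrow> real) \<Rightarrow> ereal" where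
  "guess_exponent P d D \<rho> QY k V W =
    ereal \<rho> * cond_rd d D {..<k} (\<lambda>x u. \<Sum>y\<in>UNIV. QY y * V y u * W y u x)
    - rel_entropy (UNIV \<times> UNIV \<times> {..<k})
        (\<lambda>(x, y, u). QY y * V y u * W y u x) (\<lambda>(x, y, u). P (x, y) * V y u)"

section \<open>The function x log x, sums over words, and information in these terms\<close>

text \<open>Information quantities are expanded into signed sums of \<open>xlog\<close>: it is
  continuous up to 0, so limits of types can be taken termwise, and it is the leading term of log
  c!, which links the sizes of type classes to entropies.\<close>

definition xlog :: "real \<Rightarrow> real" where
  "xlog x = x * log 2 x"

lemma xlog_0 [simp]: "xlog 0 = 0"
  by (simp add: xlog_def)

lemma tendsto_xlog_0: "(xlog \<longlongrightarrow> 0) (at 0 within {0..})"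
proof -
  have "((\<lambda>x::real. x * log 2 x) \<longlongrightarrow> 0) (at_right 0)"
    unfolding log_def by real_asymp
  moreover have "at (0::real) within {0..} = at_right 0"
    by (rule at_within_Ici_at_right)
  ultimately show ?thesis by (simp add: xlog_def[abs_def])
qed

lemma continuous_on_xlog: "continuous_on {0..} xlog"
  unfolding continuous_on_def
proof
  fix x :: real assume x: "x \<in> {0..}"
  show "(xlog \<longlongrightarrow> xlog x) (at x within {0..})"
  proof (cases "x = 0")
    case True then show ?thesis using tendsto_xlog_0 by simp
  next
    case False
    then have "isCont xlog x" using x unfolding xlog_def[abs_def] by (intro continuous_intros) auto
    then show ?thesis
      using continuous_at_imp_continuous_at_within continuous_within by blast
  qed
qed

lemma tendsto_xlog:
  fixes f :: "nat \<Rightarrow> real"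
  assumes "f \<longlonglongrightarrow> a" "\<And>n. 0 \<le> f n"
  shows "(\<lambda>n. xlog (f n)) \<longlonglongrightarrow> xlog a"
proof -
  have "0 \<le> a" using assms by (meson LIMSEQ_le_const)
  then show ?thesis
    using continuous_on_tendsto_compose[OF continuous_on_xlog assms(1)] assms(2) by auto
qed

lemma xlog_mult: "0 < n \<Longrightarrow> 0 \<le> x \<Longrightarrow> xlog (n * x) = n * xlog x + n * x * log 2 n"
  by (cases "x = 0") (auto simp: xlog_def log_mult algebra_simps)

text \<open>Jensen's inequality for the logarithm, from ln t \<le> t - 1. The Gibbs inequality
  \<open>cross_entropy\<close> and the Donsker--Varadhan step of \<open>converse_bound\<close> are
  both instances, with p a law and t a likelihood ratio of expectation at most 1.\<close>

lemma sum_log_nonpos: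
  fixes p t :: "'a \<Rightarrow> real"
  assumes "finite S" "\<And>w. w \<in> S \<Longrightarrow> 0 \<le> p w" "\<And>w. w \<in> S \<Longrightarrow> 0 < p w \<Longrightarrow> 0 < t w"
    and "(\<Sum>w\<in>S. p w * t w) \<le> (\<Sum>w\<in>S. p w)"
  shows "(\<Sum>w\<in>S. p w * log 2 (t w)) \<le> 0"
proof -
  have "p w * log 2 (t w) \<le> (p w * t w - p w) / ln 2" if "w \<in> S" for w
  proof (cases "p w = 0")
    case False
    then have "0 < p w" "0 < t w" using assms that by force+
    then have "p w * ln (t w) \<le> p w * (t w - 1)" by (intro mult_left_mono ln_le_minus_one) auto
    then have "p w * ln (t w) / ln 2 \<le> p w * (t w - 1) / ln 2" by (rule divide_right_mono) simp
    then show ?thesis by (simp add: log_def algebra_simps)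
  qed simp
  then have "(\<Sum>w\<in>S. p w * log 2 (t w)) \<le> (\<Sum>w\<in>S. (p w * t w - p w) / ln 2)"
    by (rule sum_mono)
  also have "\<dots> = ((\<Sum>w\<in>S. p w * t w) - (\<Sum>w\<in>S. p w)) / ln 2"
    by (simp add: sum_divide_distrib[symmetric] sum_subtractf)
  also have "\<dots> \<le> 0" using assms(4) by (simp add: divide_nonpos_pos)
  finally show ?thesis .
qed

lemma lists_nth_Suc:
  "{xs. length xs = Suc n \<and> (\<forall>i<Suc n. xs ! i \<in> C i)} =
   (\<lambda>(xs, c). xs @ [c]) ` ({xs. length xs = n \<and> (\<forall>i<n. xs ! i \<in> C i)} \<times> C n)"
proof (intro set_eqI iffI)
  fix xs assume xs: "xs \<in> {xs. length xs = Suc n \<and> (\<forall>i<Suc n. xs ! i \<in> C i)}"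
  then obtain ys c where ys: "xs = ys @ [c]" "length ys = n"
    by (auto simp: length_Suc_conv_rev)
  have "ys ! i \<in> C i" if "i < n" for i
  proof -
    have "xs ! i \<in> C i" using xs that by auto
    then show ?thesis using ys that by (simp add: nth_append)
  qed
  moreover have "c \<in> C n"
  proof -
    have "xs ! n \<in> C n" using xs by auto
    then show ?thesis using ys by (simp add: nth_append)
  qed
  ultimately show "xs \<in> (\<lambda>(xs, c). xs @ [c]) ` ({xs. length xs = n \<and> (\<forall>i<n. xs ! i \<in> C i)} \<times> C n)"
    using ys by auto
qed (auto simp: nth_append less_Suc_eq)

text \<open>The sets \<open>C i\<close> make one identity serve for the total mass and for all
  marginals of a product law: singletons at the coordinates that are fixed, the whole alphabet
  elsewhere. The induction appends at the end, so that the position-dependent weights keep their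
  index.\<close>

lemma sum_lists_prod:
  fixes w :: "nat \<Rightarrow> 'a \<Rightarrow> 'b::comm_semiring_1"
  assumes "\<And>i. i < n \<Longrightarrow> finite (C i)"
  shows "(\<Sum>xs\<in>{xs. length xs = n \<and> (\<forall>i<n. xs ! i \<in> C i)}. \<Prod>i<n. w i (xs ! i)) =
    (\<Prod>i<n. \<Sum>c\<in>C i. w i c)"
  using assms
proof (induction n)
  case (Suc n)
  let ?L = "{xs. length xs = n \<and> (\<forall>i<n. xs ! i \<in> C i)}"
  have "(\<Sum>xs\<in>{xs. length xs = Suc n \<and> (\<forall>i<Suc n. xs ! i \<in> C i)}. \<Prod>i<Suc n. w i (xs ! i)) =
    (\<Sum>(xs, c)\<in>?L \<times> C n. \<Prod>i<Suc n. w i ((xs @ [c]) ! i))"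
    unfolding lists_nth_Suc
    by (subst sum.reindex) (auto simp: inj_on_def intro!: sum.cong)
  also have "\<dots> = (\<Sum>(xs, c)\<in>?L \<times> C n. (\<Prod>i<n. w i (xs ! i)) * w n c)"
    by (intro sum.cong) (auto simp: nth_append mult.commute intro!: prod.cong)
  also have "\<dots> = (\<Sum>xs\<in>?L. \<Prod>i<n. w i (xs ! i)) * (\<Sum>c\<in>C n. w n c)"
    by (simp add: sum.cartesian_product[symmetric] sum_product)
  finally show ?case using Suc by (simp add: mult.commute)
qed simp

lemma bounded_fun_subseq:
  fixes f :: "nat \<Rightarrow> 'i \<Rightarrow> real"
  assumes "finite I" "\<And>n i. i \<in> I \<Longrightarrow> \<bar>f n i\<bar> \<le> B"
  shows "\<exists>r l. strict_mono (r :: nat \<Rightarrow> nat) \<and> (\<forall>i\<in>I. (\<lambda>n. f (r n) i) \<longlonglongrightarrow> l i)"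
  using assms
proof (induction I)
    case empty
    show ?case by (intro exI[of _ id]) (auto simp: strict_mono_def)
  next
    case (insert j I)
    then obtain r l where r: "strict_mono (r :: nat \<Rightarrow> nat)" "\<forall>i\<in>I. (\<lambda>n. f (r n) i) \<longlonglongrightarrow> l i"
      by auto
    have "bounded (range (\<lambda>n. f (r n) j))"
      using insert.prems by (auto simp: bounded_iff)
    then obtain m s where s: "strict_mono s" "((\<lambda>n. f (r n) j) \<circ> s) \<longlonglongrightarrow> m"
      using bounded_imp_convergent_subsequence by blast
    have "strict_mono (r \<circ> s)" using r s by (simp add: strict_mono_o)
    moreover have "(\<lambda>n. f ((r \<circ> s) n) i) \<longlonglongrightarrow> (l(j := m)) i" if "i \<in> insert j I" for i
    proof (cases "i = j")
      case True then show ?thesis using s by (simp add: o_def)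
    next
      case False
      then have "((\<lambda>n. f (r n) i) \<circ> s) \<longlonglongrightarrow> l i" using r s that by (intro LIMSEQ_subseq_LIMSEQ) auto
      then show ?thesis using False by (simp add: o_def)
    qed
    ultimately show ?case by blast
qed

text \<open>This is I(A;B|C) = H(A,C) + H(B,C) - H(A,B,C) - H(C). A positive entry forces its
  marginals to be positive, so the logarithm of the quotient splits; null entries contribute nothing
  on either side.\<close>

lemma cond_mutual_info_xlog:
  fixes p :: "'a \<Rightarrow> 'b \<Rightarrow> 'c \<Rightarrow> real"
  assumes fin: "finite A" "finite B" "finite C" and nn: "\<And>a b c. a \<in> A \<Longrightarrow> b \<in> B \<Longrightarrow> c \<in> C \<Longrightarrow> 0 \<le> p a b c"
  shows "cond_mutual_info A B C p =
    (\<Sum>a\<in>A. \<Sum>b\<in>B. \<Sum>c\<in>C. xlog (p a b c)) + (\<Sum>c\<in>C. xlog (\<Sum>a\<in>A. \<Sum>b\<in>B. p a b c))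
    - (\<Sum>a\<in>A. \<Sum>c\<in>C. xlog (\<Sum>b\<in>B. p a b c)) - (\<Sum>b\<in>B. \<Sum>c\<in>C. xlog (\<Sum>a\<in>A. p a b c))"
proof -
  let ?c = "\<lambda>c. \<Sum>a\<in>A. \<Sum>b\<in>B. p a b c" and ?ac = "\<lambda>a c. \<Sum>b\<in>B. p a b c" and ?bc = "\<lambda>b c. \<Sum>a\<in>A. p a b c"
  have "cond_mutual_info A B C p = (\<Sum>a\<in>A. \<Sum>b\<in>B. \<Sum>c\<in>C. xlog (p a b c) + p a b c * log 2 (?c c)
      - p a b c * log 2 (?ac a c) - p a b c * log 2 (?bc b c))"
    unfolding cond_mutual_info_def
  proof (intro sum.cong refl)
    fix a b c assume abc: "a \<in> A" "b \<in> B" "c \<in> C"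
    show "(if p a b c = 0 then 0 else p a b c * log 2 (p a b c * ?c c / (?ac a c * ?bc b c))) =
      xlog (p a b c) + p a b c * log 2 (?c c) - p a b c * log 2 (?ac a c) - p a b c * log 2 (?bc b c)"
    proof (cases "p a b c = 0")
      case False
      then have p: "0 < p a b c" using nn[OF abc] by simp
      have 1: "p a b c \<le> ?ac a c" by (rule member_le_sum) (use abc fin nn in auto)
      have 2: "p a b c \<le> ?bc b c" by (rule member_le_sum[of a A "\<lambda>a. p a b c"]) (use abc fin nn in auto)
      have 3: "?ac a c \<le> ?c c" by (rule member_le_sum[of a A "\<lambda>a. ?ac a c"]) (use abc fin nn in \<open>auto intro: sum_nonneg\<close>)
      have "x * log 2 (x * y / (z * w)) = xlog x + x * log 2 y - x * log 2 z - x * log 2 w"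
        if "0 < x" "x \<le> z" "x \<le> w" "z \<le> y" for x y z w :: real
        using that by (simp add: xlog_def log_mult log_divide algebra_simps)
      from this[OF p 1 2 3] show ?thesis using False by simp
    qed simp
  qed
  moreover have "(\<Sum>a\<in>A. \<Sum>b\<in>B. \<Sum>c\<in>C. p a b c * log 2 (?c c)) = (\<Sum>c\<in>C. xlog (?c c))"
  proof -
    have "(\<Sum>a\<in>A. \<Sum>b\<in>B. \<Sum>c\<in>C. p a b c * log 2 (?c c)) = (\<Sum>a\<in>A. \<Sum>c\<in>C. \<Sum>b\<in>B. p a b c * log 2 (?c c))"
      by (intro sum.cong refl) (rule sum.swap)
    also have "\<dots> = (\<Sum>c\<in>C. \<Sum>a\<in>A. \<Sum>b\<in>B. p a b c * log 2 (?c c))" by (rule sum.swap)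
    finally show ?thesis by (simp add: xlog_def sum_distrib_right)
  qed
  moreover have "(\<Sum>a\<in>A. \<Sum>b\<in>B. \<Sum>c\<in>C. p a b c * log 2 (?ac a c)) = (\<Sum>a\<in>A. \<Sum>c\<in>C. xlog (?ac a c))"
    by (intro sum.cong refl) (subst sum.swap, simp add: xlog_def sum_distrib_right)
  moreover have "(\<Sum>a\<in>A. \<Sum>b\<in>B. \<Sum>c\<in>C. p a b c * log 2 (?bc b c)) = (\<Sum>b\<in>B. \<Sum>c\<in>C. xlog (?bc b c))"
  proof -
    have "(\<Sum>a\<in>A. \<Sum>b\<in>B. \<Sum>c\<in>C. p a b c * log 2 (?bc b c)) = (\<Sum>b\<in>B. \<Sum>a\<in>A. \<Sum>c\<in>C. p a b c * log 2 (?bc b c))"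
      by (rule sum.swap)
    also have "\<dots> = (\<Sum>b\<in>B. \<Sum>c\<in>C. \<Sum>a\<in>A. p a b c * log 2 (?bc b c))"
      by (intro sum.cong refl) (rule sum.swap)
    finally show ?thesis by (simp add: xlog_def sum_distrib_right)
  qed
  ultimately show ?thesis by (simp add: sum.distrib sum_subtractf)
qed

text \<open>With a constant third variable the extra factor in the numerator is the total mass 1, so
  continuity and covering need to be treated for conditional information only.\<close>

lemma mutual_info_eq_cond:
  assumes "finite A" "finite B" "(\<Sum>a\<in>A. \<Sum>b\<in>B. p a b) = 1"
  shows "mutual_info A B p = cond_mutual_info A B {c} (\<lambda>a b _. p a b)"
  unfolding mutual_info_def cond_mutual_info_def using assms by (simp cong: if_cong)

subsection \<open>Entropy on finite probability spaces\<close>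

locale finite_pmf =
  fixes S :: "'w set" and p :: "'w \<Rightarrow> real"
  assumes fin: "finite S" and nonneg: "\<And>w. w \<in> S \<Longrightarrow> 0 \<le> p w" and total: "sum p S = 1"
begin

definition pr :: "('w \<Rightarrow> 'a) \<Rightarrow> 'a \<Rightarrow> real" where
  "pr X v = (\<Sum>w\<in>{w\<in>S. X w = v}. p w)"

text \<open>The entropy as an expectation over the sample space: no range of X has to be named, and
  points of mass zero drop out through the factor \<open>p w\<close>.\<close>

definition ent :: "('w \<Rightarrow> 'a) \<Rightarrow> real" where
  "ent X = - (\<Sum>w\<in>S. p w * log 2 (pr X (X w)))"

lemma pr_nonneg: "0 \<le> pr X v"
  unfolding pr_def by (intro sum_nonneg) (auto simp: nonneg)

lemma pr_ge: "w \<in> S \<Longrightarrow> X w = v \<Longrightarrow> p w \<le> pr X v"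
  unfolding pr_def by (rule member_le_sum[of w _ p]) (auto simp: nonneg fin)

lemma pr_pos: "w \<in> S \<Longrightarrow> 0 < p w \<Longrightarrow> 0 < pr X (X w)"
  using pr_ge[of w X "X w"] by auto

lemma pr_expect:
  assumes "finite V" "X ` S \<subseteq> V"
  shows "(\<Sum>v\<in>V. pr X v * \<phi> v) = (\<Sum>w\<in>S. p w * \<phi> (X w))"
proof -
  have "(\<Sum>w\<in>S. p w * \<phi> (X w)) = (\<Sum>v\<in>V. \<Sum>w\<in>{w\<in>S. X w = v}. p w * \<phi> (X w))"
    by (rule sum.group[symmetric]) (use assms fin in auto)
  also have "\<dots> = (\<Sum>v\<in>V. pr X v * \<phi> v)"
    unfolding pr_def by (auto simp: sum_distrib_right intro!: sum.cong)
  finally show ?thesis ..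
qed

lemma pr_sum: "finite V \<Longrightarrow> X ` S \<subseteq> V \<Longrightarrow> (\<Sum>v\<in>V. pr X v) = 1"
  using pr_expect[of V X "\<lambda>_. 1"] total by simp

lemma pr_marginal:
  assumes "finite V" "X ` S \<subseteq> V"
  shows "(\<Sum>v\<in>V. pr (\<lambda>w. (X w, Y w)) (v, y)) = pr Y y"
proof -
  have "pr Y y = (\<Sum>v\<in>V. \<Sum>w\<in>{w \<in> {w\<in>S. Y w = y}. X w = v}. p w)"
    unfolding pr_def by (rule sum.group[symmetric]) (use assms fin in auto)
  also have "\<dots> = (\<Sum>v\<in>V. pr (\<lambda>w. (X w, Y w)) (v, y))"
    unfolding pr_def by (intro sum.cong refl) auto
  finally show ?thesis ..
qed

lemma pr_mono: "(\<And>w. w \<in> S \<Longrightarrow> X w = v \<Longrightarrow> Y w = u) \<Longrightarrow> pr X v \<le> pr Y u"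
  unfolding pr_def by (intro sum_mono2) (auto simp: fin nonneg)

lemma pr_cong: "(\<And>w. w \<in> S \<Longrightarrow> X w = v \<longleftrightarrow> Y w = u) \<Longrightarrow> pr X v = pr Y u"
  unfolding pr_def by (intro sum.cong) auto

text \<open>Entropy depends only on the partition of S into fibres. This is the tool for regrouping
  tuples and for dropping components that the others determine.\<close>

lemma ent_cong:
  assumes "\<And>w w'. w \<in> S \<Longrightarrow> w' \<in> S \<Longrightarrow> X w = X w' \<longleftrightarrow> Y w = Y w'"
  shows "ent X = ent Y"
proof -
  have "pr X (X w) = pr Y (Y w)" if "w \<in> S" for w
    by (rule pr_cong) (use assms that in blast)
  then show ?thesis unfolding ent_def by simp
qed

lemma ent_mono:
  assumes "\<And>w w'. w \<in> S \<Longrightarrow> w' \<in> S \<Longrightarrow> Y w = Y w' \<Longrightarrow> X w = X w'"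
  shows "ent X \<le> ent Y"
proof -
  have "p w * log 2 (pr Y (Y w)) \<le> p w * log 2 (pr X (X w))" if "w \<in> S" for w
  proof (cases "p w = 0")
    case False
    then have "0 < p w" using nonneg[OF that] by simp
    moreover have "pr Y (Y w) \<le> pr X (X w)" by (rule pr_mono) (use that assms in blast)
    ultimately show ?thesis using that pr_pos[of w Y] by (intro mult_left_mono) auto
  qed simp
  then show ?thesis unfolding ent_def by (simp add: sum_mono)
qed

text \<open>Gibbs inequality H(X|Z) \<le> - E log r(X|Z) for a subprobability kernel r: the ratio
  \<open>?t\<close> of r(X|Z) p(Z) to p(X,Z) has expectation at most 1. The kernels used below are a
  conditional law with less conditioning, a uniform law, and one proportional to the reciprocal of
  the number of guesses.\<close>

lemma cross_entropy:
  assumes V: "finite V" "X ` S \<subseteq> V"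
    and r: "\<And>z x. z \<in> Z ` S \<Longrightarrow> x \<in> V \<Longrightarrow> 0 \<le> r z x" "\<And>w. w \<in> S \<Longrightarrow> 0 < p w \<Longrightarrow> 0 < r (Z w) (X w)"
      "\<And>z. z \<in> Z ` S \<Longrightarrow> (\<Sum>x\<in>V. r z x) \<le> 1"
  shows "ent (\<lambda>w. (X w, Z w)) - ent Z \<le> - (\<Sum>w\<in>S. p w * log 2 (r (Z w) (X w)))"
proof -
  let ?XZ = "\<lambda>w. (X w, Z w)"
  let ?t = "\<lambda>w. r (Z w) (X w) * pr Z (Z w) / pr ?XZ (?XZ w)"
  have t_pos: "0 < ?t w" if "w \<in> S" "0 < p w" for w
    using pr_pos[OF that, of ?XZ] pr_pos[OF that, of Z] r(2)[OF that] by simp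
  have "(\<Sum>w\<in>S. p w * ?t w) =
      (\<Sum>v\<in>V \<times> Z ` S. pr ?XZ v * (r (snd v) (fst v) * pr Z (snd v) / pr ?XZ v))"
    by (subst pr_expect) (use V fin in auto)
  also have "\<dots> \<le> (\<Sum>v\<in>V \<times> Z ` S. r (snd v) (fst v) * pr Z (snd v))"
    by (intro sum_mono) (auto simp: pr_nonneg r)
  also have "\<dots> = (\<Sum>z\<in>Z ` S. \<Sum>x\<in>V. r z x * pr Z z)"
    by (subst sum.swap) (simp add: sum.cartesian_product case_prod_beta)
  also have "\<dots> = (\<Sum>z\<in>Z ` S. (\<Sum>x\<in>V. r z x) * pr Z z)"
    by (simp add: sum_distrib_right)
  also have "\<dots> \<le> (\<Sum>z\<in>Z ` S. 1 * pr Z z)"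
    by (intro sum_mono mult_right_mono r(3) pr_nonneg)
  also have "\<dots> = 1" using pr_sum[of "Z ` S" Z] fin by simp
  finally have "(\<Sum>w\<in>S. p w * log 2 (?t w)) \<le> 0"
    by (intro sum_log_nonpos) (use fin nonneg t_pos total in auto)
  moreover have "p w * log 2 (?t w) = p w * log 2 (r (Z w) (X w)) + p w * log 2 (pr Z (Z w)) - p w * log 2 (pr ?XZ (?XZ w))"
    if "w \<in> S" for w
  proof (cases "p w = 0")
    case False
    then have "0 < p w" using nonneg[OF that] by simp
    then show ?thesis using pr_pos[OF that, of ?XZ] pr_pos[OF that, of Z] r(2)[OF that]
      by (simp add: log_mult log_divide algebra_simps)
  qed simp
  ultimately show ?thesis unfolding ent_def by (simp add: sum_subtractf sum.distrib)
qed

text \<open>Conditioning reduces entropy: the law of X given Z alone serves as a kernel for X given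
  (Y, Z).\<close>

lemma ent_submodular:
  "ent (\<lambda>w. (X w, Y w, Z w)) + ent Z \<le> ent (\<lambda>w. (X w, Z w)) + ent (\<lambda>w. (Y w, Z w))"
proof -
  let ?XZ = "\<lambda>w. (X w, Z w)"
  have "ent (\<lambda>w. (X w, (Y w, Z w))) - ent (\<lambda>w. (Y w, Z w)) \<le>
     - (\<Sum>w\<in>S. p w * log 2 ((\<lambda>yz x. pr ?XZ (x, snd yz) / pr Z (snd yz)) (Y w, Z w) (X w)))"
  proof (rule cross_entropy[of "X ` S"])
    fix yz assume "yz \<in> (\<lambda>w. (Y w, Z w)) ` S"
    have "(\<Sum>x\<in>X ` S. pr ?XZ (x, snd yz)) = pr Z (snd yz)" by (rule pr_marginal) (use fin in auto)
    then show "(\<Sum>x\<in>X ` S. pr ?XZ (x, snd yz) / pr Z (snd yz)) \<le> 1"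
      by (simp add: sum_divide_distrib[symmetric])
  qed (use fin pr_nonneg pr_pos[of _ ?XZ] pr_pos[of _ Z] in \<open>auto intro!: divide_nonneg_nonneg pr_nonneg\<close>)
  moreover have "p w * log 2 (pr ?XZ (X w, Z w) / pr Z (Z w)) =
     p w * log 2 (pr ?XZ (X w, Z w)) - p w * log 2 (pr Z (Z w))" if "w \<in> S" for w
  proof (cases "p w = 0")
    case False
    then have "0 < p w" using nonneg[OF that] by simp
    then show ?thesis using pr_pos[OF that, of ?XZ] pr_pos[OF that, of Z]
      by (simp add: log_divide algebra_simps)
  qed simp
  ultimately show ?thesis unfolding ent_def by (simp add: sum_subtractf)
qed

lemma ent_xlog:
  assumes "finite V" "X ` S \<subseteq> V"
  shows "ent X = - (\<Sum>v\<in>V. xlog (pr X v))"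
  using pr_expect[OF assms, of "\<lambda>v. log 2 (pr X v)"] by (simp add: ent_def xlog_def)

text \<open>Links the sums in the definitions to entropies of random variables, so that the chain
  rules of the converse can be carried out with \<open>ent\<close> alone.\<close>

lemma cond_mutual_info_law:
  assumes fins: "finite A" "finite B" "finite C" and "X ` S \<subseteq> A" "Y ` S \<subseteq> B" "Z ` S \<subseteq> C"
    and q: "\<And>a b c. a \<in> A \<Longrightarrow> b \<in> B \<Longrightarrow> c \<in> C \<Longrightarrow> q a b c = pr (\<lambda>w. (X w, Y w, Z w)) (a, b, c)"
  shows "cond_mutual_info A B C q =
    ent (\<lambda>w. (X w, Z w)) + ent (\<lambda>w. (Y w, Z w)) - ent (\<lambda>w. (X w, Y w, Z w)) - ent Z"
proof -
  let ?XYZ = "\<lambda>w. (X w, Y w, Z w)" and ?XZ = "\<lambda>w. (X w, Z w)" and ?YZ = "\<lambda>w. (Y w, Z w)"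
  have qac: "(\<Sum>b\<in>B. q a b c) = pr ?XZ (a, c)" if "a \<in> A" "c \<in> C" for a c
  proof -
    have "(\<Sum>b\<in>B. q a b c) = (\<Sum>b\<in>B. pr (\<lambda>w. (Y w, X w, Z w)) (b, a, c))"
      by (intro sum.cong refl) (auto simp: q that intro: pr_cong)
    then show ?thesis using pr_marginal[of B Y ?XZ "(a, c)"] assms by simp
  qed
  have qbc: "(\<Sum>a\<in>A. q a b c) = pr ?YZ (b, c)" if "b \<in> B" "c \<in> C" for b c
    using pr_marginal[of A X ?YZ "(b, c)"] assms that by simp
  have qc: "(\<Sum>a\<in>A. \<Sum>b\<in>B. q a b c) = pr Z c" if "c \<in> C" for c
  proof -
    have "(\<Sum>a\<in>A. \<Sum>b\<in>B. q a b c) = (\<Sum>a\<in>A. pr ?XZ (a, c))"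
      by (intro sum.cong refl qac that)
    then show ?thesis using pr_marginal[of A X Z c] assms by simp
  qed
  have "ent ?XYZ = - (\<Sum>a\<in>A. \<Sum>b\<in>B. \<Sum>c\<in>C. xlog (q a b c))"
    by (subst ent_xlog[of "A \<times> B \<times> C"]) (use assms in \<open>auto simp: sum.cartesian_product' q\<close>)
  moreover have "ent ?XZ = - (\<Sum>a\<in>A. \<Sum>c\<in>C. xlog (\<Sum>b\<in>B. q a b c))"
    by (subst ent_xlog[of "A \<times> C"]) (use assms(1-6) in \<open>auto simp: sum.cartesian_product' qac\<close>)
  moreover have "ent ?YZ = - (\<Sum>b\<in>B. \<Sum>c\<in>C. xlog (\<Sum>a\<in>A. q a b c))"
    by (subst ent_xlog[of "B \<times> C"]) (use assms(1-6) in \<open>auto simp: sum.cartesian_product' qbc\<close>)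
  moreover have "ent Z = - (\<Sum>c\<in>C. xlog (\<Sum>a\<in>A. \<Sum>b\<in>B. q a b c))"
    by (subst ent_xlog[of C]) (use assms(1-6) in \<open>auto simp: qc\<close>)
  moreover have "cond_mutual_info A B C q = (\<Sum>a\<in>A. \<Sum>b\<in>B. \<Sum>c\<in>C. xlog (q a b c))
    + (\<Sum>c\<in>C. xlog (\<Sum>a\<in>A. \<Sum>b\<in>B. q a b c))
    - (\<Sum>a\<in>A. \<Sum>c\<in>C. xlog (\<Sum>b\<in>B. q a b c)) - (\<Sum>b\<in>B. \<Sum>c\<in>C. xlog (\<Sum>a\<in>A. q a b c))"
    by (rule cond_mutual_info_xlog[OF fins]) (simp add: q pr_nonneg)
  ultimately show ?thesis by simp
qed

lemma mutual_info_law: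
  assumes "finite A" "finite B" "X ` S \<subseteq> A" "Y ` S \<subseteq> B"
    and q: "\<And>a b. a \<in> A \<Longrightarrow> b \<in> B \<Longrightarrow> q a b = pr (\<lambda>w. (X w, Y w)) (a, b)"
  shows "mutual_info A B q = ent X + ent Y - ent (\<lambda>w. (X w, Y w))"
proof -
  have "(\<Sum>a\<in>A. \<Sum>b\<in>B. q a b) = (\<Sum>v\<in>A \<times> B. pr (\<lambda>w. (X w, Y w)) v)"
    by (simp add: sum.cartesian_product' q)
  also have "\<dots> = 1" by (rule pr_sum) (use assms in auto)
  finally have "mutual_info A B q = cond_mutual_info A B {()} (\<lambda>a b _. q a b)"
    by (rule mutual_info_eq_cond[OF assms(1,2)])
  also have "\<dots> = ent (\<lambda>w. (X w, ())) + ent (\<lambda>w. (Y w, ())) - ent (\<lambda>w. (X w, Y w, ())) - ent (\<lambda>_. ())"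
    by (rule cond_mutual_info_law) (use assms(1-4) in \<open>auto simp: q intro: pr_cong\<close>)
  also have "ent (\<lambda>w. (X w, ())) = ent X" by (rule ent_cong) auto
  also have "ent (\<lambda>w. (Y w, ())) = ent Y" by (rule ent_cong) auto
  also have "ent (\<lambda>w. (X w, Y w, ())) = ent (\<lambda>w. (X w, Y w))" by (rule ent_cong) auto
  also have "ent (\<lambda>_. ()) = 0" by (simp add: ent_def pr_def total)
  finally show ?thesis by simp
qed

end

subsection \<open>The converse\<close>

text \<open>The usual time-sharing device: \<open>T\<close> adjoins a uniform time index independent
  of the sample, and single-letter laws become averages over the coordinates.\<close>

locale finite_pmf_time = finite_pmf +
  fixes n :: nat
  assumes n_pos: "1 \<le> n"
begin

sublocale T: finite_pmf "{..<n} \<times> S" "\<lambda>iw. p (snd iw) / real n"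
proof
  show "(\<Sum>iw\<in>{..<n} \<times> S. p (snd iw) / real n) = 1"
    using n_pos total by (simp add: sum.cartesian_product' sum_divide_distrib[symmetric])
qed (use fin nonneg in auto)

lemma T_expect: "(\<Sum>iw\<in>{..<n} \<times> S. p (snd iw) / real n * \<phi> iw) = (\<Sum>w\<in>S. p w * (\<Sum>i<n. \<phi> (i, w))) / real n"
  by (simp add: sum.cartesian_product' sum_divide_distrib sum_distrib_left sum.swap[of _ S])

lemma T_pr: "T.pr X v = (\<Sum>i<n. pr (\<lambda>w. X (i, w)) v) / real n"
proof -
  have "{iw \<in> {..<n} \<times> S. X iw = v} = (SIGMA i:{..<n}. {w \<in> S. X (i, w) = v})" by auto
  then have "T.pr X v = (\<Sum>(i, w)\<in>(SIGMA i:{..<n}. {w \<in> S. X (i, w) = v}). p w / real n)"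
    unfolding T.pr_def by (simp add: case_prod_beta')
  then show ?thesis unfolding pr_def
    by (simp add: sum.Sigma[symmetric] fin sum_divide_distrib)
qed

text \<open>Chain rule for the time index, whose entropy is log n. In the information quantities
  below this term occurs equally often with both signs and cancels.\<close>

lemma T_ent_time:
  "T.ent (\<lambda>iw. (fst iw, X iw)) = log 2 (real n) + (\<Sum>i<n. ent (\<lambda>w. X (i, w))) / real n"
proof -
  have pr_eq: "T.pr (\<lambda>iw. (fst iw, X iw)) (i, v) = pr (\<lambda>w. X (i, w)) v / real n" if "i < n" for i v
  proof -
    have "pr (\<lambda>w. (j, X (j, w))) (i, v) = (if j = i then pr (\<lambda>w. X (i, w)) v else 0)" for j
      unfolding pr_def by auto
    then show ?thesis using that by (simp add: T_pr)
  qed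
  have "p w * log 2 (pr (\<lambda>w. X (i, w)) (X (i, w)) / real n) =
      p w * log 2 (pr (\<lambda>w. X (i, w)) (X (i, w))) - p w * log 2 (real n)" if "w \<in> S" for i w
  proof (cases "p w = 0")
    case False
    then have "0 < p w" using nonneg[OF that] by simp
    then show ?thesis using pr_pos[OF that, of "\<lambda>w. X (i, w)"] n_pos
      by (simp add: log_divide algebra_simps)
  qed simp
  moreover have "T.ent (\<lambda>iw. (fst iw, X iw)) =
      - (\<Sum>iw\<in>{..<n} \<times> S. p (snd iw) / real n * log 2 (pr (\<lambda>w. X (fst iw, w)) (X iw) / real n))"
    unfolding T.ent_def by (intro arg_cong[where f=uminus] sum.cong refl) (auto simp: pr_eq)
  ultimately have "T.ent (\<lambda>iw. (fst iw, X iw)) =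
      - (\<Sum>w\<in>S. \<Sum>i<n. p w * log 2 (pr (\<lambda>w. X (i, w)) (X (i, w))) - p w * log 2 (real n)) / real n"
    by (simp only: T_expect) (simp add: sum_distrib_left)
  also have "\<dots> = - ((\<Sum>i<n. \<Sum>w\<in>S. p w * log 2 (pr (\<lambda>w. X (i, w)) (X (i, w)))) - real n * log 2 (real n) * sum p S) / real n"
    by (subst sum.swap) (simp add: sum_subtractf sum_distrib_left[symmetric] sum_distrib_right[symmetric])
  also have "\<dots> = log 2 (real n) + (\<Sum>i<n. ent (\<lambda>w. X (i, w))) / real n"
    using n_pos by (simp add: total ent_def sum_negf diff_divide_distrib)
  finally show ?thesis .
qed

end

text \<open>\<open>e\<close> numbers the values \<open>(i, M, Y\<^sub>1 \<dots> Y\<^sub>i\<^sub>-\<^sub>1)\<close> of the auxiliary letter, whose first component is a uniform time index.\<close>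

locale helper_code =
  fixes QY :: "'y::finite \<Rightarrow> real" and n M k :: nat and f :: "'y list \<Rightarrow> nat"
    and e :: "nat \<times> nat \<times> 'y list \<Rightarrow> nat"
  assumes QY: "pmf_on UNIV QY" and n: "1 \<le> n" and f: "\<And>ys. length ys = n \<Longrightarrow> f ys < M"
    and e: "bij_betw e ({..<n} \<times> {..<M} \<times> {a. length a \<le> n}) {..<k}"
begin

definition Ys where "Ys = {ys :: 'y list. length ys = n}"

definition pY where "pY ys = (\<Prod>i<n. QY (ys ! i))"

definition U where "U i ys = e (i, f ys, take i ys)"

lemma finite_Ys: "finite Ys"
  unfolding Ys_def using finite_lists_length_eq[of "UNIV :: 'y set" n] by simp

lemma take_Suc_Ys: "xs \<in> Ys \<Longrightarrow> ys \<in> Ys \<Longrightarrow> i < n \<Longrightarrow>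
    take (Suc i) xs = take (Suc i) ys \<longleftrightarrow> take i xs = take i ys \<and> xs ! i = ys ! i"
  by (auto simp: Ys_def take_Suc_conv_app_nth)

lemma QY_nonneg: "0 \<le> QY y" and QY_sum: "(\<Sum>y\<in>UNIV. QY y) = 1"
  using QY by (auto simp: pmf_on_def)

lemma pY_sum: "(\<Sum>ys\<in>{ys\<in>Ys. \<forall>i<n. ys ! i \<in> C i}. pY ys) = (\<Prod>i<n. \<Sum>c\<in>C i. QY c)"
  using sum_lists_prod[of n C "\<lambda>_. QY"] by (simp add: Ys_def pY_def)

sublocale Y: finite_pmf_time Ys pY n
proof
  show "sum pY Ys = 1" using pY_sum[of "\<lambda>_. UNIV"] QY_sum by simp
qed (use n in \<open>auto simp: finite_Ys pY_def QY_nonneg intro!: prod_nonneg\<close>)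

lemma U_less: "i < n \<Longrightarrow> ys \<in> Ys \<Longrightarrow> U i ys < k"
  using bij_betw_apply[OF e, of "(i, f ys, take i ys)"] f[of ys] by (auto simp: U_def Ys_def)

lemma U_eq_iff:
  assumes "i < n" "ys \<in> Ys" "j < n" "zs \<in> Ys"
  shows "U i ys = U j zs \<longleftrightarrow> i = j \<and> f ys = f zs \<and> take i ys = take i zs"
proof -
  have "inj_on e ({..<n} \<times> {..<M} \<times> {a. length a \<le> n})" using e by (rule bij_betw_imp_inj_on)
  then have "e (i, f ys, take i ys) = e (j, f zs, take j zs) \<longleftrightarrow>
      (i, f ys, take i ys) = (j, f zs, take j zs)"
    by (rule inj_on_eq_iff) (use assms f in \<open>auto simp: Ys_def\<close>)
  then show ?thesis by (auto simp: U_def)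
qed

lemma Y_coord: "i < n \<Longrightarrow> Y.pr (\<lambda>ys. ys ! i) y = QY y"
proof -
  assume i: "i < n"
  have "{ys \<in> Ys. ys ! i = y} = {ys \<in> Ys. \<forall>j<n. ys ! j \<in> (if j = i then {y} else UNIV)}"
    using i by auto
  then have "Y.pr (\<lambda>ys. ys ! i) y = (\<Prod>j<n. \<Sum>c\<in>(if j = i then {y} else UNIV). QY c)"
    unfolding Y.pr_def by (simp only: pY_sum)
  also have "\<dots> = (\<Prod>j<n. if j = i then QY y else 1)"
    by (intro prod.cong) (auto simp: QY_sum)
  finally show ?thesis using i by simp
qed

lemma T_coord: "Y.T.pr (\<lambda>iw. snd iw ! fst iw) y = QY y"
  using n by (simp add: Y.T_pr Y_coord)

definition hY where "hY = - (\<Sum>y\<in>UNIV. QY y * log 2 (QY y))"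

lemma ent_T_coord: "Y.T.ent (\<lambda>iw. snd iw ! fst iw) = hY"
proof -
  have "(\<Sum>y\<in>UNIV. Y.T.pr (\<lambda>iw. snd iw ! fst iw) y * log 2 (QY y)) =
    (\<Sum>w\<in>{..<n} \<times> Ys. pY (snd w) / real n * log 2 (QY (snd w ! fst w)))"
    by (rule Y.T.pr_expect) auto
  then show ?thesis by (simp add: Y.T.ent_def hY_def T_coord)
qed

lemma ent_Ys: "Y.ent (\<lambda>ys. ys) = real n * hY"
proof -
  have E: "(\<Sum>ys\<in>Ys. pY ys * log 2 (QY (ys ! i))) = - hY" if "i < n" for i
    using Y.pr_expect[of UNIV "\<lambda>ys. ys ! i" "\<lambda>y. log 2 (QY y)"] that by (simp add: hY_def Y_coord)
  have "pY ys * log 2 (Y.pr (\<lambda>ys. ys) ys) = (\<Sum>i<n. pY ys * log 2 (QY (ys ! i)))" if "ys \<in> Ys" for ys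
  proof -
    have "{w \<in> Ys. w = ys} = {ys}" using that by auto
    then have "Y.pr (\<lambda>ys. ys) ys = pY ys" by (simp add: Y.pr_def)
    moreover have "log 2 (pY ys) = (\<Sum>i<n. log 2 (QY (ys ! i)))" if "pY ys \<noteq> 0"
    proof -
      have pos: "0 < QY (ys ! i)" if "i < n" for i
        using \<open>pY ys \<noteq> 0\<close> that QY_nonneg[of "ys ! i"] by (auto simp: pY_def less_le)
      have "ln (pY ys) = (\<Sum>i<n. ln (QY (ys ! i)))"
        unfolding pY_def by (rule ln_prod) (auto dest: pos)
      then show ?thesis by (simp add: log_def sum_divide_distrib)
    qed
    ultimately show ?thesis by (cases "pY ys = 0") (simp_all add: sum_distrib_left)
  qed
  then have "Y.ent (\<lambda>ys. ys) = - (\<Sum>ys\<in>Ys. \<Sum>i<n. pY ys * log 2 (QY (ys ! i)))"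
    by (simp add: Y.ent_def)
  also have "\<dots> = - (\<Sum>i<n. - hY)" by (subst sum.swap) (simp add: E)
  finally show ?thesis by simp
qed

definition J where "J y u = Y.T.pr (\<lambda>iw. (snd iw ! fst iw, U (fst iw) (snd iw))) (y, u)"

text \<open>The conditional law of U given Y for the time-averaged pair. It is built from the helper
  and \<open>QY\<close>, without \<open>W\<close>. Where \<open>QY y\<close> vanishes, a point mass
  at the letter 0 keeps it a PMF.\<close>

definition V where "V y u = (if QY y = 0 then if u = 0 then 1 else 0 else J y u / QY y)"

lemma J_le: "J y u \<le> QY y"
proof -
  have "J y u \<le> Y.T.pr (\<lambda>iw. snd iw ! fst iw) y" unfolding J_def by (rule Y.T.pr_mono) auto
  then show ?thesis by (simp add: T_coord)
qed

lemma J_nonneg: "0 \<le> J y u"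
  unfolding J_def by (rule Y.T.pr_nonneg)

lemma QY_V: "QY y * V y u = J y u"
  using J_le[of y u] J_nonneg[of y u] by (auto simp: V_def)

lemma J_sum: "(\<Sum>u<k. J y u) = QY y"
proof -
  have "(\<Sum>u<k. J y u) = (\<Sum>u<k. Y.T.pr (\<lambda>iw. (U (fst iw) (snd iw), snd iw ! fst iw)) (u, y))"
    unfolding J_def by (intro sum.cong refl Y.T.pr_cong) auto
  also have "\<dots> = QY y"
    by (subst Y.T.pr_marginal) (auto simp: T_coord U_less)
  finally show ?thesis .
qed

lemma M_pos: "0 < M" using f[of "replicate n undefined"] by auto

lemma k_pos: "1 \<le> k"
  using U_less[of 0 "replicate n undefined"] n by (auto simp: Ys_def)

lemma J_outside: "k \<le> u \<Longrightarrow> J y u = 0"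
proof -
  assume u: "k \<le> u"
  have "{iw \<in> {..<n} \<times> Ys. (snd iw ! fst iw, U (fst iw) (snd iw)) = (y, u)} = {}"
    using u U_less by fastforce
  then show ?thesis unfolding J_def Y.T.pr_def by (simp only: sum.empty)
qed

lemma V_pmf: "pmf_on {..<k} (V y)"
proof (cases "QY y = 0")
  case True
  then show ?thesis using k_pos unfolding pmf_on_def by (auto simp: V_def)
next
  case False
  then show ?thesis using J_nonneg[of y] J_outside J_sum[of y] QY_nonneg[of y]
    by (auto simp: pmf_on_def V_def sum_divide_distrib[symmetric])
qed

lemma ent_U: "Y.T.ent (\<lambda>iw. U (fst iw) (snd iw)) =
    log 2 n + (\<Sum>i<n. Y.ent (\<lambda>ys. (f ys, take i ys))) / n"
proof -
  have "Y.T.ent (\<lambda>iw. U (fst iw) (snd iw)) = Y.T.ent (\<lambda>iw. (fst iw, f (snd iw), take (fst iw) (snd iw)))"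
    by (rule Y.T.ent_cong) (auto simp: U_eq_iff)
  then show ?thesis by (simp add: Y.T_ent_time)
qed

text \<open>The auxiliary letter already contains the time, the description and the past, so
  adjoining Y_T just extends the past by one letter.\<close>

lemma ent_coord_U: "Y.T.ent (\<lambda>iw. (snd iw ! fst iw, U (fst iw) (snd iw))) =
    log 2 n + (\<Sum>i<n. Y.ent (\<lambda>ys. (f ys, take (Suc i) ys))) / n"
proof -
  have "Y.T.ent (\<lambda>iw. (snd iw ! fst iw, U (fst iw) (snd iw))) =
      Y.T.ent (\<lambda>iw. (fst iw, f (snd iw), take (Suc (fst iw)) (snd iw)))"
    by (rule Y.T.ent_cong) (auto simp: U_eq_iff take_Suc_Ys)
  then show ?thesis by (simp add: Y.T_ent_time)
qed

lemma ent_f: "Y.ent f \<le> log 2 M"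
proof -
  have "Y.ent (\<lambda>ys. (f ys, ())) - Y.ent (\<lambda>_. ()) \<le> - (\<Sum>ys\<in>Ys. pY ys * log 2 (1 / real M))"
    by (rule Y.cross_entropy[of "{..<M}"]) (use f M_pos in \<open>auto simp: Ys_def\<close>)
  moreover have "Y.ent (\<lambda>ys. (f ys, ())) = Y.ent f" by (rule Y.ent_cong) auto
  moreover have "Y.ent (\<lambda>_. ()) = 0" by (simp add: Y.ent_def Y.pr_def Y.total)
  moreover have "(\<Sum>ys\<in>Ys. pY ys * log 2 (1 / real M)) = - log 2 M"
    using M_pos by (simp add: sum_distrib_right[symmetric] Y.total log_divide sum_negf)
  ultimately show ?thesis by simp
qed

text \<open>The conditional entropies H(Y_i | M, Y_1 ... Y_{i-1}) add up to H(Y^n) - H(M), as M is a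
  function of Y^n. Since H(Y^n) = n H(Y), the information between Y and U is exactly H(M) /
  n.\<close>

lemma mutual_info_bound: "mutual_info UNIV {..<k} (\<lambda>y u. QY y * V y u) \<le> log 2 M / n"
proof -
  have "mutual_info UNIV {..<k} (\<lambda>y u. QY y * V y u) =
    hY + Y.T.ent (\<lambda>iw. U (fst iw) (snd iw)) - Y.T.ent (\<lambda>iw. (snd iw ! fst iw, U (fst iw) (snd iw)))"
    unfolding ent_T_coord[symmetric]
    by (rule Y.T.mutual_info_law) (auto simp: QY_V J_def U_less)
  also have "\<dots> = hY - (\<Sum>i<n. Y.ent (\<lambda>ys. (f ys, take (Suc i) ys)) - Y.ent (\<lambda>ys. (f ys, take i ys))) / n"
    unfolding ent_U ent_coord_U by (simp add: sum_subtractf diff_divide_distrib)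
  also have "\<dots> = hY - (Y.ent (\<lambda>ys. (f ys, take n ys)) - Y.ent (\<lambda>ys. (f ys, take 0 ys))) / n"
    by (subst sum_lessThan_telescope) simp
  also have "Y.ent (\<lambda>ys. (f ys, take n ys)) = Y.ent (\<lambda>ys. ys)"
    by (rule Y.ent_cong) (auto simp: Ys_def)
  also have "Y.ent (\<lambda>ys. (f ys, take 0 ys)) = Y.ent f"
    by (rule Y.ent_cong) auto
  also have "hY - (Y.ent (\<lambda>ys. ys) - Y.ent f) / n = Y.ent f / n"
    using n by (simp add: ent_Ys diff_divide_distrib)
  also have "\<dots> \<le> log 2 M / n" by (intro divide_right_mono ent_f) simp
  finally show ?thesis .
qed

end

section \<open>The channel from (Y_i, U_i) to X_i and the single-letter bounds\<close>

locale guessing_test_channel = helper_code QY n M k f e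
  for QY :: "'y::finite \<Rightarrow> real" and n M k f e +
  fixes W :: "'y \<Rightarrow> nat \<Rightarrow> 'x::finite \<Rightarrow> real"
  assumes W: "\<And>y u. u < k \<Longrightarrow> pmf_on UNIV (W y u)"
begin

definition Xs where "Xs = {xs :: 'x list. length xs = n}"

definition pX where "pX ys xs = (\<Prod>i<n. W (ys ! i) (U i ys) (xs ! i))"

definition pXY where "pXY w = pY (snd w) * pX (snd w) (fst w)"

lemma finite_Xs: "finite Xs"
  unfolding Xs_def using finite_lists_length_eq[of "UNIV :: 'x set" n] by simp

lemma take_Suc_Xs: "xs \<in> Xs \<Longrightarrow> ys \<in> Xs \<Longrightarrow> i < n \<Longrightarrow>
    take (Suc i) xs = take (Suc i) ys \<longleftrightarrow> take i xs = take i ys \<and> xs ! i = ys ! i"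
  by (auto simp: Xs_def take_Suc_conv_app_nth)

lemma W_nonneg: "u < k \<Longrightarrow> 0 \<le> W y u x" and W_sum: "u < k \<Longrightarrow> (\<Sum>x\<in>UNIV. W y u x) = 1"
  using W by (auto simp: pmf_on_def)

lemma pX_sum: "(\<Sum>xs\<in>{xs\<in>Xs. \<forall>i<n. xs ! i \<in> C i}. pX ys xs) = (\<Prod>i<n. \<Sum>c\<in>C i. W (ys ! i) (U i ys) c)"
  using sum_lists_prod[of n C "\<lambda>i. W (ys ! i) (U i ys)"] by (simp add: Xs_def pX_def)

lemma pX_total: "ys \<in> Ys \<Longrightarrow> (\<Sum>xs\<in>Xs. pX ys xs) = 1"
  using pX_sum[where C="\<lambda>_. UNIV" and ys=ys] by (simp add: W_sum U_less)

lemma pX_nonneg: "ys \<in> Ys \<Longrightarrow> 0 \<le> pX ys xs"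
  unfolding pX_def by (intro prod_nonneg) (auto simp: W_nonneg U_less)

lemma pX_coord: "ys \<in> Ys \<Longrightarrow> i < n \<Longrightarrow> (\<Sum>xs\<in>{xs\<in>Xs. xs ! i = c}. pX ys xs) = W (ys ! i) (U i ys) c"
proof -
  assume ys: "ys \<in> Ys" and i: "i < n"
  have "{xs \<in> Xs. xs ! i = c} = {xs \<in> Xs. \<forall>j<n. xs ! j \<in> (if j = i then {c} else UNIV)}"
    using i by auto
  then have "(\<Sum>xs\<in>{xs\<in>Xs. xs ! i = c}. pX ys xs) =
      (\<Prod>j<n. \<Sum>c\<in>(if j = i then {c} else UNIV). W (ys ! j) (U j ys) c)"
    by (simp only: pX_sum)
  also have "\<dots> = (\<Prod>j<n. if j = i then W (ys ! i) (U i ys) c else 1)"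
    by (intro prod.cong) (auto simp: W_sum U_less ys)
  finally show ?thesis using i by simp
qed

text \<open>Given y the letters of X are independent, so the factors beyond position i sum to
  1.\<close>

lemma pX_take: "ys \<in> Ys \<Longrightarrow> i \<le> n \<Longrightarrow> length b = i \<Longrightarrow>
    (\<Sum>xs\<in>{xs\<in>Xs. take i xs = b}. pX ys xs) = (\<Prod>j<i. W (ys ! j) (U j ys) (b ! j))"
proof -
  assume ys: "ys \<in> Ys" and i: "i \<le> n" and b: "length b = i"
  have "take i xs = b \<longleftrightarrow> (\<forall>j<i. xs ! j = b ! j)" if "xs \<in> Xs" for xs
    using that b i by (auto simp: Xs_def list_eq_iff_nth_eq)
  then have "{xs \<in> Xs. take i xs = b} = {xs \<in> Xs. \<forall>j<n. xs ! j \<in> (if j < i then {b ! j} else UNIV)}"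
    using i by auto
  then have "(\<Sum>xs\<in>{xs\<in>Xs. take i xs = b}. pX ys xs) =
      (\<Prod>j<n. \<Sum>c\<in>(if j < i then {b ! j} else UNIV). W (ys ! j) (U j ys) c)"
    by (simp only: pX_sum)
  also have "\<dots> = (\<Prod>j<n. if j < i then W (ys ! j) (U j ys) (b ! j) else 1)"
    by (intro prod.cong) (auto simp: W_sum U_less ys)
  also have "\<dots> = (\<Prod>j\<in>{..<n} \<inter> {j. j < i}. W (ys ! j) (U j ys) (b ! j))"
    by (simp add: prod.If_cases)
  also have "{..<n} \<inter> {j. j < i} = {..<i}" using i by auto
  finally show ?thesis .
qed

sublocale XY: finite_pmf_time "Xs \<times> Ys" pXY n
proof
  have "sum pXY (Xs \<times> Ys) = (\<Sum>ys\<in>Ys. pY ys * (\<Sum>xs\<in>Xs. pX ys xs))"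
    by (simp add: pXY_def sum.cartesian_product' sum_distrib_left sum.swap[of _ Xs])
  then show "sum pXY (Xs \<times> Ys) = 1" using Y.total by (simp add: pX_total)
qed (use finite_Xs finite_Ys n Y.nonneg pX_nonneg in \<open>auto simp: pXY_def\<close>)

lemma pr_fibre:
  assumes "\<And>xs ys. xs \<in> Xs \<Longrightarrow> ys \<in> Ys \<Longrightarrow> X (xs, ys) = v \<longleftrightarrow> ys \<in> B \<and> xs \<in> A ys"
    and "B \<subseteq> Ys" "\<And>ys. A ys \<subseteq> Xs"
  shows "XY.pr X v = (\<Sum>ys\<in>B. pY ys * (\<Sum>xs\<in>A ys. pX ys xs))"
proof -
  have fins: "finite B" "\<And>ys. finite (A ys)"
    using assms(2,3) finite_Ys finite_Xs by (auto intro: finite_subset)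
  have "{w \<in> Xs \<times> Ys. X w = v} = (\<lambda>(ys, xs). (xs, ys)) ` (Sigma B A)"
    using assms by (auto simp: image_iff) blast+
  then have "XY.pr X v = (\<Sum>(ys, xs)\<in>Sigma B A. pY ys * pX ys xs)"
    unfolding XY.pr_def
    by (simp add: sum.reindex inj_on_def pXY_def case_prod_beta)
  also have "\<dots> = (\<Sum>ys\<in>B. pY ys * (\<Sum>xs\<in>A ys. pX ys xs))"
    by (simp add: sum.Sigma[symmetric] fins sum_distrib_left)
  finally show ?thesis .
qed

abbreviation A where "A i w \<equiv> (f (snd w), take i (snd w))"
abbreviation B where "B i w \<equiv> (f (snd w), take i (snd w), take i (fst w))"

text \<open>Given the description and the past of \<open>Y\<close>, the letter \<open>X\<^sub>i\<close> is independent of the past of \<open>X\<close>.\<close>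

lemma ent_Markov:
  assumes i: "i < n"
  shows "XY.ent (\<lambda>w. (fst w ! i, A i w)) - XY.ent (A i) = XY.ent (\<lambda>w. (fst w ! i, B i w)) - XY.ent (B i)"
proof -
  have key: "pXY w * log 2 (XY.pr (\<lambda>w. (fst w ! i, A i w)) (fst w ! i, A i w)) - pXY w * log 2 (XY.pr (A i) (A i w)) =
      pXY w * log 2 (XY.pr (\<lambda>w. (fst w ! i, B i w)) (fst w ! i, B i w)) - pXY w * log 2 (XY.pr (B i) (B i w))"
    if w: "w \<in> Xs \<times> Ys" for w
  proof (cases "pXY w = 0")
    case False
    then have pos: "0 < pXY w" using XY.nonneg[OF w] by simp
    obtain x0 y0 where w0: "w = (x0, y0)" "x0 \<in> Xs" "y0 \<in> Ys" using w by auto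
    define F where "F = {ys\<in>Ys. f ys = f y0 \<and> take i ys = take i y0}"
    \<comment> \<open>The probability \<open>r\<close> of the past of X is the same for all y in
      \<open>F\<close>, because for j < i both y_j and U_j are determined by the description and the
      first i letters. Hence the four probabilities are \<open>\<alpha>\<close>,
      \<open>\<beta>\<close>, \<open>\<alpha> * r\<close> and \<open>\<beta> * r\<close>, and
      \<open>r\<close> cancels from the two conditional probabilities.\<close>
    define r where "r = (\<Prod>j<i. W (y0 ! j) (e (j, f y0, take j y0)) (x0 ! j))"
    define \<alpha> where "\<alpha> = (\<Sum>ys\<in>F. pY ys)"
    define \<beta> where "\<beta> = (\<Sum>ys\<in>F. pY ys * W (ys ! i) (U i ys) (x0 ! i))"
    have F: "F \<subseteq> Ys" by (auto simp: F_def)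
    have past: "(\<Prod>j<i. W (ys ! j) (U j ys) (x0 ! j)) = r" if "ys \<in> F" for ys
      unfolding r_def
    proof (intro prod.cong refl)
      fix j assume "j \<in> {..<i}"
      then have "take j (take i ys) = take j (take i y0)" "ys ! j = y0 ! j"
        using that by (auto simp: F_def) (metis nth_take)
      then show "W (ys ! j) (U j ys) (x0 ! j) = W (y0 ! j) (e (j, f y0, take j y0)) (x0 ! j)"
        using \<open>j \<in> {..<i}\<close> that by (auto simp: U_def F_def min_def)
    qed
    have len: "length x0 = n" using w0 by (simp add: Xs_def)
    have "XY.pr (A i) (A i w) = (\<Sum>ys\<in>F. pY ys * (\<Sum>xs\<in>Xs. pX ys xs))"
      by (rule pr_fibre) (auto simp: F_def w0)
    then have 1: "XY.pr (A i) (A i w) = \<alpha>"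
      using F by (auto simp: \<alpha>_def pX_total subset_iff)
    have "XY.pr (\<lambda>w. (fst w ! i, A i w)) (fst w ! i, A i w) =
        (\<Sum>ys\<in>F. pY ys * (\<Sum>xs\<in>{xs\<in>Xs. xs ! i = x0 ! i}. pX ys xs))"
      by (rule pr_fibre) (auto simp: F_def w0)
    then have 2: "XY.pr (\<lambda>w. (fst w ! i, A i w)) (fst w ! i, A i w) = \<beta>"
      using F i by (auto simp: \<beta>_def pX_coord subset_iff)
    have "XY.pr (B i) (B i w) = (\<Sum>ys\<in>F. pY ys * (\<Sum>xs\<in>{xs\<in>Xs. take i xs = take i x0}. pX ys xs))"
      by (rule pr_fibre) (auto simp: F_def w0)
    also have "\<dots> = (\<Sum>ys\<in>F. pY ys * r)"
    proof (intro sum.cong refl)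
      fix ys assume ys: "ys \<in> F"
      have "(\<Sum>xs\<in>{xs\<in>Xs. take i xs = take i x0}. pX ys xs) = (\<Prod>j<i. W (ys ! j) (U j ys) (take i x0 ! j))"
        by (rule pX_take) (use ys F i len in auto)
      then show "pY ys * (\<Sum>xs\<in>{xs\<in>Xs. take i xs = take i x0}. pX ys xs) = pY ys * r"
        using past[OF ys] by simp
    qed
    finally have 3: "XY.pr (B i) (B i w) = \<alpha> * r" by (simp add: \<alpha>_def sum_distrib_right)
    have "XY.pr (\<lambda>w. (fst w ! i, B i w)) (fst w ! i, B i w) =
        (\<Sum>ys\<in>F. pY ys * (\<Sum>xs\<in>{xs\<in>Xs. take (Suc i) xs = take (Suc i) x0}. pX ys xs))"
      by (rule pr_fibre) (use w0 i in \<open>auto simp: F_def take_Suc_Xs\<close>)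
    also have "\<dots> = (\<Sum>ys\<in>F. pY ys * W (ys ! i) (U i ys) (x0 ! i) * r)"
    proof (intro sum.cong refl)
      fix ys assume ys: "ys \<in> F"
      have "(\<Sum>xs\<in>{xs\<in>Xs. take (Suc i) xs = take (Suc i) x0}. pX ys xs) =
          (\<Prod>j<Suc i. W (ys ! j) (U j ys) (take (Suc i) x0 ! j))"
        by (rule pX_take) (use ys F i len in auto)
      then show "pY ys * (\<Sum>xs\<in>{xs\<in>Xs. take (Suc i) xs = take (Suc i) x0}. pX ys xs) =
          pY ys * W (ys ! i) (U i ys) (x0 ! i) * r"
        using past[OF ys] by simp
    qed
    finally have 4: "XY.pr (\<lambda>w. (fst w ! i, B i w)) (fst w ! i, B i w) = \<beta> * r"
      by (simp add: \<beta>_def sum_distrib_right)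
    have "0 < \<alpha>" "0 < \<beta>" "0 < \<alpha> * r"
      using XY.pr_pos[OF w pos, of "A i"] XY.pr_pos[OF w pos, of "\<lambda>w. (fst w ! i, A i w)"]
        XY.pr_pos[OF w pos, of "B i"] 1 2 3 by auto
    then show ?thesis unfolding 1 2 3 4 by (simp add: log_mult zero_less_mult_iff algebra_simps)
  qed simp
  have "(\<Sum>w\<in>Xs \<times> Ys. pXY w * log 2 (XY.pr (\<lambda>w. (fst w ! i, A i w)) (fst w ! i, A i w)) - pXY w * log 2 (XY.pr (A i) (A i w))) =
      (\<Sum>w\<in>Xs \<times> Ys. pXY w * log 2 (XY.pr (\<lambda>w. (fst w ! i, B i w)) (fst w ! i, B i w)) - pXY w * log 2 (XY.pr (B i) (B i w)))"
    by (rule sum.cong[OF refl key])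
  then show ?thesis unfolding XY.ent_def by (simp add: sum_subtractf)
qed

text \<open>In terms of information, I(X_i; Z_i | A) \<le> I(X_i; Z, B | A) = I(X_i; Z | B) for A =
  \<open>A i\<close> and B = \<open>B i\<close>, the equality being the Markov property
  \<open>ent_Markov\<close>. Adding Y_i to the condition only lowers the entropy of Z. So each term
  is at most \<open>?g i - ?g (Suc i)\<close>, where \<open>?g i\<close> is H(Z |
  \<open>B i\<close>), and the sum telescopes to H(Z | M) minus a nonnegative rest.\<close>

lemma single_letter_info:
  fixes Z :: "'x list \<times> 'y list \<Rightarrow> 'z list"
  shows "(\<Sum>i<n. XY.ent (\<lambda>w. (fst w ! i, A i w)) + XY.ent (\<lambda>w. (Z w ! i, A i w))
      - XY.ent (\<lambda>w. (fst w ! i, Z w ! i, A i w)) - XY.ent (A i))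
    \<le> XY.ent (\<lambda>w. (Z w, f (snd w))) - XY.ent (\<lambda>w. f (snd w))"
proof -
  let ?g = "\<lambda>i. XY.ent (\<lambda>w. (Z w, B i w)) - XY.ent (B i)"
  have step: "XY.ent (\<lambda>w. (fst w ! i, A i w)) + XY.ent (\<lambda>w. (Z w ! i, A i w))
      - XY.ent (\<lambda>w. (fst w ! i, Z w ! i, A i w)) - XY.ent (A i) \<le> ?g i - ?g (Suc i)" if i: "i < n" for i
  proof -
    have "XY.ent (\<lambda>w. (fst w ! i, (Z w, B i w), (Z w ! i, A i w))) + XY.ent (\<lambda>w. (Z w ! i, A i w)) \<le>
        XY.ent (\<lambda>w. (fst w ! i, (Z w ! i, A i w))) + XY.ent (\<lambda>w. ((Z w, B i w), (Z w ! i, A i w)))"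
      by (rule XY.ent_submodular)
    moreover have "XY.ent (\<lambda>w. (fst w ! i, (Z w, B i w), (Z w ! i, A i w))) = XY.ent (\<lambda>w. (Z w, fst w ! i, B i w))"
      by (rule XY.ent_cong) auto
    moreover have "XY.ent (\<lambda>w. ((Z w, B i w), (Z w ! i, A i w))) = XY.ent (\<lambda>w. (Z w, B i w))"
      by (rule XY.ent_cong) auto
    moreover have "XY.ent (\<lambda>w. (Z w, B (Suc i) w, (fst w ! i, B i w))) + XY.ent (\<lambda>w. (fst w ! i, B i w)) \<le>
        XY.ent (\<lambda>w. (Z w, (fst w ! i, B i w))) + XY.ent (\<lambda>w. (B (Suc i) w, (fst w ! i, B i w)))"
      by (rule XY.ent_submodular)
    moreover have "XY.ent (\<lambda>w. (Z w, B (Suc i) w, (fst w ! i, B i w))) = XY.ent (\<lambda>w. (Z w, B (Suc i) w))"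
      by (rule XY.ent_cong) (use i in \<open>auto simp: take_Suc_Xs take_Suc_Ys\<close>)
    moreover have "XY.ent (\<lambda>w. (B (Suc i) w, (fst w ! i, B i w))) = XY.ent (B (Suc i))"
      by (rule XY.ent_cong) (use i in \<open>auto simp: take_Suc_Xs take_Suc_Ys\<close>)
    ultimately show ?thesis using ent_Markov[OF i] by linarith
  qed
  have "(\<Sum>i<n. XY.ent (\<lambda>w. (fst w ! i, A i w)) + XY.ent (\<lambda>w. (Z w ! i, A i w))
      - XY.ent (\<lambda>w. (fst w ! i, Z w ! i, A i w)) - XY.ent (A i)) \<le> (\<Sum>i<n. ?g i - ?g (Suc i))"
    by (rule sum_mono) (use step in auto)
  also have "\<dots> = ?g 0 - ?g n" by (rule sum_lessThan_telescope')
  also have "\<dots> \<le> ?g 0" using XY.ent_mono[where X="B n" and Y="\<lambda>w. (Z w, B n w)"] by simp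
  also have "XY.ent (\<lambda>w. (Z w, B 0 w)) = XY.ent (\<lambda>w. (Z w, f (snd w)))"
    by (rule XY.ent_cong) auto
  also have "XY.ent (B 0) = XY.ent (\<lambda>w. f (snd w))"
    by (rule XY.ent_cong) auto
  finally show ?thesis .
qed

end

context guessing_test_channel
begin

abbreviation xT where "xT iw \<equiv> fst (snd iw) ! fst iw"
abbreviation yT where "yT iw \<equiv> snd (snd iw) ! fst iw"
abbreviation uT where "uT iw \<equiv> U (fst iw) (snd (snd iw))"

text \<open>At every time i the law of X_i given (Y_i, U_i) = (y, u) is \<open>W y u\<close>; as
  this does not depend on i, it survives the averaging over time.\<close>

lemma joint_law:
  assumes "u < k"
  shows "QY y * V y u * W y u x = XY.T.pr (\<lambda>iw. (xT iw, yT iw, uT iw)) (x, y, u)"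
proof -
  have "XY.pr (\<lambda>w. (fst w ! i, snd w ! i, U i (snd w))) (x, y, u) =
      Y.pr (\<lambda>ys. (ys ! i, U i ys)) (y, u) * W y u x" if "i < n" for i
  proof -
    have "XY.pr (\<lambda>w. (fst w ! i, snd w ! i, U i (snd w))) (x, y, u) =
      (\<Sum>ys\<in>{ys\<in>Ys. (ys ! i, U i ys) = (y, u)}. pY ys * (\<Sum>xs\<in>{xs\<in>Xs. xs ! i = x}. pX ys xs))"
      by (rule pr_fibre) auto
    also have "\<dots> = (\<Sum>ys\<in>{ys\<in>Ys. (ys ! i, U i ys) = (y, u)}. pY ys * W y u x)"
      by (intro sum.cong refl) (auto simp: pX_coord that)
    finally show ?thesis by (simp only: Y.pr_def sum_distrib_right)
  qed
  then show ?thesis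
    by (simp add: QY_V J_def XY.T_pr Y.T_pr sum_distrib_right)
qed

lemma joint_law_XU:
  assumes "u < k"
  shows "(\<Sum>y\<in>UNIV. QY y * V y u * W y u x) = XY.T.pr (\<lambda>iw. (xT iw, uT iw)) (x, u)"
proof -
  have "(\<Sum>y\<in>UNIV. QY y * V y u * W y u x) =
      (\<Sum>y\<in>UNIV. XY.T.pr (\<lambda>iw. (yT iw, xT iw, uT iw)) (y, x, u))"
    by (intro sum.cong refl) (auto simp: joint_law[OF assms] intro: XY.T.pr_cong)
  also have "\<dots> = XY.T.pr (\<lambda>iw. (xT iw, uT iw)) (x, u)"
    by (rule XY.T.pr_marginal) auto
  finally show ?thesis .
qed

lemma T_ent_U: "XY.T.ent (\<lambda>iw. (\<Phi> iw, uT iw)) = log 2 n + (\<Sum>i<n. XY.ent (\<lambda>w. (\<Phi> (i, w), A i w))) / n"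
proof -
  have "XY.T.ent (\<lambda>iw. (\<Phi> iw, uT iw)) = XY.T.ent (\<lambda>iw. (fst iw, \<Phi> iw, A (fst iw) (snd iw)))"
    by (rule XY.T.ent_cong) (auto simp: U_eq_iff)
  then show ?thesis by (simp add: XY.T_ent_time)
qed

text \<open>The joint law of (X_T, Z_T, U_T) supplies a test channel \<open>K\<close> whose expected
  distortion is the mean of \<open>dbar\<close>, hence at most D. Its conditional information is an
  average of the single-letter terms, because U_T is equivalent to the time, the description and the
  past of Y.\<close>

lemma cond_rd_bound:
  fixes Z :: "'x list \<times> 'y list \<Rightarrow> 'xh::finite list"
  assumes Z: "\<And>w. w \<in> Xs \<times> Ys \<Longrightarrow> dbar d (fst w) (Z w) \<le> D"
  shows "cond_rd d D {..<k} (\<lambda>x u. \<Sum>y\<in>UNIV. QY y * V y u * W y u x) \<le>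
    ereal ((XY.ent (\<lambda>w. (Z w, f (snd w))) - XY.ent (\<lambda>w. f (snd w))) / n)"
proof -
  define q where "q x u = (\<Sum>y\<in>UNIV. QY y * V y u * W y u x)" for x u
  let ?z = "\<lambda>iw. Z (snd iw) ! fst iw"
  let ?r = "\<lambda>x xh u. XY.T.pr (\<lambda>iw. (xT iw, ?z iw, uT iw)) (x, xh, u)"
  have q: "q x u = XY.T.pr (\<lambda>iw. (xT iw, uT iw)) (x, u)" if "u < k" for x u
    using joint_law_XU[OF that] by (simp add: q_def)
  \<comment> \<open>The conditional law of the reconstruction letter, with an arbitrary point mass
    where the condition has probability zero.\<close>
  define K where "K x u xh = (if q x u = 0 then if xh = undefined then 1 else 0 else ?r x xh u / q x u)"
    for x u and xh :: 'xh
  have qK: "q x u * K x u xh = ?r x xh u" if "u < k" for x u xh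
  proof -
    have "?r x xh u \<le> q x u" unfolding q[OF that] by (rule XY.T.pr_mono) auto
    then show ?thesis using XY.T.pr_nonneg[of "\<lambda>iw. (xT iw, ?z iw, uT iw)" "(x, xh, u)"] by (auto simp: K_def)
  qed
  have r_sum: "(\<Sum>xh\<in>UNIV. ?r x xh u) = q x u" if "u < k" for x u
  proof -
    have "(\<Sum>xh\<in>UNIV. ?r x xh u) = (\<Sum>xh\<in>UNIV. XY.T.pr (\<lambda>iw. (?z iw, xT iw, uT iw)) (xh, x, u))"
      by (intro sum.cong refl) (auto intro: XY.T.pr_cong)
    also have "\<dots> = XY.T.pr (\<lambda>iw. (xT iw, uT iw)) (x, u)"
      by (rule XY.T.pr_marginal) auto
    finally show ?thesis by (simp add: q that)
  qed
  have K_pmf: "pmf_on UNIV (K x u)" if "u < k" for x u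
  proof (cases "q x u = 0")
    case True
    then show ?thesis unfolding pmf_on_def by (auto simp: K_def)
  next
    case False
    then show ?thesis using r_sum[OF that, of x] XY.T.pr_nonneg q[OF that, of x]
      unfolding pmf_on_def by (auto simp: K_def sum_divide_distrib[symmetric] intro!: divide_nonneg_nonneg XY.T.pr_nonneg)
  qed
  have "(\<Sum>x\<in>UNIV. \<Sum>u<k. \<Sum>xh\<in>UNIV. q x u * K x u xh * d x xh) =
      (\<Sum>x\<in>UNIV. \<Sum>u<k. \<Sum>xh\<in>UNIV. ?r x xh u * d x xh)"
    by (intro sum.cong refl) (auto simp: qK)
  also have "\<dots> = (\<Sum>x\<in>UNIV. \<Sum>xh\<in>UNIV. \<Sum>u<k. ?r x xh u * d x xh)"
    by (intro sum.cong refl) (rule sum.swap)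
  also have "\<dots> = (\<Sum>v\<in>UNIV \<times> UNIV \<times> {..<k}. XY.T.pr (\<lambda>iw. (xT iw, ?z iw, uT iw)) v * d (fst v) (fst (snd v)))"
    by (simp add: sum.cartesian_product case_prod_beta)
  also have "\<dots> = (\<Sum>iw\<in>{..<n} \<times> (Xs \<times> Ys). pXY (snd iw) / n * d (xT iw) (?z iw))"
    by (subst XY.T.pr_expect) (auto simp: U_less)
  also have "\<dots> = (\<Sum>w\<in>Xs \<times> Ys. pXY w * (\<Sum>i<n. d (fst w ! i) (Z w ! i))) / n"
    by (simp only: XY.T_expect) simp
  also have "\<dots> = (\<Sum>w\<in>Xs \<times> Ys. pXY w * dbar d (fst w) (Z w))"
    unfolding sum_divide_distrib by (intro sum.cong refl) (auto simp: dbar_def Xs_def)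
  also have "\<dots> \<le> (\<Sum>w\<in>Xs \<times> Ys. pXY w * D)"
    by (intro sum_mono mult_left_mono Z XY.nonneg) auto
  also have "\<dots> = D" by (simp add: sum_distrib_right[symmetric] XY.total)
  finally have dist: "(\<Sum>x\<in>UNIV. \<Sum>u<k. \<Sum>xh\<in>UNIV. q x u * K x u xh * d x xh) \<le> D" .
  have "cond_mutual_info UNIV UNIV {..<k} (\<lambda>x xh u. q x u * K x u xh) =
      XY.T.ent (\<lambda>iw. (xT iw, uT iw)) + XY.T.ent (\<lambda>iw. (?z iw, uT iw))
      - XY.T.ent (\<lambda>iw. (xT iw, ?z iw, uT iw)) - XY.T.ent uT"
    by (rule XY.T.cond_mutual_info_law) (auto simp: qK U_less)
  also have "XY.T.ent uT = XY.T.ent (\<lambda>iw. ((), uT iw))" by (rule XY.T.ent_cong) auto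
  also have "XY.T.ent (\<lambda>iw. (xT iw, ?z iw, uT iw)) = XY.T.ent (\<lambda>iw. ((xT iw, ?z iw), uT iw))"
    by (rule XY.T.ent_cong) auto
  also have "XY.T.ent (\<lambda>iw. (xT iw, uT iw)) + XY.T.ent (\<lambda>iw. (?z iw, uT iw))
      - XY.T.ent (\<lambda>iw. ((xT iw, ?z iw), uT iw)) - XY.T.ent (\<lambda>iw. ((), uT iw)) =
      (\<Sum>i<n. XY.ent (\<lambda>w. (fst w ! i, A i w)) + XY.ent (\<lambda>w. (Z w ! i, A i w))
      - XY.ent (\<lambda>w. ((fst w ! i, Z w ! i), A i w)) - XY.ent (\<lambda>w. ((), A i w))) / n"
    unfolding T_ent_U by (simp add: sum.distrib sum_subtractf diff_divide_distrib add_divide_distrib)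
  also have "\<dots> = (\<Sum>i<n. XY.ent (\<lambda>w. (fst w ! i, A i w)) + XY.ent (\<lambda>w. (Z w ! i, A i w))
      - XY.ent (\<lambda>w. (fst w ! i, Z w ! i, A i w)) - XY.ent (A i)) / n"
  proof (intro arg_cong2[where f="(/)"] sum.cong refl)
    fix i
    have "XY.ent (\<lambda>w. ((fst w ! i, Z w ! i), A i w)) = XY.ent (\<lambda>w. (fst w ! i, Z w ! i, A i w))"
      by (rule XY.ent_cong) auto
    moreover have "XY.ent (\<lambda>w. ((), A i w)) = XY.ent (A i)"
      by (rule XY.ent_cong) auto
    ultimately show "XY.ent (\<lambda>w. (fst w ! i, A i w)) + XY.ent (\<lambda>w. (Z w ! i, A i w))
      - XY.ent (\<lambda>w. ((fst w ! i, Z w ! i), A i w)) - XY.ent (\<lambda>w. ((), A i w)) =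
      XY.ent (\<lambda>w. (fst w ! i, A i w)) + XY.ent (\<lambda>w. (Z w ! i, A i w))
      - XY.ent (\<lambda>w. (fst w ! i, Z w ! i, A i w)) - XY.ent (A i)" by simp
  qed
  also have "\<dots> \<le> (XY.ent (\<lambda>w. (Z w, f (snd w))) - XY.ent (\<lambda>w. f (snd w))) / n"
    by (intro divide_right_mono single_letter_info) simp
  finally have info: "cond_mutual_info UNIV UNIV {..<k} (\<lambda>x xh u. q x u * K x u xh) \<le>
      (XY.ent (\<lambda>w. (Z w, f (snd w))) - XY.ent (\<lambda>w. f (snd w))) / n" .
  have "cond_rd d D {..<k} q \<le> ereal (cond_mutual_info UNIV UNIV {..<k} (\<lambda>x xh u. q x u * K x u xh))"
    unfolding cond_rd_def by (rule INF_lower) (use K_pmf dist in auto)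
  also have "\<dots> \<le> ereal ((XY.ent (\<lambda>w. (Z w, f (snd w))) - XY.ent (\<lambda>w. f (snd w))) / n)"
    using info by simp
  finally show ?thesis by (simp add: q_def[abs_def])
qed

text \<open>The factor \<open>V y u\<close> cancels and leaves
  \<open>QY y * W y u x / P (x, y)\<close>; the product of these ratios along a word is the density
  of \<open>pXY\<close> with respect to P^n. This is why equality holds. The assumption
  \<open>ac\<close> describes the case of finite divergence.\<close>

lemma rel_entropy_block:
  assumes P: "\<And>z. 0 \<le> P z"
    and ac: "\<And>x y u. u < k \<Longrightarrow> 0 < QY y * V y u * W y u x \<Longrightarrow> 0 < P (x, y)"
  shows "rel_entropy (UNIV \<times> UNIV \<times> {..<k})
      (\<lambda>(x, y, u). QY y * V y u * W y u x) (\<lambda>(x, y, u). P (x, y) * V y u) =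
    ereal ((\<Sum>w\<in>Xs \<times> Ys. pXY w * log 2 (pXY w / (\<Prod>i<n. P (fst w ! i, snd w ! i)))) / n)"
    and "\<And>w. w \<in> Xs \<times> Ys \<Longrightarrow> 0 < pXY w \<Longrightarrow> 0 < (\<Prod>i<n. P (fst w ! i, snd w ! i))"
proof -
  let ?h = "\<lambda>i w. log 2 (QY (snd w ! i) * W (snd w ! i) (U i (snd w)) (fst w ! i) / P (fst w ! i, snd w ! i))"
  have pos: "0 < QY (snd w ! i) * W (snd w ! i) (U i (snd w)) (fst w ! i)" "0 < P (fst w ! i, snd w ! i)"
    if w: "w \<in> Xs \<times> Ys" "0 < pXY w" and i: "i < n" for w i
  proof -
    let ?x = "fst w ! i" and ?y = "snd w ! i" and ?u = "U i (snd w)"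
    have u: "?u < k" using w i U_less by auto
    have "0 < XY.T.pr (\<lambda>iw. (xT iw, yT iw, uT iw)) (?x, ?y, ?u)"
      using XY.T.pr_pos[of "(i, w)" "\<lambda>iw. (xT iw, yT iw, uT iw)"] w i n by simp
    then have *: "0 < QY ?y * V ?y ?u * W ?y ?u ?x" by (simp add: joint_law[OF u])
    then show "0 < P (?x, ?y)" using ac u by blast
    have "0 \<le> V ?y ?u" using V_pmf by (simp add: pmf_on_def)
    then show "0 < QY ?y * W ?y ?u ?x" using * QY_nonneg[of ?y] W_nonneg[OF u, of ?y ?x]
      by (auto simp: zero_less_mult_iff)
  qed
  show P_pos: "0 < (\<Prod>i<n. P (fst w ! i, snd w ! i))" if "w \<in> Xs \<times> Ys" "0 < pXY w" for w
    using pos(2)[OF that] by (intro prod_pos) auto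
  have V_nn: "0 \<le> V y u" for y u using V_pmf[of y] by (simp add: pmf_on_def)
  let ?q = "\<lambda>(x, y, u). QY y * V y u * W y u x" and ?p = "\<lambda>(x, y, u). P (x, y) * V y u"
  let ?S = "UNIV \<times> UNIV \<times> {..<k} :: ('x \<times> 'y \<times> nat) set"
  have "\<not> (\<exists>a\<in>?S. ?q a > 0 \<and> ?p a = 0)"
  proof
    assume "\<exists>a\<in>?S. ?q a > 0 \<and> ?p a = 0"
    then obtain x y u where u: "u < k" "0 < QY y * V y u * W y u x" "P (x, y) * V y u = 0" by auto
    then have "V y u \<noteq> 0" by auto
    then show False using ac[OF u(1,2)] u(3) by simp
  qed
  then have "rel_entropy ?S ?q ?p = ereal (\<Sum>a\<in>?S. if ?q a = 0 then 0 else ?q a * log 2 (?q a / ?p a))"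
    unfolding rel_entropy_def by (rule if_not_P)
  also have "(\<Sum>a\<in>?S. if ?q a = 0 then 0 else ?q a * log 2 (?q a / ?p a)) =
      (\<Sum>a\<in>?S. XY.T.pr (\<lambda>iw. (xT iw, yT iw, uT iw)) a *
        (\<lambda>(x, y, u). log 2 (QY y * W y u x / P (x, y))) a)"
    by (intro sum.cong refl) (auto simp: joint_law[symmetric])
  also have "\<dots> = (\<Sum>iw\<in>{..<n} \<times> (Xs \<times> Ys). pXY (snd iw) / n * ?h (fst iw) (snd iw))"
    by (subst XY.T.pr_expect) (auto simp: U_less)
  also have "\<dots> = (\<Sum>w\<in>Xs \<times> Ys. pXY w * (\<Sum>i<n. ?h i w)) / n"
    by (simp only: XY.T_expect) simp
  also have "(\<Sum>w\<in>Xs \<times> Ys. pXY w * (\<Sum>i<n. ?h i w)) =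
      (\<Sum>w\<in>Xs \<times> Ys. pXY w * log 2 (pXY w / (\<Prod>i<n. P (fst w ! i, snd w ! i))))"
  proof (intro sum.cong refl)
    fix w assume w: "w \<in> Xs \<times> Ys"
    show "pXY w * (\<Sum>i<n. ?h i w) = pXY w * log 2 (pXY w / (\<Prod>i<n. P (fst w ! i, snd w ! i)))"
    proof (cases "pXY w = 0")
      case False
      then have "0 < pXY w" using XY.nonneg[OF w] by simp
      note pos = pos[OF w this]
      have "ln (\<Prod>i<n. QY (snd w ! i) * W (snd w ! i) (U i (snd w)) (fst w ! i) / P (fst w ! i, snd w ! i)) =
        (\<Sum>i<n. ln (QY (snd w ! i) * W (snd w ! i) (U i (snd w)) (fst w ! i) / P (fst w ! i, snd w ! i)))"
        using pos by (intro ln_prod finite_lessThan) (metis divide_pos_pos lessThan_iff less_numeral_extra(3))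
      moreover have "(\<Prod>i<n. QY (snd w ! i) * W (snd w ! i) (U i (snd w)) (fst w ! i) / P (fst w ! i, snd w ! i)) =
        pXY w / (\<Prod>i<n. P (fst w ! i, snd w ! i))"
        by (simp add: pXY_def pY_def pX_def prod_dividef prod.distrib)
      ultimately show ?thesis by (simp add: log_def sum_divide_distrib)
    qed simp
  qed
  finally show "rel_entropy ?S ?q ?p = ereal ((\<Sum>w\<in>Xs \<times> Ys. pXY w *
    log 2 (pXY w / (\<Prod>i<n. P (fst w ! i, snd w ! i)))) / n)" .
qed

end

section \<open>The lower bound on the moment for every code\<close>

lemma sum_inverse_le_ln:
  assumes "1 \<le> N"
  shows "(\<Sum>i\<in>{1..N}. 1 / real i) \<le> 1 + ln N"
proof -
  have "harm N - ln (real N) \<le> harm 1 - ln (real 1)"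
    using euler_mascheroni_sequence_decreasing[of 1 N] assms by simp
  then show ?thesis by (simp add: harm_def inverse_eq_divide)
qed

lemma num_guesses_spec:
  fixes g :: "nat \<Rightarrow> nat \<Rightarrow> 'xh::finite list"
  assumes g: "is_guessing_strategy n R g" and m: "m < num_desc n R"
    and xh: "length xh = n" "dbar d xs xh \<le> D"
  shows "num_guesses d D g xs m \<in> {1..CARD('xh) ^ n}" "dbar d xs (g m (num_guesses d D g xs m)) \<le> D"
proof -
  have "bij_betw (g m) {1..CARD('xh) ^ n} {xs. length xs = n}"
    using g m by (simp add: is_guessing_strategy_def)
  then have "xh \<in> g m ` {1..CARD('xh) ^ n}" using xh(1) by (simp add: bij_betw_imp_surj_on)
  then obtain i where i: "i \<in> {1..CARD('xh) ^ n}" "g m i = xh" by blast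
  let ?Q = "\<lambda>i. 1 \<le> i \<and> dbar d xs (g m i) \<le> D"
  have "?Q i" using i xh by simp
  then have "?Q (num_guesses d D g xs m)" "num_guesses d D g xs m \<le> i"
    unfolding num_guesses_def by (rule LeastI, rule Least_le)
  then show "num_guesses d D g xs m \<in> {1..CARD('xh) ^ n}" "dbar d xs (g m (num_guesses d D g xs m)) \<le> D"
    using i by auto
qed

lemma log_num_desc_le: "0 \<le> R \<Longrightarrow> 1 \<le> n \<Longrightarrow> log 2 (num_desc n R) / n \<le> R"
proof -
  assume "0 \<le> R" "1 \<le> n"
  then have "log 2 (num_desc n R) \<le> n * R" by (simp add: num_desc_def log_nat_power)
  then show ?thesis using \<open>1 \<le> n\<close> by (simp add: divide_le_eq mult.commute)
qed

lemma converse_bound: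
  fixes P :: "'x::finite \<times> 'y::finite \<Rightarrow> real" and d :: "'x \<Rightarrow> 'xh::finite \<Rightarrow> real"
  assumes P: "\<And>z. 0 \<le> P z" and R: "0 \<le> R" and rho: "0 < \<rho>"
    and feasible: "\<And>xs :: 'x list. length xs = n \<Longrightarrow> \<exists>xh. length xh = n \<and> dbar d xs xh \<le> D"
    and n: "1 \<le> n" and f: "is_helper n R f" and g: "is_guessing_strategy n R g"
    and QY: "pmf_on UNIV QY"
  shows "\<exists>k V. 1 \<le> k \<and> (\<forall>y. pmf_on {..<k} (V y)) \<and>
    mutual_info UNIV {..<k} (\<lambda>y u. QY y * V y u) \<le> R \<and>
    (\<forall>W. (\<forall>y. \<forall>u\<in>{..<k}. pmf_on UNIV (W y u)) \<longrightarrow>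
      guess_exponent P d D \<rho> QY k V W \<le> ereal ((log 2 (guess_moment P d D \<rho> n f g) + \<rho> * log 2 (1 + n * ln CARD('xh))) / n))"
proof -
  let ?M = "num_desc n R"
  let ?U = "{..<n} \<times> {..<?M} \<times> {a :: 'y list. length a \<le> n}"
  have "finite ?U" using finite_lists_length_le[of "UNIV :: 'y set" n] by auto
  then obtain e where e: "bij_betw e ?U {..<card ?U}"
    using ex_bij_betw_finite_nat by (metis atLeast0LessThan)
  interpret C: helper_code QY n ?M "card ?U" f e
    by unfold_locales (use QY n f e in \<open>auto simp: is_helper_def\<close>)
  define G where "G w = num_guesses d D g (fst w) (f (snd w))" for w
  define Z where "Z w = g (f (snd w)) (G w)" for w
  define gm where "gm = guess_moment P d D \<rho> n f g"
  let ?N = "CARD('xh) ^ n"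
  \<comment> \<open>A bound on the harmonic sum up to \<open>?N\<close>, so that i |-> 1 / (i h) is
    a subprobability on the possible numbers of guesses. As \<open>?N\<close> is exponential in n,
    \<open>h\<close> is linear in n and log h is the O(log n) loss.\<close>
  define h where "h = 1 + ln (real ?N)"
  have h: "h = 1 + n * ln CARD('xh)" by (simp add: h_def ln_realpow)
  have h1: "1 \<le> h" by (simp add: h_def)
  have "guess_exponent P d D \<rho> QY (card ?U) C.V W \<le> ereal ((log 2 gm + \<rho> * log 2 h) / n)" (is "?lhs \<le> _")
    if W: "\<forall>y. \<forall>u\<in>{..<card ?U}. pmf_on UNIV (W y u)" for W
  proof -
    interpret X: guessing_test_channel QY n ?M "card ?U" f e W
      by unfold_locales (use W in auto)
    let ?S = "X.Xs \<times> C.Ys"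
    let ?Pn = "\<lambda>w. \<Prod>i<n. P (fst w ! i, snd w ! i)"
    have wS: "length (fst w) = n \<and> length (snd w) = n \<and> f (snd w) < ?M" if "w \<in> ?S" for w
      using that f by (auto simp: X.Xs_def C.Ys_def is_helper_def)
    have G: "G w \<in> {1..?N}" "dbar d (fst w) (Z w) \<le> D" if "w \<in> ?S" for w
    proof -
      obtain xh :: "'xh list" where "length xh = n" "dbar d (fst w) xh \<le> D"
        using feasible wS[OF \<open>w \<in> ?S\<close>] by blast
      from num_guesses_spec[OF g _ this, of "f (snd w)"] wS[OF \<open>w \<in> ?S\<close>]
      show "G w \<in> {1..?N}" "dbar d (fst w) (Z w) \<le> D" by (auto simp: G_def Z_def)
    qed
    have g_bij: "bij_betw (g m) {1..?N} {xs. length xs = n}" if "m < ?M" for m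
      using g that by (simp add: is_guessing_strategy_def)
    \<comment> \<open>The rank of a word in the list for m: given the description, the successful
      reconstruction and the number of guesses determine each other.\<close>
    define rk where "rk m = the_inv_into {1..?N} (g m)" for m
    have rk: "rk m (g m i) = i" if "m < ?M" "i \<in> {1..?N}" for m i
      unfolding rk_def using the_inv_into_f_f g_bij[OF that(1)] that(2) by (metis bij_betw_imp_inj_on)
    have rk_Z: "rk (f (snd w)) (Z w) = G w" if "w \<in> ?S" for w
      using wS[OF that] G(1)[OF that] by (simp only: Z_def rk)
    have "X.XY.ent (\<lambda>w. (Z w, f (snd w))) - X.XY.ent (\<lambda>w. f (snd w)) \<le>
        - (\<Sum>w\<in>?S. X.pXY w * log 2 (1 / (real (rk (f (snd w)) (Z w)) * h)))"
    proof (rule X.XY.cross_entropy[of "{xs. length xs = n}"])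
      show "finite {xs :: 'xh list. length xs = n}"
        using finite_lists_length_eq[of "UNIV :: 'xh set" n] by simp
      show "Z ` ?S \<subseteq> {xs. length xs = n}"
        using bij_betw_apply[OF g_bij] G(1) wS unfolding Z_def by blast
    next
      fix m assume "m \<in> (\<lambda>w. f (snd w)) ` ?S"
      then have m: "m < ?M" using wS by auto
      have "(\<Sum>x\<in>{xs. length xs = n}. 1 / (real (rk m x) * h)) = (\<Sum>i\<in>{1..?N}. 1 / (real (rk m (g m i)) * h))"
        by (rule sum.reindex_bij_betw[OF g_bij[OF m], symmetric])
      also have "\<dots> = (\<Sum>i\<in>{1..?N}. 1 / real i) / h"
        unfolding sum_divide_distrib by (intro sum.cong refl) (simp add: rk m)
      also have "\<dots> \<le> h / h"
        using h1 by (intro divide_right_mono) (auto simp: h_def intro!: sum_inverse_le_ln[of ?N, simplified])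
      also have "\<dots> = 1" using h1 by simp
      finally show "(\<Sum>x\<in>{xs. length xs = n}. 1 / (real (rk m x) * h)) \<le> 1" .
    next
      fix w assume w: "w \<in> ?S"
      then show "0 < 1 / (real (rk (f (snd w)) (Z w)) * h)"
        using G(1)[OF w] h1 by (simp add: rk_Z)
    qed (use h1 in auto)
    also have "- (\<Sum>w\<in>?S. X.pXY w * log 2 (1 / (real (rk (f (snd w)) (Z w)) * h))) =
        (\<Sum>w\<in>?S. X.pXY w * log 2 (G w)) + log 2 h"
    proof -
      have "X.pXY w * log 2 (1 / (real (rk (f (snd w)) (Z w)) * h)) = - (X.pXY w * log 2 (G w)) - X.pXY w * log 2 h"
        if "w \<in> ?S" for w
        using G(1)[OF that] h1 by (simp add: rk_Z[OF that] log_divide log_mult algebra_simps)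
      then show ?thesis
        by (simp add: sum_subtractf sum_negf sum_distrib_right[symmetric] X.XY.total)
    qed
    finally have EG: "X.XY.ent (\<lambda>w. (Z w, f (snd w))) - X.XY.ent (\<lambda>w. f (snd w)) \<le>
        (\<Sum>w\<in>?S. X.pXY w * log 2 (G w)) + log 2 h" .
    have "cond_rd d D {..<card ?U} (\<lambda>x u. \<Sum>y\<in>UNIV. QY y * C.V y u * W y u x) \<le>
        ereal ((X.XY.ent (\<lambda>w. (Z w, f (snd w))) - X.XY.ent (\<lambda>w. f (snd w))) / n)"
      by (rule X.cond_rd_bound) (rule G(2))
    also have "\<dots> \<le> ereal (((\<Sum>w\<in>?S. X.pXY w * log 2 (G w)) + log 2 h) / n)"
      using EG by (auto intro: divide_right_mono)
    finally have rd: "ereal \<rho> * cond_rd d D {..<card ?U} (\<lambda>x u. \<Sum>y\<in>UNIV. QY y * C.V y u * W y u x) \<le>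
        ereal \<rho> * ereal (((\<Sum>w\<in>?S. X.pXY w * log 2 (G w)) + log 2 h) / n)"
      using rho by (intro ereal_mult_left_mono) auto
    \<comment> \<open>Without absolute continuity the divergence is infinite while the rate term is
      bounded by \<open>rd\<close>, so the exponent is minus infinity.\<close>
    show ?thesis
    proof (cases "\<forall>x y u. u < card ?U \<longrightarrow> 0 < QY y * C.V y u * W y u x \<longrightarrow> 0 < P (x, y)")
      case False
      then obtain x y u where "u < card ?U" "0 < QY y * C.V y u * W y u x" "\<not> 0 < P (x, y)" by blast
      then have inf: "rel_entropy (UNIV \<times> UNIV \<times> {..<card ?U})
              (\<lambda>(x, y, u). QY y * C.V y u * W y u x) (\<lambda>(x, y, u). P (x, y) * C.V y u) = \<infinity>"
        unfolding rel_entropy_def using P[of "(x, y)"]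
        by (intro if_P bexI[of _ "(x, y, u)"]) auto
      have "?lhs \<le> ereal \<rho> * ereal (((\<Sum>w\<in>?S. X.pXY w * log 2 (G w)) + log 2 h) / n) - \<infinity>"
        unfolding guess_exponent_def inf by (intro ereal_minus_mono rd order_refl)
      then show ?thesis by simp
    next
      case True
      have ac: "0 < P (x, y)" if "u < card ?U" "0 < QY y * C.V y u * W y u x" for x y u
        using True that by blast
      have rel1: "rel_entropy (UNIV \<times> UNIV \<times> {..<card ?U})
              (\<lambda>(x, y, u). QY y * C.V y u * W y u x) (\<lambda>(x, y, u). P (x, y) * C.V y u) =
          ereal ((\<Sum>w\<in>?S. X.pXY w * log 2 (X.pXY w / ?Pn w)) / n)"
        by (rule X.rel_entropy_block(1)[OF P]) (rule ac)
      have rel2: "0 < ?Pn w" if "w \<in> ?S" "0 < X.pXY w" for w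
        by (rule X.rel_entropy_block(2)[OF P _ that]) (rule ac)
      have gm_eq: "gm = (\<Sum>w\<in>?S. ?Pn w * real (G w) powr \<rho>)"
        unfolding gm_def guess_moment_def X.Xs_def C.Ys_def G_def
        by (simp add: sum.cartesian_product case_prod_beta)
      have G_pos: "0 < real (G w)" if "w \<in> ?S" for w using G(1)[OF that] by simp
      have gm_ge: "?Pn w * real (G w) powr \<rho> \<le> gm" if "w \<in> ?S" for w
        unfolding gm_eq by (rule member_le_sum[OF that]) (auto simp: P X.finite_Xs C.finite_Ys intro!: mult_nonneg_nonneg prod_nonneg)
      have "\<exists>w\<in>?S. 0 < X.pXY w"
      proof (rule ccontr)
        assume "\<not> ?thesis"
        then have "sum X.pXY ?S \<le> 0" by (intro sum_nonpos) (meson not_le)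
        then show False by (simp add: X.XY.total)
      qed
      then obtain w0 where w0: "w0 \<in> ?S" "0 < X.pXY w0" by blast
      have gm_pos: "0 < gm"
        using gm_ge[OF w0(1)] rel2[OF w0] G_pos[OF w0(1)] by (smt (verit) mult_pos_pos powr_gt_zero)
      \<comment> \<open>Donsker--Varadhan: \<open>pXY\<close> is compared with the law proportional
        to P^n G^\<rho>, whose normalizing constant is the moment \<open>gm\<close>.\<close>
      have "(\<Sum>w\<in>?S. X.pXY w * log 2 (?Pn w * real (G w) powr \<rho> / (X.pXY w * gm))) \<le> 0"
      proof (rule sum_log_nonpos)
        have "(\<Sum>w\<in>?S. X.pXY w * (?Pn w * real (G w) powr \<rho> / (X.pXY w * gm))) \<le>
            (\<Sum>w\<in>?S. ?Pn w * real (G w) powr \<rho> / gm)"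
          using gm_pos by (intro sum_mono) (auto intro!: divide_nonneg_pos mult_nonneg_nonneg prod_nonneg P)
        also have "\<dots> = 1" using gm_pos by (simp add: sum_divide_distrib[symmetric] gm_eq[symmetric])
        finally show "(\<Sum>w\<in>?S. X.pXY w * (?Pn w * real (G w) powr \<rho> / (X.pXY w * gm))) \<le> sum X.pXY ?S"
          by (simp add: X.XY.total)
      qed (use X.XY.nonneg rel2 G_pos gm_pos X.XY.fin in \<open>auto intro!: divide_pos_pos mult_pos_pos\<close>)
      moreover have "X.pXY w * log 2 (?Pn w * real (G w) powr \<rho> / (X.pXY w * gm)) =
          \<rho> * (X.pXY w * log 2 (G w)) - X.pXY w * log 2 (X.pXY w / ?Pn w) - X.pXY w * log 2 gm" if w: "w \<in> ?S" for w
      proof (cases "X.pXY w = 0")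
        case False
        then have p: "0 < X.pXY w" using X.XY.nonneg[OF w] by simp
        have "p * log 2 (a * b powr \<rho> / (p * gm)) = \<rho> * (p * log 2 b) - p * log 2 (p / a) - p * log 2 gm"
          if "0 < p" "0 < a" "0 < b" for p a b :: real
          using that gm_pos by (simp add: log_mult log_divide log_powr algebra_simps)
        then show ?thesis using p rel2[OF w p] G_pos[OF w] by blast
      qed simp
      ultimately have DV: "\<rho> * (\<Sum>w\<in>?S. X.pXY w * log 2 (G w)) - (\<Sum>w\<in>?S. X.pXY w * log 2 (X.pXY w / ?Pn w)) \<le> log 2 gm"
        by (simp add: sum_subtractf sum_distrib_left[symmetric] sum_distrib_right[symmetric] X.XY.total)
      let ?E = "\<Sum>w\<in>?S. X.pXY w * log 2 (G w)" and ?Dv = "\<Sum>w\<in>?S. X.pXY w * log 2 (X.pXY w / ?Pn w)"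
      have "?lhs \<le> ereal \<rho> * ereal ((?E + log 2 h) / n) - ereal (?Dv / n)"
        unfolding guess_exponent_def rel1 by (intro ereal_minus_mono rd order_refl)
      also have "\<dots> = ereal ((\<rho> * ?E - ?Dv + \<rho> * log 2 h) / n)"
        by (simp add: diff_divide_distrib add_divide_distrib algebra_simps)
      also have "\<dots> \<le> ereal ((log 2 gm + \<rho> * log 2 h) / n)"
        using DV by (auto intro!: divide_right_mono)
      finally show ?thesis .
    qed
  qed
  moreover have "mutual_info UNIV {..<card ?U} (\<lambda>y u. QY y * C.V y u) \<le> R"
    using C.mutual_info_bound log_num_desc_le[OF R n] by linarith
  ultimately show ?thesis
    using C.k_pos C.V_pmf unfolding gm_def h by blast
qed

section \<open>Scaling and continuity of conditional mutual information\<close>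

text \<open>Passing from counts to frequencies changes each of the four \<open>xlog\<close> sums by
  the total count times log n, twice with each sign. Hence n times the information of a type is a
  combination of \<open>xlog\<close> of its counts, the form in which the sizes of type classes come
  out of Stirling's formula.\<close>

lemma cond_mutual_info_scale:
  fixes N :: "'a \<Rightarrow> 'b \<Rightarrow> 'c \<Rightarrow> nat"
  assumes fin: "finite A" "finite B" "finite C" and n: "0 < n"
  shows "real n * cond_mutual_info A B C (\<lambda>a b c. real (N a b c) / real n) =
    (\<Sum>a\<in>A. \<Sum>b\<in>B. \<Sum>c\<in>C. xlog (N a b c)) + (\<Sum>c\<in>C. xlog (\<Sum>a\<in>A. \<Sum>b\<in>B. N a b c))
    - (\<Sum>a\<in>A. \<Sum>c\<in>C. xlog (\<Sum>b\<in>B. N a b c)) - (\<Sum>b\<in>B. \<Sum>c\<in>C. xlog (\<Sum>a\<in>A. N a b c))"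
proof -
  have x: "real n * xlog (v / real n) = xlog v - v * log 2 n" if "0 \<le> v" for v
    using xlog_mult[of "real n" "v / real n"] n that by simp
  have s: "(\<Sum>a\<in>A. \<Sum>b\<in>B. \<Sum>c\<in>C. real (N a b c) * log 2 n) = (\<Sum>c\<in>C. (\<Sum>a\<in>A. \<Sum>b\<in>B. real (N a b c)) * log 2 n)"
    "(\<Sum>a\<in>A. \<Sum>c\<in>C. (\<Sum>b\<in>B. real (N a b c)) * log 2 n) = (\<Sum>c\<in>C. (\<Sum>a\<in>A. \<Sum>b\<in>B. real (N a b c)) * log 2 n)"
    "(\<Sum>b\<in>B. \<Sum>c\<in>C. (\<Sum>a\<in>A. real (N a b c)) * log 2 n) = (\<Sum>c\<in>C. (\<Sum>a\<in>A. \<Sum>b\<in>B. real (N a b c)) * log 2 n)"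
  proof -
    show "(\<Sum>a\<in>A. \<Sum>c\<in>C. (\<Sum>b\<in>B. real (N a b c)) * log 2 n) = (\<Sum>c\<in>C. (\<Sum>a\<in>A. \<Sum>b\<in>B. real (N a b c)) * log 2 n)"
      by (subst sum.swap) (simp add: sum_distrib_right)
    moreover have "(\<Sum>a\<in>A. \<Sum>b\<in>B. \<Sum>c\<in>C. real (N a b c) * log 2 n) = (\<Sum>a\<in>A. \<Sum>c\<in>C. (\<Sum>b\<in>B. real (N a b c)) * log 2 n)"
      by (intro sum.cong refl) (subst sum.swap, simp add: sum_distrib_right)
    ultimately show "(\<Sum>a\<in>A. \<Sum>b\<in>B. \<Sum>c\<in>C. real (N a b c) * log 2 n) = (\<Sum>c\<in>C. (\<Sum>a\<in>A. \<Sum>b\<in>B. real (N a b c)) * log 2 n)"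
      by simp
    have "(\<Sum>b\<in>B. \<Sum>c\<in>C. (\<Sum>a\<in>A. real (N a b c)) * log 2 n) = (\<Sum>c\<in>C. (\<Sum>b\<in>B. \<Sum>a\<in>A. real (N a b c)) * log 2 n)"
      by (subst sum.swap) (simp add: sum_distrib_right)
    also have "\<dots> = (\<Sum>c\<in>C. (\<Sum>a\<in>A. \<Sum>b\<in>B. real (N a b c)) * log 2 n)"
      by (intro sum.cong refl arg_cong2[where f="(*)"]) (rule sum.swap)
    finally show "(\<Sum>b\<in>B. \<Sum>c\<in>C. (\<Sum>a\<in>A. real (N a b c)) * log 2 n) = (\<Sum>c\<in>C. (\<Sum>a\<in>A. \<Sum>b\<in>B. real (N a b c)) * log 2 n)" .
  qed
  have "real n * cond_mutual_info A B C (\<lambda>a b c. real (N a b c) / real n) =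
     (\<Sum>a\<in>A. \<Sum>b\<in>B. \<Sum>c\<in>C. xlog (N a b c) - real (N a b c) * log 2 n)
     + (\<Sum>c\<in>C. xlog (\<Sum>a\<in>A. \<Sum>b\<in>B. N a b c) - (\<Sum>a\<in>A. \<Sum>b\<in>B. real (N a b c)) * log 2 n)
    - (\<Sum>a\<in>A. \<Sum>c\<in>C. xlog (\<Sum>b\<in>B. N a b c) - (\<Sum>b\<in>B. real (N a b c)) * log 2 n)
    - (\<Sum>b\<in>B. \<Sum>c\<in>C. xlog (\<Sum>a\<in>A. N a b c) - (\<Sum>a\<in>A. real (N a b c)) * log 2 n)"
    by (subst cond_mutual_info_xlog[OF fin])
      (simp_all add: right_diff_distrib distrib_left sum_distrib_left x sum_divide_distrib[symmetric] sum_nonneg)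
  then show ?thesis by (simp add: sum_subtractf s)
qed

text \<open>The quotients in the definition are not continuous at null entries; the
  \<open>xlog\<close> form is.\<close>

lemma cond_mutual_info_tendsto:
  fixes p :: "nat \<Rightarrow> 'a \<Rightarrow> 'b \<Rightarrow> 'c \<Rightarrow> real"
  assumes fin: "finite A" "finite B" "finite C" and nn: "\<And>n a b c. a \<in> A \<Longrightarrow> b \<in> B \<Longrightarrow> c \<in> C \<Longrightarrow> 0 \<le> p n a b c"
    and lim: "\<And>a b c. a \<in> A \<Longrightarrow> b \<in> B \<Longrightarrow> c \<in> C \<Longrightarrow> (\<lambda>n. p n a b c) \<longlonglongrightarrow> q a b c"
  shows "(\<lambda>n. cond_mutual_info A B C (p n)) \<longlonglongrightarrow> cond_mutual_info A B C q"
proof -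
  have q: "0 \<le> q a b c" if "a \<in> A" "b \<in> B" "c \<in> C" for a b c
    using lim[OF that] nn[OF that] by (meson LIMSEQ_le_const)
  have "cond_mutual_info A B C q = (\<Sum>a\<in>A. \<Sum>b\<in>B. \<Sum>c\<in>C. xlog (q a b c)) + (\<Sum>c\<in>C. xlog (\<Sum>a\<in>A. \<Sum>b\<in>B. q a b c))
    - (\<Sum>a\<in>A. \<Sum>c\<in>C. xlog (\<Sum>b\<in>B. q a b c)) - (\<Sum>b\<in>B. \<Sum>c\<in>C. xlog (\<Sum>a\<in>A. q a b c))"
    by (rule cond_mutual_info_xlog[OF fin q])
  moreover have "cond_mutual_info A B C (p n) = (\<Sum>a\<in>A. \<Sum>b\<in>B. \<Sum>c\<in>C. xlog (p n a b c)) + (\<Sum>c\<in>C. xlog (\<Sum>a\<in>A. \<Sum>b\<in>B. p n a b c))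
    - (\<Sum>a\<in>A. \<Sum>c\<in>C. xlog (\<Sum>b\<in>B. p n a b c)) - (\<Sum>b\<in>B. \<Sum>c\<in>C. xlog (\<Sum>a\<in>A. p n a b c))" for n
    by (rule cond_mutual_info_xlog[OF fin nn])
  ultimately show ?thesis
    by (simp only:) (intro tendsto_intros tendsto_xlog lim sum_nonneg nn; assumption)
qed

subsection \<open>The method of types\<close>

lemma ln_fact_bounds:
  "real c * ln c - c \<le> ln (fact c)" "ln (fact c) \<le> real c * ln c - c + 1 + ln (real c + 1)"
proof -
  show "real c * ln c - c \<le> ln (fact c)"
  proof (induction c)
    case (Suc c)
    have "real c * ln (real c + 1) \<le> real c * ln c + 1"
    proof (cases "c = 0")
      case False
      have "ln ((real c + 1) / c) \<le> (real c + 1) / c - 1" using False by (intro ln_le_minus_one) auto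
      then have "real c * ln ((real c + 1) / c) \<le> real c * ((real c + 1) / c - 1)"
        by (rule mult_left_mono) simp
      then show ?thesis using False by (simp add: ln_div field_simps)
    qed simp
    moreover have "ln (fact (Suc c)) = ln (real c + 1) + ln (fact c)"
      by (simp add: ln_mult add.commute)
    ultimately show ?case using Suc by (simp add: algebra_simps)
  qed simp
  have "ln (fact c) \<le> real c * ln c - c + 1 + ln (real c)" if "1 \<le> c"
    using that
  proof (induction c rule: dec_induct)
    case (step c)
    have "ln (c / (real c + 1)) \<le> c / (real c + 1) - 1" using step by (intro ln_le_minus_one) auto
    then have "(real c + 1) * ln (c / (real c + 1)) \<le> (real c + 1) * (c / (real c + 1) - 1)"
      by (rule mult_left_mono) simp
    then have "(real c + 1) * ln c + 1 \<le> (real c + 1) * ln (real c + 1)"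
      using step by (simp add: ln_div field_simps)
    moreover have "ln (fact (Suc c)) = ln (real c + 1) + ln (fact c)"
      by (simp add: ln_mult add.commute)
    ultimately show ?case using step by (simp add: algebra_simps)
  qed simp
  moreover have "ln (real c) \<le> ln (real c + 1)" if "1 \<le> c" using that by simp
  moreover have "1 \<le> c" if "c \<noteq> 0" using that by simp
  ultimately show "ln (fact c) \<le> real c * ln c - c + 1 + ln (real c + 1)"
    by (cases "c = 0") (simp, linarith)
qed

lemma log_fact_bounds:
  assumes "c \<le> n"
  shows "xlog c - c * log 2 (exp 1) \<le> log 2 (fact c)"
    "log 2 (fact c) \<le> xlog c - c * log 2 (exp 1) + log 2 (exp 1 * (real n + 1))"
proof -
  show "xlog c - c * log 2 (exp 1) \<le> log 2 (fact c)"
    using divide_right_mono[OF ln_fact_bounds(1)[of c], of "ln 2"]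
    by (simp add: xlog_def log_def diff_divide_distrib)
  have "ln (fact c) \<le> real c * ln c - c + 1 + ln (real n + 1)"
    using ln_fact_bounds(2)[of c] assms by (smt (verit) ln_le_cancel_iff of_nat_0_le_iff of_nat_mono)
  from divide_right_mono[OF this, of "ln 2"]
  show "log 2 (fact c) \<le> xlog c - c * log 2 (exp 1) + log 2 (exp 1 * (real n + 1))"
    by (simp add: xlog_def log_def diff_divide_distrib add_divide_distrib ln_mult)
qed

lemma count_list_map_sum:
  assumes "set zs \<subseteq> Z" "finite Z"
  shows "count_list (map f zs) v = (\<Sum>z\<in>{z\<in>Z. f z = v}. count_list zs z)"
  using assms(1)
proof (induction zs)
  case (Cons z zs)
  have "(\<Sum>z'\<in>{z\<in>Z. f z = v}. count_list (z # zs) z') =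
      (\<Sum>z'\<in>{z\<in>Z. f z = v}. (if z' = z then 1 else 0) + count_list zs z')"
    by (intro sum.cong) auto
  also have "\<dots> = (if f z = v then 1 else 0) + (\<Sum>z'\<in>{z\<in>Z. f z = v}. count_list zs z')"
    using Cons.prems assms(2) by (simp add: sum.distrib)
  finally show ?case using Cons by simp
qed simp

text \<open>The conditional type class (V-shell): the words whose joint type with the given word
  \<open>ss\<close> is N.\<close>

definition tclass :: "'s list \<Rightarrow> ('s \<times> 'a \<Rightarrow> nat) \<Rightarrow> 'a list set" where
  "tclass ss N = {as. length as = length ss \<and> count_list (zip ss as) = N}"

lemma finite_tclass:
  assumes "finite A" "\<And>s a. a \<notin> A \<Longrightarrow> N (s, a) = 0"
  shows "finite (tclass ss N)"
proof (rule finite_subset)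
  show "tclass ss N \<subseteq> {as. set as \<subseteq> A \<and> length as = length ss}"
  proof (clarsimp simp: tclass_def)
    fix as a assume as: "length as = length ss" "N = count_list (zip ss as)" "a \<in> set as"
    then obtain i where "i < length as" "as ! i = a" by (auto simp: in_set_conv_nth)
    then have "(ss ! i, a) \<in> set (zip ss as)" using as(1) by (auto simp: set_zip)
    then have "count_list (zip ss as) (ss ! i, a) \<noteq> 0" by (simp add: count_list_0_iff)
    then show "a \<in> A" using assms(2)[of a "ss ! i"] as(2) by auto
  qed
  show "finite {as. set as \<subseteq> A \<and> length as = length ss}"
    using finite_lists_length_eq[OF assms(1)] .
qed

text \<open>The class is a product of multinomial coefficients, one for each s; the identity is
  cleared of denominators to suit an induction on the first letter. The words beginning with a
  contribute the share N (s, a), and these shares add up to the number of occurrences of s, the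
  factor by which its factorial grows.\<close>

lemma card_tclass:
  assumes "finite A" "finite S" "set ss \<subseteq> S"
    and "\<And>s. s \<in> S \<Longrightarrow> (\<Sum>a\<in>A. N (s, a)) = count_list ss s"
    and "\<And>s a. (s, a) \<notin> S \<times> A \<Longrightarrow> N (s, a) = 0"
  shows "card (tclass ss N) * (\<Prod>z\<in>S \<times> A. fact (N z)) = (\<Prod>s\<in>S. fact (count_list ss s) :: nat)"
  using assms(3-)
proof (induction ss arbitrary: N)
  case Nil
  have "N z = 0" for z
  proof (cases "z \<in> S \<times> A")
    case True
    then have "(\<Sum>a\<in>A. N (fst z, a)) = 0" using Nil.prems(2)[of "fst z"] by auto
    then show ?thesis using True assms(1) by (auto simp: mem_Times_iff)
  qed (use Nil.prems(3)[of "fst z" "snd z"] in auto)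
  then have "N = (\<lambda>_. 0)" by auto
  then have "tclass [] N = {[]}" unfolding tclass_def by auto
  then show ?case using \<open>N = (\<lambda>_. 0)\<close> by simp
next
  case (Cons s ss)
  let ?N = "\<lambda>a. N((s, a) := N (s, a) - 1)"
  let ?A = "{a \<in> A. 0 < N (s, a)}"
  have s: "s \<in> S" using Cons.prems by simp
  have tc: "tclass (s # ss) N = (\<Union>a\<in>?A. (#) a ` tclass ss (?N a))"
  proof (intro equalityI subsetI)
    fix xs assume xs: "xs \<in> tclass (s # ss) N"
    then obtain a as where as: "xs = a # as" "length as = length ss"
      by (auto simp: tclass_def length_Suc_conv)
    have cnt: "count_list ((s, a) # zip ss as) = N" using xs as by (simp add: tclass_def)
    then have "N (s, a) = Suc (count_list (zip ss as) (s, a))" by auto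
    then have "a \<in> ?A" using Cons.prems(3)[of s a] by force
    moreover have "count_list (zip ss as) = ?N a"
      unfolding cnt[symmetric] by (auto simp: fun_eq_iff)
    ultimately show "xs \<in> (\<Union>a\<in>?A. (#) a ` tclass ss (?N a))"
      using as by (auto simp: tclass_def)
  next
    fix xs assume "xs \<in> (\<Union>a\<in>?A. (#) a ` tclass ss (?N a))"
    then obtain a as where "a \<in> ?A" "xs = a # as" "length as = length ss" "count_list (zip ss as) = ?N a"
      by (auto simp: tclass_def)
    then show "xs \<in> tclass (s # ss) N" by (auto simp: tclass_def fun_eq_iff)
  qed
  have fin: "finite (tclass ss (?N a))" for a
    by (rule finite_tclass[OF assms(1)]) (use Cons.prems(3) in auto)
  have "card (tclass (s # ss) N) = (\<Sum>a\<in>?A. card ((#) a ` tclass ss (?N a)))"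
    unfolding tc by (rule card_UN_disjoint) (use assms(1) fin in auto)
  also have "\<dots> = (\<Sum>a\<in>?A. card (tclass ss (?N a)))"
    by (intro sum.cong refl card_image) auto
  finally have card: "card (tclass (s # ss) N) = (\<Sum>a\<in>?A. card (tclass ss (?N a)))" .
  have step: "card (tclass ss (?N a)) * (\<Prod>z\<in>S \<times> A. fact (N z)) = N (s, a) * (\<Prod>s\<in>S. fact (count_list ss s))"
    if a: "a \<in> ?A" for a
  proof -
    have z: "(s, a) \<in> S \<times> A" and fS: "finite (S \<times> A)" using a s assms by auto
    have "(\<Prod>z\<in>S \<times> A. fact (N z)) = (fact (N (s, a)) :: nat) * (\<Prod>z\<in>S \<times> A - {(s, a)}. fact (N z))"
      by (rule prod.remove[OF fS z])
    also have "(\<Prod>z\<in>S \<times> A - {(s, a)}. fact (N z)) = (\<Prod>z\<in>S \<times> A - {(s, a)}. fact (?N a z) :: nat)"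
      by (intro prod.cong) auto
    also have "fact (N (s, a)) = N (s, a) * (fact (?N a (s, a)) :: nat)"
      using a by (simp add: fact_reduce)
    finally have "(\<Prod>z\<in>S \<times> A. fact (N z)) = N (s, a) * (\<Prod>z\<in>S \<times> A. fact (?N a z) :: nat)"
      by (subst (2) prod.remove[OF fS z]) (simp only: mult.assoc)
    moreover have "card (tclass ss (?N a)) * (\<Prod>z\<in>S \<times> A. fact (?N a z)) = (\<Prod>s\<in>S. fact (count_list ss s) :: nat)"
    proof (rule Cons.IH)
      fix s' assume s': "s' \<in> S"
      show "(\<Sum>b\<in>A. ?N a (s', b)) = count_list ss s'"
      proof (cases "s' = s")
        case True
        have "(\<Sum>b\<in>A. N (s, b)) = N (s, a) + (\<Sum>b\<in>A - {a}. N (s, b))"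
          by (rule sum.remove) (use a assms(1) in auto)
        moreover have "(\<Sum>b\<in>A. ?N a (s, b)) = ?N a (s, a) + (\<Sum>b\<in>A - {a}. ?N a (s, b))"
          by (rule sum.remove) (use a assms(1) in auto)
        moreover have "(\<Sum>b\<in>A - {a}. ?N a (s, b)) = (\<Sum>b\<in>A - {a}. N (s, b))"
          by (intro sum.cong) auto
        ultimately show ?thesis using Cons.prems(2)[OF s] a True by simp
      next
        case False
        then show ?thesis using Cons.prems(2)[OF s'] by simp
      qed
    qed (use Cons.prems in auto)
    ultimately show ?thesis by (simp only: mult.assoc mult.left_commute)
  qed
  have "card (tclass (s # ss) N) * (\<Prod>z\<in>S \<times> A. fact (N z)) = (\<Sum>a\<in>?A. N (s, a)) * (\<Prod>s\<in>S. fact (count_list ss s))"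
    unfolding card sum_distrib_right by (intro sum.cong refl step)
  also have "(\<Sum>a\<in>?A. N (s, a)) = (\<Sum>a\<in>A. N (s, a))"
    by (rule sum.mono_neutral_left) (use assms(1) in auto)
  also have "\<dots> = Suc (count_list ss s)" using Cons.prems(2)[OF s] by simp
  also have "Suc (count_list ss s) * (\<Prod>s\<in>S. fact (count_list ss s)) = (\<Prod>s'\<in>S. fact (count_list (s # ss) s'))"
  proof -
    have "(\<Prod>s'\<in>S - {s}. fact (count_list (s # ss) s')) = (\<Prod>s'\<in>S - {s}. fact (count_list ss s') :: nat)"
      by (intro prod.cong) auto
    then show ?thesis by (simp add: prod.remove[OF assms(2) s] algebra_simps)
  qed
  finally show ?case .
qed

text \<open>The linear terms of Stirling's formula cancel because the N (s, a) add up to the count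
  of s (\<open>mass\<close>). Each factorial then costs at most \<open>\<tau>\<close>, and only
  those on the relevant side of the inequality do.\<close>

lemma log_card_tclass:
  fixes N :: "'s \<times> 'a \<Rightarrow> nat" and \<tau> :: real
  assumes fin: "finite A" "finite S" and ss: "set ss \<subseteq> S" "length ss = n"
    and N: "\<And>s. s \<in> S \<Longrightarrow> (\<Sum>a\<in>A. N (s, a)) = count_list ss s"
    and N0: "\<And>s a. (s, a) \<notin> S \<times> A \<Longrightarrow> N (s, a) = 0"
  defines "\<tau> \<equiv> log 2 (exp 1 * (real n + 1))"
  shows "0 < card (tclass ss N)"
    and "(\<Sum>s\<in>S. xlog (count_list ss s)) - (\<Sum>z\<in>S \<times> A. xlog (N z)) - card S * card A * \<tau> \<le> log 2 (card (tclass ss N))"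
    and "log 2 (card (tclass ss N)) \<le> (\<Sum>s\<in>S. xlog (count_list ss s)) - (\<Sum>z\<in>S \<times> A. xlog (N z)) + card S * \<tau>"
proof -
  have eq: "card (tclass ss N) * (\<Prod>z\<in>S \<times> A. fact (N z)) = (\<Prod>s\<in>S. fact (count_list ss s) :: nat)"
    by (rule card_tclass) (use assms in auto)
  moreover have "(\<Prod>s\<in>S. fact (count_list ss s) :: nat) \<noteq> 0" using fin by simp
  ultimately show pos: "0 < card (tclass ss N)" by (metis gr0I mult_0)
  have lp: "log 2 (real (\<Prod>i\<in>I. fact (h i) :: nat)) = (\<Sum>i\<in>I. log 2 (fact (h i)))" if "finite I" for I :: "'i set" and h
  proof -
    have "ln (\<Prod>i\<in>I. fact (h i) :: real) = (\<Sum>i\<in>I. ln (fact (h i)))" by (rule ln_prod) (use that in auto)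
    then show ?thesis by (simp add: log_def sum_divide_distrib)
  qed
  have "real (card (tclass ss N)) * real (\<Prod>z\<in>S \<times> A. fact (N z) :: nat) = real (\<Prod>s\<in>S. fact (count_list ss s) :: nat)"
    using eq by (metis of_nat_mult)
  then have "log 2 (card (tclass ss N)) + log 2 (real (\<Prod>z\<in>S \<times> A. fact (N z) :: nat)) = log 2 (real (\<Prod>s\<in>S. fact (count_list ss s) :: nat))"
    using pos fin by (metis (no_types, lifting) fact_nonzero log_mult_pos of_nat_0_less_iff prod_pos fact_gt_zero)
  then have lc: "log 2 (card (tclass ss N)) = (\<Sum>s\<in>S. log 2 (fact (count_list ss s))) - (\<Sum>z\<in>S \<times> A. log 2 (fact (N z)))"
    using fin by (simp only: lp finite_cartesian_product)
  have cn: "count_list ss s \<le> n" for s using count_le_length[of ss s] ss by simp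
  have Nn: "N z \<le> n" if "z \<in> S \<times> A" for z
  proof -
    have "N (fst z, snd z) \<le> (\<Sum>a\<in>A. N (fst z, a))" by (rule member_le_sum) (use that fin in auto)
    then show ?thesis using N[of "fst z"] cn[of "fst z"] that by auto
  qed
  let ?e = "log 2 (exp 1)"
  have mass: "(\<Sum>s\<in>S. count_list ss s * ?e) = (\<Sum>z\<in>S \<times> A. N z * ?e)"
    unfolding sum.cartesian_product' by (intro sum.cong refl) (simp only: N[symmetric] of_nat_sum sum_distrib_right)
  have 1: "(\<Sum>s\<in>S. xlog (count_list ss s) - count_list ss s * ?e) \<le> (\<Sum>s\<in>S. log 2 (fact (count_list ss s)))"
    by (intro sum_mono log_fact_bounds(1)[OF cn])
  have 2: "(\<Sum>s\<in>S. log 2 (fact (count_list ss s))) \<le> (\<Sum>s\<in>S. xlog (count_list ss s) - count_list ss s * ?e + \<tau>)"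
    unfolding \<tau>_def by (intro sum_mono log_fact_bounds(2)[OF cn])
  have 3: "(\<Sum>z\<in>S \<times> A. xlog (N z) - N z * ?e) \<le> (\<Sum>z\<in>S \<times> A. log 2 (fact (N z)))"
    by (intro sum_mono log_fact_bounds(1)[OF Nn])
  have 4: "(\<Sum>z\<in>S \<times> A. log 2 (fact (N z))) \<le> (\<Sum>z\<in>S \<times> A. xlog (N z) - N z * ?e + \<tau>)"
    unfolding \<tau>_def by (intro sum_mono log_fact_bounds(2)[OF Nn])
  show "(\<Sum>s\<in>S. xlog (count_list ss s)) - (\<Sum>z\<in>S \<times> A. xlog (N z)) - card S * card A * \<tau> \<le> log 2 (card (tclass ss N))"
    using 1 4 mass by (simp add: lc sum.distrib sum_subtractf card_cartesian_product)
  show "log 2 (card (tclass ss N)) \<le> (\<Sum>s\<in>S. xlog (count_list ss s)) - (\<Sum>z\<in>S \<times> A. xlog (N z)) + card S * \<tau>"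
    using 2 3 mass by (simp add: lc sum.distrib sum_subtractf)
qed

section \<open>Greedy coverings and the type covering lemma\<close>

text \<open>Greedy choice: by double counting, some element of \<Omega> covers at least the average
  share \<alpha> of what is still uncovered, which therefore shrinks by a factor 1 - \<alpha> in
  every round.\<close>

lemma fractional_cover_step:
  fixes \<alpha> :: real
  assumes fin: "finite X" "finite \<Omega>" and \<Omega>: "\<Omega> \<noteq> {}" and \<alpha>: "0 \<le> \<alpha>" "\<alpha> \<le> 1"
    and frac: "\<And>x. x \<in> X \<Longrightarrow> \<alpha> * card \<Omega> \<le> card {\<omega>\<in>\<Omega>. cov x \<omega>}"
  shows "\<exists>C\<subseteq>\<Omega>. card C \<le> L \<and> card {x\<in>X. \<forall>\<omega>\<in>C. \<not> cov x \<omega>} \<le> (1 - \<alpha>) ^ L * card X"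
proof (induction L)
  case 0
  show ?case by (intro exI[of _ "{}"]) auto
next
  case (Suc L)
  then obtain C where C: "C \<subseteq> \<Omega>" "card C \<le> L" "card {x\<in>X. \<forall>\<omega>\<in>C. \<not> cov x \<omega>} \<le> (1 - \<alpha>) ^ L * card X" by blast
  let ?U = "{x\<in>X. \<forall>\<omega>\<in>C. \<not> cov x \<omega>}"
  have finU: "finite ?U" using fin by simp
  have "(\<Sum>\<omega>\<in>\<Omega>. card {x\<in>?U. cov x \<omega>}) = (\<Sum>x\<in>?U. card {\<omega>\<in>\<Omega>. cov x \<omega>})"
    using fin finU by (intro sum_multicount_gen) auto
  then have "real (\<Sum>\<omega>\<in>\<Omega>. card {x\<in>?U. cov x \<omega>}) = (\<Sum>x\<in>?U. real (card {\<omega>\<in>\<Omega>. cov x \<omega>}))"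
    by simp
  also have "\<dots> \<ge> (\<Sum>x\<in>?U. \<alpha> * card \<Omega>)" by (intro sum_mono frac) auto
  finally have ge: "(\<Sum>\<omega>\<in>\<Omega>. \<alpha> * card ?U) \<le> (\<Sum>\<omega>\<in>\<Omega>. real (card {x\<in>?U. cov x \<omega>}))"
    by (simp add: mult.commute mult.left_commute)
  have "\<exists>\<omega>\<in>\<Omega>. \<alpha> * card ?U \<le> card {x\<in>?U. cov x \<omega>}"
  proof (rule ccontr)
    assume "\<not> ?thesis"
    then have "(\<Sum>\<omega>\<in>\<Omega>. real (card {x\<in>?U. cov x \<omega>})) < (\<Sum>\<omega>\<in>\<Omega>. \<alpha> * card ?U)"
      using fin(2) \<Omega> by (intro sum_strict_mono) (auto simp: not_le)
    with ge show False by simp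
  qed
  then obtain \<omega> where \<omega>: "\<omega> \<in> \<Omega>" "\<alpha> * card ?U \<le> card {x\<in>?U. cov x \<omega>}" by blast
  have "{x\<in>X. \<forall>\<omega>\<in>insert \<omega> C. \<not> cov x \<omega>} = ?U - {x\<in>?U. cov x \<omega>}" by auto
  moreover have "card (?U - {x\<in>?U. cov x \<omega>}) = card ?U - card {x\<in>?U. cov x \<omega>}"
    by (rule card_Diff_subset) (use fin in auto)
  moreover have "card {x\<in>?U. cov x \<omega>} \<le> card ?U" by (rule card_mono[OF finU]) auto
  ultimately have "real (card {x\<in>X. \<forall>\<omega>\<in>insert \<omega> C. \<not> cov x \<omega>}) = real (card ?U) - card {x\<in>?U. cov x \<omega>}"
    by (simp only: of_nat_diff)
  also have "\<dots> \<le> (1 - \<alpha>) * card ?U" using \<omega> by (simp add: algebra_simps)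
  also have "\<dots> \<le> (1 - \<alpha>) * ((1 - \<alpha>) ^ L * card X)" using C \<alpha> by (intro mult_left_mono) auto
  finally have "card {x\<in>X. \<forall>\<omega>\<in>insert \<omega> C. \<not> cov x \<omega>} \<le> (1 - \<alpha>) ^ Suc L * card X" by simp
  moreover have "card (insert \<omega> C) \<le> Suc L" using C card_insert_le_m1[of "Suc L" C \<omega>] by simp
  ultimately show ?case using \<omega> C by (intro exI[of _ "insert \<omega> C"]) auto
qed

lemma fractional_cover:
  fixes \<alpha> :: real
  assumes fin: "finite X" "finite \<Omega>" and ne: "X \<noteq> {}" "\<Omega> \<noteq> {}" and \<alpha>: "0 < \<alpha>"
    and frac: "\<And>x. x \<in> X \<Longrightarrow> \<alpha> * card \<Omega> \<le> card {\<omega>\<in>\<Omega>. cov x \<omega>}"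
  obtains C where "C \<subseteq> \<Omega>" "card C \<le> (ln (card X) + 1) / \<alpha>" "\<And>x. x \<in> X \<Longrightarrow> \<exists>\<omega>\<in>C. cov x \<omega>"
proof -
  obtain x0 where "x0 \<in> X" using ne by blast
  then have "\<alpha> * card \<Omega> \<le> card {\<omega>\<in>\<Omega>. cov x0 \<omega>}" using frac by blast
  also have "\<dots> \<le> 1 * card \<Omega>" using fin by (simp add: card_mono)
  finally have \<alpha>1: "\<alpha> \<le> 1" using fin ne by (simp add: card_gt_0_iff)
  \<comment> \<open>The least integer exceeding ln (card X) / \<alpha>. Since 1 - \<alpha> \<le> exp
    (- \<alpha>), fewer than one element is uncovered after \<open>L\<close> rounds, hence
    none.\<close>
  define L where "L = Suc (nat \<lfloor>ln (card X) / \<alpha>\<rfloor>)"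
  have X1: "1 \<le> card X" using fin ne by (simp add: Suc_le_eq card_gt_0_iff)
  then have lnX: "0 \<le> ln (card X)" by simp
  obtain C where C: "C \<subseteq> \<Omega>" "card C \<le> L" "card {x\<in>X. \<forall>\<omega>\<in>C. \<not> cov x \<omega>} \<le> (1 - \<alpha>) ^ L * card X"
    using fractional_cover_step[where cov=cov and L=L, OF fin ne(2) _ \<alpha>1 frac] \<alpha> by auto
  have "ln (card X) / \<alpha> < L" unfolding L_def using lnX \<alpha> by (simp add: floor_less_iff) linarith
  then have lt: "ln (card X) < \<alpha> * L" using \<alpha> by (simp add: divide_less_eq mult.commute)
  have "(1 - \<alpha>) ^ L \<le> exp (- \<alpha>) ^ L" using \<alpha>1 exp_ge_add_one_self[of "-\<alpha>"] by (intro power_mono) auto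
  also have "\<dots> = exp (- (\<alpha> * L))" by (simp add: exp_of_nat_mult[symmetric] mult.commute)
  also have "\<dots> < exp (- ln (card X))" using lt by simp
  also have "\<dots> = 1 / card X" using X1 by (simp add: exp_minus inverse_eq_divide)
  finally have "(1 - \<alpha>) ^ L * card X < 1" using X1 by (simp add: field_simps)
  with C(3) have "card {x\<in>X. \<forall>\<omega>\<in>C. \<not> cov x \<omega>} = 0" by linarith
  then have cover: "\<exists>\<omega>\<in>C. cov x \<omega>" if "x \<in> X" for x using that fin by auto
  have "real L \<le> ln (card X) / \<alpha> + 1" unfolding L_def using lnX \<alpha> by simp
  also have "\<dots> \<le> (ln (card X) + 1) / \<alpha>" using \<alpha> \<alpha>1 by (simp add: field_simps)
  finally have "card C \<le> (ln (card X) + 1) / \<alpha>" using C(2) by linarith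
  with C(1) cover show thesis using that by blast
qed

text \<open>Type covering with side information cs, without random coding: every word as of the
  prescribed type is covered by a fraction 2^(- n I) of the candidates bs, up to a polynomial
  factor, so the greedy covering needs about 2^(n I) of them. It is used twice, with constant cs for
  the helper's codebook and with cs the codeword for the reconstructions.\<close>

lemma type_cover:
  fixes N :: "'a \<Rightarrow> 'b \<Rightarrow> 'c \<Rightarrow> nat"
  assumes fin: "finite A" "finite B" "finite C" and n: "1 \<le> n" and cs: "length cs = n" "set cs \<subseteq> C"
    and N0: "\<And>a b c. (a, b, c) \<notin> A \<times> B \<times> C \<Longrightarrow> N a b c = 0"
  shows "\<exists>S. finite S \<and> S \<subseteq> {bs. length bs = n \<and> set bs \<subseteq> B} \<and>
    real (card S) \<le> 2 powr (n * cond_mutual_info A B C (\<lambda>a b c. N a b c / n)) *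
      ((n * ln (card A) + 1) * (exp 1 * (real n + 1)) ^ (card A * card B * card C + card C)) \<and>
    (\<forall>as. length as = n \<longrightarrow> (\<forall>a c. count_list (zip as cs) (a, c) = (\<Sum>b\<in>B. N a b c)) \<longrightarrow>
      (\<exists>bs\<in>S. \<forall>a b c. count_list (zip as (zip bs cs)) (a, b, c) = N a b c))"
proof -
  define X where "X = {as. length as = n \<and> (\<forall>a c. count_list (zip as cs) (a, c) = (\<Sum>b\<in>B. N a b c))}"
  define I where "I = cond_mutual_info A B C (\<lambda>a b c. N a b c / n)"
  define \<tau> where "\<tau> = log 2 (exp 1 * (real n + 1))"
  \<comment> \<open>The candidates form the conditional class of \<open>Ncb\<close> given cs; those
    that cover a fixed as include the class of \<open>N'\<close> given the pair (as, cs).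
    \<open>hi\<close> and \<open>lo\<close> bound the logarithms of the two sizes, and
    \<open>hi - lo\<close> is n I plus a multiple of \<open>\<tau>\<close>.\<close>
  define Ncb where "Ncb = (\<lambda>(c, b). \<Sum>a\<in>A. N a b c)"
  define N' where "N' = (\<lambda>((a, c), b). N a b c)"
  define \<Omega> where "\<Omega> = tclass cs Ncb"
  define lo where "lo = (\<Sum>a\<in>A. \<Sum>c\<in>C. xlog (\<Sum>b\<in>B. N a b c)) - (\<Sum>a\<in>A. \<Sum>b\<in>B. \<Sum>c\<in>C. xlog (N a b c))
    - card A * card B * card C * \<tau>"
  define hi where "hi = (\<Sum>c\<in>C. xlog (\<Sum>a\<in>A. \<Sum>b\<in>B. N a b c)) - (\<Sum>b\<in>B. \<Sum>c\<in>C. xlog (\<Sum>a\<in>A. N a b c)) + card C * \<tau>"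
  let ?cov = "\<lambda>as bs. \<forall>a b c. count_list (zip as (zip bs cs)) (a, b, c) = N a b c"
  show ?thesis
  proof (cases "X = {}")
    case True
    have "0 \<le> ln (real (card A))" by (cases "card A = 0") auto
    then show ?thesis using True by (intro exI[of _ "{}"]) (auto simp: X_def)
  next
    case False
    have setX: "set (zip as cs) \<subseteq> A \<times> C \<and> set as \<subseteq> A" if "as \<in> X" for as
    proof -
      have "z \<in> A \<times> C" if z: "z \<in> set (zip as cs)" for z
      proof (rule ccontr)
        assume "z \<notin> A \<times> C"
        then have "(\<Sum>b\<in>B. N (fst z) b (snd z)) = 0" by (intro sum.neutral ballI N0) (auto simp: mem_Times_iff)
        moreover have "count_list (zip as cs) (fst z, snd z) = (\<Sum>b\<in>B. N (fst z) b (snd z))"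
          using \<open>as \<in> X\<close> by (simp only: X_def mem_Collect_eq)
        ultimately show False using z by (simp add: count_list_0_iff)
      qed
      then have sub: "set (zip as cs) \<subseteq> A \<times> C" by blast
      have "set as = set (map fst (zip as cs))" using that cs by (simp add: X_def)
      also have "\<dots> \<subseteq> A" unfolding set_map using sub by fastforce
      finally show ?thesis using sub by blast
    qed
    have finX: "finite X" and cardX: "card X \<le> card A ^ n"
    proof -
      have sub: "X \<subseteq> {as. set as \<subseteq> A \<and> length as = n}" using setX by (auto simp: X_def)
      show "finite X" using finite_subset[OF sub finite_lists_length_eq[OF fin(1)]] .
      show "card X \<le> card A ^ n"
        using card_mono[OF finite_lists_length_eq[OF fin(1)] sub] by (simp add: card_lists_length_eq fin)
    qed
    \<comment> \<open>One element of \<open>X\<close> is enough to express the counts of cs by N,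
      which gives \<open>Ncb\<close> the marginals that \<open>log_card_tclass\<close> asks
      for.\<close>
    obtain as0 where as0: "as0 \<in> X" using False by blast
    have cnt_cs: "count_list cs c = (\<Sum>a\<in>A. \<Sum>b\<in>B. N a b c)" if c: "c \<in> C" for c
    proof -
      have "count_list (map snd (zip as0 cs)) c = (\<Sum>z\<in>{z\<in>A \<times> C. snd z = c}. count_list (zip as0 cs) z)"
        by (rule count_list_map_sum) (use setX[OF as0] fin in auto)
      also have "{z\<in>A \<times> C. snd z = c} = (\<lambda>a. (a, c)) ` A" using c by auto
      also have "(\<Sum>z\<in>(\<lambda>a. (a, c)) ` A. count_list (zip as0 cs) z) = (\<Sum>a\<in>A. \<Sum>b\<in>B. N a b c)"
        using as0 by (subst sum.reindex) (auto simp: inj_on_def X_def)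
      finally show ?thesis using as0 cs by (simp add: X_def)
    qed
    have Ncb_sum: "(\<Sum>b\<in>B. Ncb (c, b)) = count_list cs c" if "c \<in> C" for c
      unfolding cnt_cs[OF that] Ncb_def by (simp add: sum.swap[of _ B])
    have Ncb0: "Ncb (c, b) = 0" if "(c, b) \<notin> C \<times> B" for c b
      unfolding Ncb_def prod.case by (intro sum.neutral ballI N0) (use that in auto)
    note \<Omega>_bounds = log_card_tclass[OF fin(2,3) cs(2,1) Ncb_sum Ncb0, folded \<Omega>_def \<tau>_def]
    have fin\<Omega>: "finite \<Omega>" unfolding \<Omega>_def by (rule finite_tclass[OF fin(2)]) (use Ncb0 in auto)
    have hi: "log 2 (card \<Omega>) \<le> hi"
    proof -
      have "(\<Sum>c\<in>C. xlog (count_list cs c)) = (\<Sum>c\<in>C. xlog (\<Sum>a\<in>A. \<Sum>b\<in>B. N a b c))"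
        by (intro sum.cong refl) (simp add: cnt_cs)
      moreover have "(\<Sum>z\<in>C \<times> B. xlog (Ncb z)) = (\<Sum>b\<in>B. \<Sum>c\<in>C. xlog (\<Sum>a\<in>A. N a b c))"
        by (simp add: sum.cartesian_product' Ncb_def sum.swap[of _ B])
      ultimately show ?thesis using \<Omega>_bounds(3) by (simp add: hi_def)
    qed
    have cov: "2 powr lo \<le> card {bs\<in>\<Omega>. ?cov as bs}" if as: "as \<in> X" for as
    proof -
      have zlen: "length (zip as cs) = n" using as cs by (simp add: X_def)
      have N'_sum: "(\<Sum>b\<in>B. N' (s, b)) = count_list (zip as cs) s" for s
        using as by (cases s) (simp add: N'_def X_def)
      have N'0: "N' (s, b) = 0" if "(s, b) \<notin> (A \<times> C) \<times> B" for s b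
        using that N0 by (cases s) (auto simp: N'_def)
      note bounds = log_card_tclass[OF fin(2) finite_cartesian_product[OF fin(1,3)] conjunct1[OF setX[OF as]] zlen N'_sum N'0, folded \<tau>_def]
      have "tclass (zip as cs) N' \<subseteq> {bs\<in>\<Omega>. ?cov as bs}"
      proof
        fix bs assume "bs \<in> tclass (zip as cs) N'"
        then have bs: "length bs = n" and cnt: "count_list (zip (zip as cs) bs) = N'"
          using zlen by (auto simp: tclass_def)
        have sub: "set (zip (zip as cs) bs) \<subseteq> (A \<times> C) \<times> B"
        proof
          fix z assume "z \<in> set (zip (zip as cs) bs)"
          then have "N' z \<noteq> 0" by (simp add: count_list_0_iff cnt[symmetric])
          then show "z \<in> (A \<times> C) \<times> B" using N'0[of "fst z" "snd z"] by (cases z) auto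
        qed
        have z1: "zip cs bs = map (\<lambda>z. (snd (fst z), snd z)) (zip (zip as cs) bs)"
          using as bs cs by (intro nth_equalityI) (auto simp: X_def)
        have z2: "zip as (zip bs cs) = map (\<lambda>z. (fst (fst z), snd z, snd (fst z))) (zip (zip as cs) bs)"
          using as bs cs by (intro nth_equalityI) (auto simp: X_def)
        have "count_list (zip cs bs) (c, b) = Ncb (c, b)" for c b
        proof (cases "(c, b) \<in> C \<times> B")
          case True
          have "count_list (zip cs bs) (c, b) = (\<Sum>z\<in>{z\<in>(A \<times> C) \<times> B. (snd (fst z), snd z) = (c, b)}. N' z)"
            unfolding z1 cnt[symmetric] by (rule count_list_map_sum[OF sub]) (use fin in auto)
          also have "{z\<in>(A \<times> C) \<times> B. (snd (fst z), snd z) = (c, b)} = (\<lambda>a. ((a, c), b)) ` A"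
            using True by auto
          also have "(\<Sum>z\<in>(\<lambda>a. ((a, c), b)) ` A. N' z) = Ncb (c, b)"
            by (subst sum.reindex) (auto simp: inj_on_def N'_def Ncb_def)
          finally show ?thesis .
        next
          case False
          have "(c, b) \<notin> set (zip cs bs)" unfolding z1 set_map using sub False by fastforce
          then show ?thesis using Ncb0[OF False] by simp
        qed
        then have "bs \<in> \<Omega>" using bs cs by (auto simp: \<Omega>_def tclass_def)
        moreover have "?cov as bs"
        proof (intro allI)
          fix a b c
          have "inj (\<lambda>z :: ('a \<times> 'c) \<times> 'b. (fst (fst z), snd z, snd (fst z)))" by (auto simp: inj_on_def)
          from count_list_map_conv[OF this, of "zip (zip as cs) bs" "((a, c), b)"]
          show "count_list (zip as (zip bs cs)) (a, b, c) = N a b c"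
            unfolding z2 by (simp add: cnt N'_def)
        qed
        ultimately show "bs \<in> {bs\<in>\<Omega>. ?cov as bs}" by simp
      qed
      then have "card (tclass (zip as cs) N') \<le> card {bs\<in>\<Omega>. ?cov as bs}"
        by (rule card_mono[rotated]) (use fin\<Omega> in simp)
      moreover have "lo \<le> log 2 (card (tclass (zip as cs) N'))"
      proof -
        have "(\<Sum>s\<in>A \<times> C. xlog (count_list (zip as cs) s)) = (\<Sum>a\<in>A. \<Sum>c\<in>C. xlog (\<Sum>b\<in>B. N a b c))"
          using as by (simp add: sum.cartesian_product' X_def)
        moreover have "(\<Sum>z\<in>(A \<times> C) \<times> B. xlog (N' z)) = (\<Sum>a\<in>A. \<Sum>b\<in>B. \<Sum>c\<in>C. xlog (N a b c))"
          by (simp add: sum.cartesian_product' N'_def sum.swap[of _ B])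
        ultimately show ?thesis using bounds(2) by (simp add: lo_def card_cartesian_product mult_ac)
      qed
      then have "2 powr lo \<le> card (tclass (zip as cs) N')"
        using bounds(1) by (simp add: le_log_iff)
      ultimately show ?thesis by linarith
    qed
    have \<Omega>_pos: "0 < card \<Omega>" by (rule \<Omega>_bounds(1))
    have "2 powr (lo - hi) * card \<Omega> \<le> 2 powr lo"
    proof -
      have "card \<Omega> \<le> 2 powr hi" using hi \<Omega>_pos by (simp add: log_le_iff)
      then have "2 powr (lo - hi) * card \<Omega> \<le> 2 powr (lo - hi) * 2 powr hi" by (rule mult_left_mono) simp
      also have "\<dots> = 2 powr lo" by (simp add: powr_add[symmetric])
      finally show ?thesis .
    qed
    then have frac: "2 powr (lo - hi) * card \<Omega> \<le> card {bs\<in>\<Omega>. ?cov as bs}" if "as \<in> X" for as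
      using cov[OF that] by linarith
    have \<Omega>_ne: "\<Omega> \<noteq> {}" using \<Omega>_pos by auto
    obtain S where S: "S \<subseteq> \<Omega>" "card S \<le> (ln (card X) + 1) / 2 powr (lo - hi)" "\<And>as. as \<in> X \<Longrightarrow> \<exists>bs\<in>S. ?cov as bs"
      using fractional_cover[where cov="?cov", OF finX fin\<Omega> False \<Omega>_ne _ frac] by auto
    have "ln (card X) \<le> ln (real (card A ^ n))"
      using cardX finX False by (intro ln_mono) (auto simp: card_gt_0_iff simp del: of_nat_power)
    also have "\<dots> = n * ln (card A)"
    proof -
      have "0 < card A" using setX[OF as0] as0 n fin by (cases as0) (auto simp: card_gt_0_iff X_def)
      then show ?thesis by (simp add: ln_realpow)
    qed
    finally have lnX: "ln (card X) + 1 \<le> n * ln (card A) + 1" by simp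
    have "hi - lo = n * I + (card A * card B * card C + card C) * \<tau>"
      using cond_mutual_info_scale[OF fin, of n N] n unfolding I_def hi_def lo_def by (simp add: algebra_simps)
    then have "1 / 2 powr (lo - hi) = 2 powr (n * I + \<tau> * real (card A * card B * card C + card C))"
      by (simp add: powr_minus_divide[symmetric] mult.commute)
    also have "\<dots> = 2 powr (n * I) * (2 powr \<tau>) ^ (card A * card B * card C + card C)"
      unfolding powr_add powr_powr[symmetric] by (subst powr_realpow) auto
    also have "2 powr \<tau> = exp 1 * (real n + 1)" unfolding \<tau>_def by (rule powr_log_cancel) (auto intro!: mult_pos_pos)
    finally have pw: "1 / 2 powr (lo - hi) = 2 powr (n * I) * (exp 1 * (real n + 1)) ^ (card A * card B * card C + card C)" .
    have "card S \<le> (ln (card X) + 1) * (1 / 2 powr (lo - hi))" using S(2) by simp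
    also have "\<dots> \<le> (n * ln (card A) + 1) * (1 / 2 powr (lo - hi))"
      using lnX by (intro mult_right_mono) auto
    finally have "card S \<le> 2 powr (n * I) * ((n * ln (card A) + 1) * (exp 1 * (real n + 1)) ^ (card A * card B * card C + card C))"
      unfolding pw by (simp only: mult_ac)
    moreover have "S \<subseteq> {bs. length bs = n \<and> set bs \<subseteq> B}"
    proof
      fix bs assume "bs \<in> S"
      then have bs: "length bs = n" "count_list (zip cs bs) = Ncb" using S(1) cs by (auto simp: \<Omega>_def tclass_def)
      have "b \<in> B" if "b \<in> set bs" for b
      proof -
        have "set bs = set (map snd (zip cs bs))" using bs cs by simp
        then have "b \<in> snd ` set (zip cs bs)" using that by (simp only: set_map)
        then obtain c where "(c, b) \<in> set (zip cs bs)" by force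
        then have "Ncb (c, b) \<noteq> 0" by (simp add: bs(2)[symmetric] count_list_0_iff)
        then show ?thesis using Ncb0[of c b] by auto
      qed
      then show "bs \<in> {bs. length bs = n \<and> set bs \<subseteq> B}" using bs by auto
    qed
    moreover have "finite S" using S(1) fin\<Omega> finite_subset by blast
    ultimately show ?thesis using S(3) unfolding I_def X_def by blast
  qed
qed

subsection \<open>Guessing orders\<close>

text \<open>Sorting by cost: the first i words all cost at most \<open>c (g i)\<close>, and there
  are at most K times that many such words.\<close>

lemma ex_ordering:
  fixes c :: "'a \<Rightarrow> nat"
  assumes fin: "finite \<Omega>" and le: "\<And>t. card {\<omega>\<in>\<Omega>. c \<omega> \<le> t} \<le> K * t"
  shows "\<exists>g. bij_betw g {1..card \<Omega>} \<Omega> \<and> (\<forall>i\<in>{1..card \<Omega>}. i \<le> K * c (g i))"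
proof -
  obtain ys where ys: "set ys = \<Omega>" "distinct ys" using finite_distinct_list[OF fin] by blast
  define xs where "xs = sort_key c ys"
  have xs: "set xs = \<Omega>" "distinct xs" "sorted (map c xs)" using ys by (simp_all add: xs_def)
  have len: "length xs = card \<Omega>" using xs distinct_card by metis
  define g where "g i = xs ! (i - 1)" for i
  have "bij_betw (\<lambda>i. i - 1) {1..card \<Omega>} {..<card \<Omega>}"
    by (rule bij_betwI[where g=Suc]) auto
  moreover have "bij_betw (nth xs) {..<card \<Omega>} \<Omega>"
    by (rule bij_betw_nth[OF xs(2)]) (simp_all add: xs(1) len)
  ultimately have "bij_betw (nth xs \<circ> (\<lambda>i. i - 1)) {1..card \<Omega>} \<Omega>"
    by (rule bij_betw_trans)
  then have bij: "bij_betw g {1..card \<Omega>} \<Omega>" by (simp add: g_def[abs_def] o_def)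
  moreover have "i \<le> K * c (g i)" if i: "i \<in> {1..card \<Omega>}" for i
  proof -
    have "nth xs ` {..<i} \<subseteq> {\<omega>\<in>\<Omega>. c \<omega> \<le> c (g i)}"
    proof
      fix \<omega> assume "\<omega> \<in> nth xs ` {..<i}"
      then obtain j where j: "j < i" "\<omega> = xs ! j" by blast
      then have "j < length xs" using i len by simp
      then have "\<omega> \<in> \<Omega>" using xs(1) j by auto
      moreover have "map c xs ! j \<le> map c xs ! (i - 1)"
        by (rule sorted_nth_mono[OF xs(3)]) (use i j len in auto)
      then have "c \<omega> \<le> c (g i)" using j i len \<open>j < length xs\<close> by (simp add: g_def)
      ultimately show "\<omega> \<in> {\<omega>\<in>\<Omega>. c \<omega> \<le> c (g i)}" by simp
    qed
    then have "card (nth xs ` {..<i}) \<le> card {\<omega>\<in>\<Omega>. c \<omega> \<le> c (g i)}"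
      by (rule card_mono[rotated]) (use fin in simp)
    moreover have "card (nth xs ` {..<i}) = i"
      using i len xs(2) by (subst card_image) (auto simp: inj_on_def nth_eq_iff_index_eq)
    ultimately show ?thesis using le[of "c (g i)"] by linarith
  qed
  ultimately show ?thesis by blast
qed

text \<open>Interleaving: one list serves all sets S j simultaneously and is worse by a factor K
  only. Words of cost at most t lie in the union of the at most K sets of size at most t.\<close>

lemma ex_ordering_family:
  assumes fin: "finite \<Omega>" "finite J" and J: "card J \<le> K" "1 \<le> K" and S: "\<And>j. j \<in> J \<Longrightarrow> S j \<subseteq> \<Omega>"
  shows "\<exists>g. bij_betw g {1..card \<Omega>} \<Omega> \<and>
    (\<forall>i\<in>{1..card \<Omega>}. \<forall>j\<in>J. g i \<in> S j \<longrightarrow> i \<le> K * card (S j))"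
proof -
  \<comment> \<open>The size of the smallest set containing the word. The inserted
    \<open>card \<Omega>\<close> gives words outside all the sets the maximal cost and keeps the
    argument of \<open>Min\<close> nonempty.\<close>
  define c where "c \<omega> = Min (insert (card \<Omega>) ((\<lambda>j. card (S j)) ` {j\<in>J. \<omega> \<in> S j}))" for \<omega>
  have c_le: "c \<omega> \<le> card (S j)" if "j \<in> J" "\<omega> \<in> S j" for \<omega> j
    unfolding c_def by (rule Min_le) (use fin that in auto)
  have "card {\<omega>\<in>\<Omega>. c \<omega> \<le> t} \<le> K * t" for t
  proof (cases "card \<Omega> \<le> t")
    case True
    have "card {\<omega>\<in>\<Omega>. c \<omega> \<le> t} \<le> card \<Omega>" by (rule card_mono) (use fin in auto)
    also have "\<dots> \<le> 1 * t" using True by simp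
    also have "\<dots> \<le> K * t" by (rule mult_le_mono1) (rule J)
    finally show ?thesis .
  next
    case False
    have "{\<omega>\<in>\<Omega>. c \<omega> \<le> t} \<subseteq> (\<Union>j\<in>{j\<in>J. card (S j) \<le> t}. S j)"
    proof
      fix \<omega> assume "\<omega> \<in> {\<omega>\<in>\<Omega>. c \<omega> \<le> t}"
      then have "c \<omega> \<le> t" by simp
      moreover have "c \<omega> \<in> insert (card \<Omega>) ((\<lambda>j. card (S j)) ` {j\<in>J. \<omega> \<in> S j})"
        unfolding c_def by (rule Min_in) (use fin in auto)
      ultimately show "\<omega> \<in> (\<Union>j\<in>{j\<in>J. card (S j) \<le> t}. S j)" using False by auto
    qed
    then have "card {\<omega>\<in>\<Omega>. c \<omega> \<le> t} \<le> card (\<Union>j\<in>{j\<in>J. card (S j) \<le> t}. S j)"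
      by (rule card_mono[rotated]) (use fin S in \<open>auto intro: finite_subset\<close>)
    also have "\<dots> \<le> (\<Sum>j\<in>{j\<in>J. card (S j) \<le> t}. card (S j))"
      by (rule card_UN_le) (use fin in simp)
    also have "\<dots> \<le> (\<Sum>j\<in>{j\<in>J. card (S j) \<le> t}. t)" by (rule sum_mono) simp
    also have "\<dots> \<le> card J * t" by (simp add: card_mono fin)
    also have "\<dots> \<le> K * t" using J by simp
    finally show ?thesis .
  qed
  from ex_ordering[OF fin(1) this] obtain g where g: "bij_betw g {1..card \<Omega>} \<Omega>"
    "\<And>i. i \<in> {1..card \<Omega>} \<Longrightarrow> i \<le> K * c (g i)" by blast
  have "i \<le> K * card (S j)" if "i \<in> {1..card \<Omega>}" "j \<in> J" "g i \<in> S j" for i j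
    using g(2)[OF that(1)] mult_le_mono2[OF c_le[OF that(2,3)], of K] by linarith
  with g(1) show ?thesis by blast
qed

lemma num_guesses_le:
  assumes "bij_betw (g m) {1..K} \<Omega>" "xh \<in> \<Omega>" "dbar d x xh \<le> D"
    and "\<And>i. i \<in> {1..K} \<Longrightarrow> g m i = xh \<Longrightarrow> i \<le> B"
  shows "num_guesses d D g x m \<le> B"
proof -
  have "xh \<in> g m ` {1..K}" using assms(1,2) by (simp add: bij_betw_imp_surj_on)
  then obtain i where i: "i \<in> {1..K}" "g m i = xh" by blast
  have "num_guesses d D g x m \<le> i" unfolding num_guesses_def
    by (rule Least_le) (use i assms(3) in auto)
  then show ?thesis using assms(4)[OF i] by linarith
qed

text \<open>With minimal coverings the code can be fixed before a joint type N of source and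
  reconstruction is chosen; N then enters only through the upper bound
  \<open>cover_number_type_le\<close> and may depend on the limiting types.\<close>

definition cover_number :: "('x \<Rightarrow> 'xh \<Rightarrow> real) \<Rightarrow> real \<Rightarrow> nat \<Rightarrow> 'x list set \<Rightarrow> nat" where
  "cover_number d D n X = (LEAST k. \<exists>S. S \<subseteq> {xh. length xh = n} \<and> card S = k \<and>
     (\<forall>x\<in>X. \<exists>xh\<in>S. dbar d x xh \<le> D))"

lemma cover_number_le:
  "S \<subseteq> {xh. length xh = n} \<Longrightarrow> (\<And>x. x \<in> X \<Longrightarrow> \<exists>xh\<in>S. dbar d x xh \<le> D) \<Longrightarrow> cover_number d D n X \<le> card S"
  unfolding cover_number_def by (rule Least_le) blast

lemma cover_number_attained:
  fixes d :: "'x \<Rightarrow> 'xh \<Rightarrow> real"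
  assumes "\<And>x. x \<in> X \<Longrightarrow> \<exists>xh. length xh = n \<and> dbar d x xh \<le> D"
  obtains S where "S \<subseteq> {xh. length xh = n}" "card S = cover_number d D n X"
    "\<And>x. x \<in> X \<Longrightarrow> \<exists>xh\<in>S. dbar d x xh \<le> D"
proof -
  have "\<exists>S. S \<subseteq> {xh. length xh = n} \<and> card S = card {xh :: 'xh list. length xh = n} \<and> (\<forall>x\<in>X. \<exists>xh\<in>S. dbar d x xh \<le> D)"
    using assms by (intro exI[of _ "{xh. length xh = n}"]) auto
  from LeastI[of "\<lambda>k. \<exists>S. S \<subseteq> {xh. length xh = n} \<and> card S = k \<and> (\<forall>x\<in>X. \<exists>xh\<in>S. dbar d x xh \<le> D)", OF this]
  show thesis using that unfolding cover_number_def by blast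
qed

lemma card_types_le:
  assumes "finite Z"
  shows "finite (count_list ` {zs. length zs = n \<and> set zs \<subseteq> Z})"
    and "card (count_list ` {zs. length zs = n \<and> set zs \<subseteq> Z}) \<le> (n + 1) ^ card Z"
proof -
  let ?T = "count_list ` {zs. length zs = n \<and> set zs \<subseteq> Z}"
  have fin: "finite (PiE Z (\<lambda>_. {..n}))" using assms by (intro finite_PiE) auto
  have inj: "inj_on (\<lambda>t. restrict t Z) ?T"
  proof (rule inj_onI)
    fix s t assume s: "s \<in> ?T" and t: "t \<in> ?T" and eq: "restrict s Z = restrict t Z"
    have "s z = t z" for z
    proof (cases "z \<in> Z")
      case True then show ?thesis using eq by (metis restrict_apply)
    next
      case False
      then have "s z = 0" "t z = 0" using s t by (auto simp: subset_iff intro!: count_notin)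
      then show ?thesis by simp
    qed
    then show "s = t" by blast
  qed
  have img: "(\<lambda>t. restrict t Z) ` ?T \<subseteq> PiE Z (\<lambda>_. {..n})"
    using count_le_length by fastforce
  show "finite ?T" using finite_imageD[OF finite_subset[OF img fin] inj] .
  have "card ?T \<le> card (PiE Z (\<lambda>_. {..n}))" by (rule card_inj_on_le[OF inj img fin])
  then show "card ?T \<le> (n + 1) ^ card Z" using assms by (simp add: card_PiE)
qed

lemma finite_lists_UNIV: "finite {xs :: 'a::finite list. length xs = n}"
  and card_lists_UNIV: "card {xs :: 'a::finite list. length xs = n} = CARD('a) ^ n"
  using finite_lists_length_eq[of "UNIV :: 'a set" n] card_lists_length_eq[of "UNIV :: 'a set" n] by simp_all

text \<open>The codebook may be larger than the set of descriptions by a factor \<open>B\<close>: the helper sends the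
  codeword index modulo the number of descriptions and the guesser interleaves the remaining possibilities.\<close>

lemma helper_from_codebook:
  fixes d :: "'x::finite \<Rightarrow> 'xh::finite \<Rightarrow> real" and C :: "nat list set" and u :: "'y list \<Rightarrow> nat list"
  assumes feas: "\<And>x :: 'x list. length x = n \<Longrightarrow> \<exists>xh. length xh = n \<and> dbar d x xh \<le> D"
    and C: "finite C" "\<And>v. v \<in> C \<Longrightarrow> length v = n \<and> set v \<subseteq> {..<k}" "card C \<le> B * num_desc n R" and B: "1 \<le> B"
    and u: "\<And>y. y \<in> Y0 \<Longrightarrow> u y \<in> C"
  shows "\<exists>f g. is_helper n R f \<and> is_guessing_strategy n R g \<and>
    (\<forall>y\<in>Y0. \<forall>x. length x = n \<longrightarrow> num_guesses d D g x (f y) \<le> (B * (n + 1) ^ (CARD('x) * k)) *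
      cover_number d D n {x'. length x' = n \<and> count_list (zip x' (u y)) = count_list (zip x (u y))})"
proof -
  let ?M = "num_desc n R" and ?\<Omega> = "{xh :: 'xh list. length xh = n}"
  let ?K = "(n + 1) ^ (CARD('x) * k)"
  have M: "0 < ?M" by (simp add: num_desc_def)
  obtain h where "bij_betw h C {0..<card C}" using ex_bij_betw_finite_nat[OF C(1)] by blast
  then have h: "inj_on h C" "\<And>v. v \<in> C \<Longrightarrow> h v < B * ?M"
    using C(3) bij_betw_apply[of h C "{0..<card C}"] by (auto dest: bij_betw_imp_inj_on) fastforce
  define f where "f y = (if y \<in> Y0 then h (u y) mod ?M else 0)" for y
  have helper: "is_helper n R f" using M by (simp add: is_helper_def f_def)
  define cls where "cls v t = {x' :: 'x list. length x' = n \<and> count_list (zip x' v) = t}" for v :: "nat list" and t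
  define T where "T v = (\<lambda>x'. count_list (zip x' v)) ` {x' :: 'x list. length x' = n}" for v :: "nat list"
  have T: "finite (T v) \<and> card (T v) \<le> ?K" if "v \<in> C" for v
  proof -
    have "T v \<subseteq> count_list ` {zs. length zs = n \<and> set zs \<subseteq> (UNIV :: 'x set) \<times> {..<k}}"
      unfolding T_def
    proof (clarify, rule imageI)
      fix x' :: "'x list" assume "n = length x'"
      then show "zip x' v \<in> {zs. length zs = length x' \<and> set zs \<subseteq> UNIV \<times> {..<k}}"
        using C(2)[OF that] by (auto dest: set_zip_rightD)
    qed
    moreover note card_types_le[of "(UNIV :: 'x set) \<times> {..<k}" n]
    ultimately show ?thesis
      by (auto simp: card_cartesian_product intro: finite_subset order_trans[OF card_mono])
  qed
  have "\<exists>S. \<forall>v t. S v t \<subseteq> ?\<Omega> \<and> card (S v t) = cover_number d D n (cls v t) \<and> (\<forall>x\<in>cls v t. \<exists>xh\<in>S v t. dbar d x xh \<le> D)"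
  proof (intro choice allI)
    fix v t
    show "\<exists>S. S \<subseteq> ?\<Omega> \<and> card S = cover_number d D n (cls v t) \<and> (\<forall>x\<in>cls v t. \<exists>xh\<in>S. dbar d x xh \<le> D)"
      by (rule cover_number_attained[of "cls v t" n d D]) (use feas in \<open>auto simp: cls_def\<close>)
  qed
  then obtain S where S: "\<And>v t. S v t \<subseteq> ?\<Omega>" "\<And>v t. card (S v t) = cover_number d D n (cls v t)"
    "\<And>v t x. x \<in> cls v t \<Longrightarrow> \<exists>xh\<in>S v t. dbar d x xh \<le> D" by metis
  \<comment> \<open>The classes that the list for m has to serve: a codeword with index congruent to
    m, together with a joint type of x with it. Congruent indices below \<open>B * ?M\<close> have
    different quotients below \<open>B\<close>, which bounds the number of such codewords.\<close>
  define J where "J m = (SIGMA v:{v\<in>C. h v mod ?M = m}. T v)" for m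
  have J: "finite (J m) \<and> card (J m) \<le> B * ?K" for m
  proof -
    have "card {v\<in>C. h v mod ?M = m} \<le> B"
    proof -
      have "inj_on (\<lambda>v. h v div ?M) {v\<in>C. h v mod ?M = m}"
        using h(1) by (intro inj_onI) (metis (mono_tags, lifting) div_mult_mod_eq inj_onD mem_Collect_eq)
      moreover have "(\<lambda>v. h v div ?M) ` {v\<in>C. h v mod ?M = m} \<subseteq> {..<B}"
        using h(2) M by (auto simp: less_mult_imp_div_less)
      ultimately have "card {v\<in>C. h v mod ?M = m} \<le> card {..<B}" by (intro card_inj_on_le) auto
      then show ?thesis by simp
    qed
    moreover have "card (J m) = (\<Sum>v\<in>{v\<in>C. h v mod ?M = m}. card (T v))"
      unfolding J_def by (rule card_SigmaI) (use C T in auto)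
    moreover have "\<dots> \<le> (\<Sum>v\<in>{v\<in>C. h v mod ?M = m}. ?K)" by (rule sum_mono) (use T in auto)
    moreover have "(\<Sum>v\<in>{v\<in>C. h v mod ?M = m}. ?K) = card {v\<in>C. h v mod ?M = m} * ?K" by simp
    moreover have "finite (J m)" unfolding J_def using C T by auto
    ultimately show ?thesis by (metis (no_types, lifting) mult_le_mono1 order_trans)
  qed
  have "\<exists>g. \<forall>m. bij_betw (g m) {1..card ?\<Omega>} ?\<Omega> \<and>
    (\<forall>i\<in>{1..card ?\<Omega>}. \<forall>j\<in>J m. g m i \<in> S (fst j) (snd j) \<longrightarrow> i \<le> (B * ?K) * card (S (fst j) (snd j)))"
  proof (intro choice allI)
    fix m
    show "\<exists>g. bij_betw g {1..card ?\<Omega>} ?\<Omega> \<and>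
    (\<forall>i\<in>{1..card ?\<Omega>}. \<forall>j\<in>J m. g i \<in> S (fst j) (snd j) \<longrightarrow> i \<le> (B * ?K) * card (S (fst j) (snd j)))"
      by (rule ex_ordering_family) (use J S(1) B finite_lists_UNIV in auto)
  qed
  then obtain g where g: "\<And>m. bij_betw (g m) {1..card ?\<Omega>} ?\<Omega>"
    "\<And>m i j. i \<in> {1..card ?\<Omega>} \<Longrightarrow> j \<in> J m \<Longrightarrow> g m i \<in> S (fst j) (snd j) \<Longrightarrow> i \<le> (B * ?K) * card (S (fst j) (snd j))"
    by metis
  have strat: "is_guessing_strategy n R g"
    using g(1) unfolding is_guessing_strategy_def card_lists_UNIV by blast
  have "num_guesses d D g x (f y) \<le> (B * ?K) *
      cover_number d D n {x'. length x' = n \<and> count_list (zip x' (u y)) = count_list (zip x (u y))}"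
    if y: "y \<in> Y0" and x: "length x = n" for x y
  proof -
    let ?t = "count_list (zip x (u y))"
    have j: "(u y, ?t) \<in> J (f y)" using u[OF y] x y by (auto simp: J_def f_def T_def)
    have "x \<in> cls (u y) ?t" using x by (simp add: cls_def)
    from S(3)[OF this] obtain xh where xh: "xh \<in> S (u y) ?t" "dbar d x xh \<le> D" by blast
    then have "xh \<in> ?\<Omega>" using S(1) by blast
    have "num_guesses d D g x (f y) \<le> (B * ?K) * card (S (u y) ?t)"
      by (rule num_guesses_le[OF g(1) \<open>xh \<in> ?\<Omega>\<close> xh(2)]) (use g(2)[OF _ j] xh in auto)
    then show ?thesis by (simp add: S(2) cls_def)
  qed
  with helper strat show ?thesis by blast
qed

subsection \<open>Probabilities of joint type classes\<close>

lemma sum_nth_count: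
  fixes \<phi> :: "'a \<Rightarrow> real"
  assumes "set zs \<subseteq> Z" "finite Z"
  shows "(\<Sum>i<length zs. \<phi> (zs ! i)) = (\<Sum>z\<in>Z. count_list zs z * \<phi> z)"
  using assms(1)
proof (induction zs)
  case (Cons z zs)
  have "(\<Sum>z'\<in>Z. count_list (z # zs) z' * \<phi> z') = (\<Sum>z'\<in>Z. (if z' = z then \<phi> z else 0) + count_list zs z' * \<phi> z')"
    by (intro sum.cong) (auto simp: algebra_simps)
  then show ?case using Cons assms(2) by (simp add: sum.lessThan_Suc_shift sum.distrib del: sum.lessThan_Suc)
qed simp

lemma log_prod_count:
  fixes F :: "'a \<Rightarrow> real"
  assumes "set zs \<subseteq> Z" "finite Z" "\<And>z. z \<in> set zs \<Longrightarrow> 0 < F z"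
  shows "(\<Prod>i<length zs. F (zs ! i)) = 2 powr (\<Sum>z\<in>Z. count_list zs z * log 2 (F z))"
proof -
  have pos: "0 < F (zs ! i)" if "i < length zs" for i using assms(3) that by simp
  have "2 powr (\<Sum>z\<in>Z. count_list zs z * log 2 (F z)) = 2 powr (\<Sum>i<length zs. log 2 (F (zs ! i)))"
    by (subst sum_nth_count[OF assms(1,2), where \<phi>="\<lambda>z. log 2 (F z)"]) simp
  also have "\<dots> = (\<Prod>i<length zs. 2 powr log 2 (F (zs ! i)))" by (simp add: powr_sum)
  also have "\<dots> = (\<Prod>i<length zs. F (zs ! i))" by (intro prod.cong refl) (simp add: pos)
  finally show ?thesis ..
qed

text \<open>When t is absolutely continuous with respect to P, this is the relative entropy of t
  with respect to P_{XY} Q_{U|Y}, where Q_{U|Y} is taken from t itself and has cancelled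
  (\<open>rel_entropy_type\<close>). In this expanded form it is continuous in t.\<close>

definition type_divergence :: "('x::finite \<times> 'y::finite \<Rightarrow> real) \<Rightarrow> nat \<Rightarrow> ('x \<Rightarrow> 'y \<Rightarrow> nat \<Rightarrow> real) \<Rightarrow> real" where
  "type_divergence P k t = (\<Sum>x\<in>UNIV. \<Sum>y\<in>UNIV. \<Sum>v<k. xlog (t x y v))
     - (\<Sum>y\<in>UNIV. \<Sum>v<k. xlog (\<Sum>x\<in>UNIV. t x y v))
     + (\<Sum>y\<in>UNIV. xlog (\<Sum>v<k. \<Sum>x\<in>UNIV. t x y v))
     - (\<Sum>x\<in>UNIV. \<Sum>y\<in>UNIV. \<Sum>v<k. t x y v * log 2 (P (x, y)))"

lemma joint_marginals_pos:
  fixes t :: "'x::finite \<Rightarrow> 'y::finite \<Rightarrow> nat \<Rightarrow> real"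
  assumes t: "\<And>x y v. 0 \<le> t x y v" and v: "v < k" "0 < t x y v"
  shows "0 < (\<Sum>x\<in>UNIV. t x y v)" "0 < (\<Sum>v<k. \<Sum>x\<in>UNIV. t x y v)"
proof -
  have "t x y v \<le> (\<Sum>x\<in>UNIV. t x y v)" by (rule member_le_sum[of x UNIV "\<lambda>x. t x y v"]) (auto simp: t)
  moreover have "(\<Sum>x\<in>UNIV. t x y v) \<le> (\<Sum>v<k. \<Sum>x\<in>UNIV. t x y v)"
    by (rule member_le_sum[of v "{..<k}" "\<lambda>v. \<Sum>x\<in>UNIV. t x y v"]) (auto simp: v t sum_nonneg)
  ultimately show "0 < (\<Sum>x\<in>UNIV. t x y v)" "0 < (\<Sum>v<k. \<Sum>x\<in>UNIV. t x y v)" using v by simp_all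
qed

lemma type_divergence_eq:
  fixes t :: "'x::finite \<Rightarrow> 'y::finite \<Rightarrow> nat \<Rightarrow> real"
  assumes t: "\<And>x y v. 0 \<le> t x y v" and ac: "\<And>x y v. v < k \<Longrightarrow> 0 < t x y v \<Longrightarrow> 0 < P (x, y)"
  defines "J \<equiv> \<lambda>y v. \<Sum>x\<in>UNIV. t x y v"
  defines "Q \<equiv> \<lambda>y. \<Sum>v<k. J y v"
  shows "(\<Sum>x\<in>UNIV. \<Sum>y\<in>UNIV. \<Sum>v<k. t x y v * log 2 (Q y * (t x y v / J y v) / P (x, y))) = type_divergence P k t"
proof -
  have pos: "0 < J y v \<and> 0 < Q y" if "v < k" "0 < t x y v" for x y v
    using joint_marginals_pos[of t, OF t that] by (simp add: J_def Q_def)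
  have "(\<Sum>x\<in>UNIV. \<Sum>y\<in>UNIV. \<Sum>v<k. t x y v * log 2 (Q y * (t x y v / J y v) / P (x, y))) =
    (\<Sum>x\<in>UNIV. \<Sum>y\<in>UNIV. \<Sum>v<k. xlog (t x y v) - t x y v * log 2 (J y v) + t x y v * log 2 (Q y) - t x y v * log 2 (P (x, y)))"
  proof (intro sum.cong refl)
    fix x y v assume "v \<in> {..<k}"
    then have v: "v < k" by simp
    show "t x y v * log 2 (Q y * (t x y v / J y v) / P (x, y)) =
      xlog (t x y v) - t x y v * log 2 (J y v) + t x y v * log 2 (Q y) - t x y v * log 2 (P (x, y))"
    proof (cases "t x y v = 0")
      case False
      then have tp: "0 < t x y v" using t[of x y v] by simp
      have "a * log 2 (q * (a / j) / p) = xlog a - a * log 2 j + a * log 2 q - a * log 2 p"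
        if "0 < a" "0 < j" "0 < q" "0 < p" for a j q p :: real
        using that by (simp add: xlog_def log_mult log_divide algebra_simps)
      then show ?thesis using pos[OF v tp] ac[OF v tp] tp by blast
    qed simp
  qed
  also have "\<dots> = (\<Sum>x\<in>UNIV. \<Sum>y\<in>UNIV. \<Sum>v<k. xlog (t x y v)) - (\<Sum>x\<in>UNIV. \<Sum>y\<in>UNIV. \<Sum>v<k. t x y v * log 2 (J y v))
    + (\<Sum>x\<in>UNIV. \<Sum>y\<in>UNIV. \<Sum>v<k. t x y v * log 2 (Q y)) - (\<Sum>x\<in>UNIV. \<Sum>y\<in>UNIV. \<Sum>v<k. t x y v * log 2 (P (x, y)))"
    by (simp add: sum.distrib sum_subtractf)
  also have "(\<Sum>x\<in>UNIV. \<Sum>y\<in>UNIV. \<Sum>v<k. t x y v * log 2 (J y v)) = (\<Sum>y\<in>UNIV. \<Sum>v<k. xlog (J y v))"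
  proof -
    have "(\<Sum>x\<in>UNIV. \<Sum>y\<in>UNIV. \<Sum>v<k. t x y v * log 2 (J y v)) = (\<Sum>y\<in>UNIV. \<Sum>x\<in>UNIV. \<Sum>v<k. t x y v * log 2 (J y v))"
      by (rule sum.swap)
    also have "\<dots> = (\<Sum>y\<in>UNIV. \<Sum>v<k. \<Sum>x\<in>UNIV. t x y v * log 2 (J y v))"
      by (intro sum.cong refl) (rule sum.swap)
    also have "\<dots> = (\<Sum>y\<in>UNIV. \<Sum>v<k. xlog (J y v))" by (simp add: xlog_def J_def sum_distrib_right)
    finally show ?thesis .
  qed
  also have "(\<Sum>x\<in>UNIV. \<Sum>y\<in>UNIV. \<Sum>v<k. t x y v * log 2 (Q y)) = (\<Sum>y\<in>UNIV. xlog (Q y))"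
  proof -
    have "(\<Sum>x\<in>UNIV. \<Sum>y\<in>UNIV. \<Sum>v<k. t x y v * log 2 (Q y)) = (\<Sum>y\<in>UNIV. \<Sum>x\<in>UNIV. \<Sum>v<k. t x y v * log 2 (Q y))"
      by (rule sum.swap)
    also have "\<dots> = (\<Sum>y\<in>UNIV. \<Sum>v<k. \<Sum>x\<in>UNIV. t x y v * log 2 (Q y))"
      by (intro sum.cong refl) (rule sum.swap)
    also have "\<dots> = (\<Sum>y\<in>UNIV. xlog (Q y))" by (simp add: xlog_def Q_def J_def sum_distrib_right)
    finally show ?thesis .
  qed
  finally show "(\<Sum>x\<in>UNIV. \<Sum>y\<in>UNIV. \<Sum>v<k. t x y v * log 2 (Q y * (t x y v / J y v) / P (x, y))) = type_divergence P k t"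
    by (simp add: type_divergence_def J_def Q_def)
qed

text \<open>A change of measure replaces counting. The word u is a function of y and costs no
  probability of its own, so the comparison measure consists of the marginal of y and the channel
  from (y, v) to x; this is how the conditional law of v given y disappears from the
  exponent.\<close>

lemma type_class_prob:
  fixes P :: "'x::finite \<times> 'y::finite \<Rightarrow> real" and u :: "'y list \<Rightarrow> nat list"
  assumes P: "\<And>z. 0 \<le> P z" and n: "1 \<le> n"
    and u: "\<And>y. y \<in> Y0 \<Longrightarrow> length y = n \<and> length (u y) = n \<and> set (u y) \<subseteq> {..<k}"
    and t: "\<And>x y v. t x y v = real (\<tau> (x, y, v)) / n"
    and ac: "\<And>x y v. v < k \<Longrightarrow> 0 < t x y v \<Longrightarrow> 0 < P (x, y)"
  shows "(\<Sum>(x, y)\<in>{(x, y). length x = n \<and> y \<in> Y0 \<and> count_list (zip x (zip y (u y))) = \<tau>}. \<Prod>i<n. P (x ! i, y ! i))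
    \<le> 2 powr (- (n * type_divergence P k t))"
proof -
  let ?S = "{(x, y). length x = n \<and> y \<in> Y0 \<and> count_list (zip x (zip y (u y))) = \<tau>}"
  let ?Z = "(UNIV :: 'x set) \<times> (UNIV :: 'y set) \<times> {..<k}"
  define J where "J y v = (\<Sum>x\<in>UNIV. t x y v)" for y v
  define Q where "Q y = (\<Sum>v<k. J y v)" for y
  define W where "W y v x = t x y v / J y v" for y v x
  \<comment> \<open>On the type class, \<open>P\<^sup>n\<close> is a constant multiple of the subprobability \<open>q\<close>.\<close>
  define q where "q x y = (\<Prod>i<n. Q (y ! i)) * (\<Prod>i<n. W (y ! i) (u y ! i) (x ! i))" for x y
  have tnn: "0 \<le> t x y v" for x y v by (simp add: t)
  have Jnn: "0 \<le> J y v" for y v by (simp add: J_def tnn sum_nonneg)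
  have Qnn: "0 \<le> Q y" for y by (simp add: Q_def Jnn sum_nonneg)
  have Wnn: "0 \<le> W y v x" for y v x by (simp add: W_def tnn Jnn)
  \<comment> \<open>Only an inequality: where \<open>J y v = 0\<close>, the division convention
    makes \<open>W y v\<close> vanish.\<close>
  have W_sum: "(\<Sum>x\<in>UNIV. W y v x) \<le> 1" for y v
    using Jnn[of y v] by (simp add: W_def sum_divide_distrib[symmetric] J_def[symmetric])
  have td1: "(\<Sum>x\<in>UNIV. \<Sum>y\<in>UNIV. \<Sum>v<k. t x y v * log 2 (Q y * (t x y v / J y v) / P (x, y))) = type_divergence P k t"
    unfolding Q_def J_def by (rule type_divergence_eq[OF tnn]) (rule ac)
  have td2: "0 < J y v" "0 < Q y" if "v < k" "0 < t x y v" for x y v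
    using joint_marginals_pos[of t, OF tnn that] by (simp_all add: J_def Q_def)
  have Y0: "Y0 \<subseteq> {y. length y = n}" using u by auto
  have finS: "finite ?S"
    by (rule finite_subset[OF _ finite_cartesian_product[OF finite_lists_UNIV[of n] finite_lists_UNIV[of n]]]) (use Y0 in auto)
  have eq: "(\<Prod>i<n. P (x ! i, y ! i)) = q x y * 2 powr (- (n * type_divergence P k t))" if xy: "(x, y) \<in> ?S" for x y
  proof -
    let ?zs = "zip x (zip y (u y))"
    have len: "length x = n" "length y = n" "length (u y) = n" and cnt: "count_list ?zs = \<tau>"
      and uk: "set (u y) \<subseteq> {..<k}" using xy u by auto
    have zlen: "length ?zs = n" using len by simp
    have nth: "?zs ! i = (x ! i, y ! i, u y ! i)" if "i < n" for i using len that by simp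
    have sub: "set ?zs \<subseteq> ?Z" using uk by (auto dest!: set_zip_rightD)
    have tpos: "0 < t x' y' v" if "(x', y', v) \<in> set ?zs" for x' y' v
    proof -
      have "\<tau> (x', y', v) \<noteq> 0" using that by (simp add: cnt[symmetric] count_list_0_iff)
      then show ?thesis using n by (simp add: t)
    qed
    \<comment> \<open>On the class a product along the word depends on the type alone. This is
      applied to P and to the factors of \<open>q\<close>.\<close>
    have F: "(\<Prod>i<n. F (x ! i, y ! i, u y ! i)) = 2 powr (n * (\<Sum>x\<in>UNIV. \<Sum>y\<in>UNIV. \<Sum>v<k. t x y v * log 2 (F (x, y, v))))"
      if Fpos: "\<And>x y v. v < k \<Longrightarrow> 0 < t x y v \<Longrightarrow> 0 < F (x, y, v)" for F :: "'x \<times> 'y \<times> nat \<Rightarrow> real"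
    proof -
      have "(\<Prod>i<n. F (x ! i, y ! i, u y ! i)) = (\<Prod>i<length ?zs. F (?zs ! i))"
        using zlen nth by (intro prod.cong) auto
      also have "\<dots> = 2 powr (\<Sum>z\<in>?Z. count_list ?zs z * log 2 (F z))"
        by (rule log_prod_count[OF sub]) (use Fpos tpos sub in auto)
      also have "(\<Sum>z\<in>?Z. count_list ?zs z * log 2 (F z)) = n * (\<Sum>x\<in>UNIV. \<Sum>y\<in>UNIV. \<Sum>v<k. t x y v * log 2 (F (x, y, v)))"
        using n unfolding cnt by (simp add: sum.cartesian_product' sum_distrib_left t)
      finally show ?thesis .
    qed
    have "(\<Prod>i<n. P (x ! i, y ! i)) = 2 powr (n * (\<Sum>x\<in>UNIV. \<Sum>y\<in>UNIV. \<Sum>v<k. t x y v * log 2 (P (x, y))))"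
      using F[of "\<lambda>(x, y, v). P (x, y)"] ac by simp
    moreover have "q x y = (\<Prod>i<n. Q (y ! i) * W (y ! i) (u y ! i) (x ! i))" by (simp add: q_def prod.distrib)
    moreover have "\<dots> = 2 powr (n * (\<Sum>x\<in>UNIV. \<Sum>y\<in>UNIV. \<Sum>v<k. t x y v * log 2 (Q y * W y v x)))"
      using F[of "\<lambda>(x, y, v). Q y * W y v x"] td2 by (simp add: W_def)
    moreover have "type_divergence P k t = (\<Sum>x\<in>UNIV. \<Sum>y\<in>UNIV. \<Sum>v<k. t x y v * log 2 (Q y * W y v x)) -
        (\<Sum>x\<in>UNIV. \<Sum>y\<in>UNIV. \<Sum>v<k. t x y v * log 2 (P (x, y)))"
    proof -
      have "t x y v * log 2 (Q y * (t x y v / J y v) / P (x, y)) = t x y v * log 2 (Q y * W y v x) - t x y v * log 2 (P (x, y))"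
        if "v < k" for x y v
      proof (cases "t x y v = 0")
        case False
        then have "0 < t x y v" using tnn[of x y v] by simp
        then have "0 < J y v" "0 < Q y" "0 < P (x, y)" using td2[OF that] ac[OF that] by auto
        then have "log 2 (Q y * (t x y v / J y v) / P (x, y)) = log 2 (Q y * (t x y v / J y v)) - log 2 (P (x, y))"
          using \<open>0 < t x y v\<close> by (intro log_divide_pos) auto
        then show ?thesis by (simp only: W_def right_diff_distrib)
      qed simp
      then have "type_divergence P k t = (\<Sum>x\<in>UNIV. \<Sum>y\<in>UNIV. \<Sum>v<k. t x y v * log 2 (Q y * W y v x) - t x y v * log 2 (P (x, y)))"
        unfolding td1[symmetric] by (intro sum.cong refl) (simp only: lessThan_iff)
      then show ?thesis by (simp only: sum_subtractf)
    qed
    ultimately show ?thesis by (simp add: powr_add[symmetric] right_diff_distrib)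
  qed
  have "(\<Sum>(x, y)\<in>?S. q x y) \<le> (\<Sum>(x, y)\<in>{x. length x = n} \<times> Y0. q x y)"
    by (rule sum_mono2)
      (auto simp: q_def Qnn Wnn finite_lists_UNIV finite_subset[OF Y0 finite_lists_UNIV] intro!: mult_nonneg_nonneg prod_nonneg)
  also have "\<dots> = (\<Sum>y\<in>Y0. (\<Prod>i<n. Q (y ! i)) * (\<Sum>x\<in>{x. length x = n}. \<Prod>i<n. W (y ! i) (u y ! i) (x ! i)))"
    by (simp add: sum.cartesian_product[symmetric] sum.swap[of _ _ Y0] q_def sum_distrib_left)
  also have "\<dots> \<le> (\<Sum>y\<in>Y0. (\<Prod>i<n. Q (y ! i)) * 1)"
  proof (intro sum_mono mult_left_mono)
    fix y
    have "(\<Sum>x\<in>{x. length x = n}. \<Prod>i<n. W (y ! i) (u y ! i) (x ! i)) = (\<Prod>i<n. \<Sum>x\<in>UNIV. W (y ! i) (u y ! i) x)"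
      using sum_lists_prod[of n "\<lambda>_. UNIV" "\<lambda>i. W (y ! i) (u y ! i)"] by simp
    also have "\<dots> \<le> (\<Prod>i<n. 1)" by (intro prod_mono conjI W_sum sum_nonneg Wnn)
    finally show "(\<Sum>x\<in>{x. length x = n}. \<Prod>i<n. W (y ! i) (u y ! i) (x ! i)) \<le> 1" by simp
  qed (simp add: Qnn prod_nonneg)
  also have "\<dots> \<le> (\<Sum>y\<in>{y. length y = n}. \<Prod>i<n. Q (y ! i))"
    unfolding mult_1_right by (rule sum_mono2) (use Y0 Qnn finite_lists_UNIV in \<open>auto intro!: prod_nonneg\<close>)
  also have "\<dots> = (\<Sum>y\<in>UNIV. Q y) ^ n"
    using sum_lists_prod[of n "\<lambda>_. UNIV" "\<lambda>_. Q"] by simp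
  finally have q_le: "(\<Sum>(x, y)\<in>?S. q x y) \<le> (\<Sum>y\<in>UNIV. Q y) ^ n" .
  \<comment> \<open>\<open>\<tau>\<close> is known to be the type of a word only when the class is
    nonempty, and this is what gives \<open>Q\<close> total mass 1.\<close>
  show ?thesis
  proof (cases "?S = {}")
    case False
    then obtain x y where xy: "(x, y) \<in> ?S" by auto
    let ?zs = "zip x (zip y (u y))"
    have "set ?zs \<subseteq> ?Z" using xy u by (auto dest!: set_zip_rightD)
    then have "(\<Sum>z\<in>?Z. count_list ?zs z) = length ?zs" by (intro sum_count_set) auto
    then have "(\<Sum>z\<in>?Z. \<tau> z) = n" using xy u by auto
    then have "(\<Sum>z\<in>?Z. real (\<tau> z)) = n" by (metis of_nat_sum)
    then have "(\<Sum>x\<in>UNIV. \<Sum>y\<in>UNIV. \<Sum>v<k. t x y v) = 1"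
      using n by (simp add: t sum.cartesian_product' sum_divide_distrib[symmetric])
    moreover have "(\<Sum>y\<in>UNIV. Q y) = (\<Sum>x\<in>UNIV. \<Sum>y\<in>UNIV. \<Sum>v<k. t x y v)"
    proof -
      have "(\<Sum>y\<in>UNIV. Q y) = (\<Sum>y\<in>UNIV. \<Sum>x\<in>UNIV. \<Sum>v<k. t x y v)"
        unfolding Q_def J_def by (intro sum.cong refl) (rule sum.swap)
      then show ?thesis by (subst sum.swap)
    qed
    ultimately have "(\<Sum>(x, y)\<in>?S. q x y) \<le> 1" using q_le by simp
    moreover have "(\<Sum>(x, y)\<in>?S. \<Prod>i<n. P (x ! i, y ! i)) = (\<Sum>(x, y)\<in>?S. q x y) * 2 powr (- (n * type_divergence P k t))"
      unfolding sum_distrib_right by (intro sum.cong refl) (use eq in auto)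
    ultimately show ?thesis by (simp add: mult_le_cancel_right1 split_beta)
  qed (simp only: sum.empty powr_ge_zero)
qed

text \<open>Some class carries at least the average share of the sum, and on it h is replaced by its
  maximum, attained at w. That the class has positive probability is recorded because it later
  yields absolute continuity of its type with respect to P.\<close>

lemma sum_type_pigeonhole:
  fixes p h :: "'w \<Rightarrow> real"
  assumes fin: "finite S" and p: "\<And>w. w \<in> S \<Longrightarrow> 0 \<le> p w" and gt: "0 \<le> X" "X < (\<Sum>w\<in>S. p w * h w)"
  obtains w where "w \<in> S" "X < card (\<tau> ` S) * ((\<Sum>w'\<in>{w'\<in>S. \<tau> w' = \<tau> w}. p w') * h w)" "0 < h w" "0 < (\<Sum>w'\<in>{w'\<in>S. \<tau> w' = \<tau> w}. p w')"
proof -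
  have "(\<Sum>w\<in>S. p w * h w) = (\<Sum>t\<in>\<tau> ` S. \<Sum>w\<in>{w\<in>S. \<tau> w = t}. p w * h w)"
    by (rule sum.group[symmetric]) (use fin in auto)
  have "\<exists>t\<in>\<tau> ` S. X < card (\<tau> ` S) * (\<Sum>w\<in>{w\<in>S. \<tau> w = t}. p w * h w)"
  proof (rule ccontr)
    assume "\<not> ?thesis"
    then have "(\<Sum>t\<in>\<tau> ` S. card (\<tau> ` S) * (\<Sum>w\<in>{w\<in>S. \<tau> w = t}. p w * h w)) \<le> (\<Sum>t\<in>\<tau> ` S. X)"
      by (intro sum_mono) (auto simp: not_less)
    then have "card (\<tau> ` S) * (\<Sum>w\<in>S. p w * h w) \<le> card (\<tau> ` S) * X"
      by (simp add: sum_distrib_left[symmetric] \<open>(\<Sum>w\<in>S. p w * h w) = _\<close>)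
    moreover have "S \<noteq> {}" using gt by auto
    then have "0 < card (\<tau> ` S)" using fin by (simp add: card_gt_0_iff)
    ultimately show False using gt by simp
  qed
  then obtain t where t: "t \<in> \<tau> ` S" "X < card (\<tau> ` S) * (\<Sum>w\<in>{w\<in>S. \<tau> w = t}. p w * h w)" by blast
  let ?S = "{w\<in>S. \<tau> w = t}"
  have "?S \<noteq> {}" "finite ?S" using t fin by auto
  then have "Max (h ` ?S) \<in> h ` ?S" by (intro Max_in) auto
  then obtain w where w: "w \<in> ?S" "h w = Max (h ` ?S)" by auto
  have "(\<Sum>w\<in>?S. p w * h w) \<le> (\<Sum>w'\<in>?S. p w' * h w)"
    unfolding w(2) by (intro sum_mono mult_left_mono Max_ge) (use fin p in auto)
  also have "\<dots> = (\<Sum>w'\<in>?S. p w') * h w" by (simp add: sum_distrib_right)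
  finally have le: "card (\<tau> ` S) * (\<Sum>w\<in>?S. p w * h w) \<le> card (\<tau> ` S) * ((\<Sum>w'\<in>?S. p w') * h w)"
    by (rule mult_left_mono) simp
  then have "0 < card (\<tau> ` S) * ((\<Sum>w'\<in>?S. p w') * h w)" using t gt by linarith
  moreover have "0 \<le> (\<Sum>w'\<in>?S. p w')" using p by (intro sum_nonneg) auto
  ultimately have "0 < h w" "0 < (\<Sum>w'\<in>?S. p w')" by (auto simp: zero_less_mult_iff)
  then show thesis using that[of w] w(1) t(2) le by auto
qed

subsection \<open>Achievability\<close>

text \<open>The polynomial factor of \<open>type_cover\<close>: the logarithm of at most a^n words
  to be covered, plus 1, times m Stirling factors.\<close>

definition cover_overhead :: "nat \<Rightarrow> nat \<Rightarrow> nat \<Rightarrow> real" where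
  "cover_overhead a m n = (n * ln (real a) + 1) * (exp 1 * (real n + 1)) ^ m"

lemma cover_overhead_ge_1: "1 \<le> a \<Longrightarrow> 1 \<le> cover_overhead a m n"
proof -
  assume "1 \<le> a"
  then have "1 \<le> n * ln (real a) + 1" by simp
  moreover have "1 * 1 \<le> exp 1 * (real n + 1)" by (intro mult_mono) auto
  then have "1 \<le> (exp 1 * (real n + 1)) ^ m" by simp
  ultimately have "1 * 1 \<le> cover_overhead a m n" unfolding cover_overhead_def by (intro mult_mono) auto
  then show ?thesis by simp
qed

lemma log_Suc_over_n: "(\<lambda>n. log 2 (real n + 1) / real n) \<longlonglongrightarrow> 0"
  unfolding log_def by real_asymp

lemma const_over_n: "(\<lambda>n. c / real n) \<longlonglongrightarrow> 0"
  by real_asymp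

lemma cover_overhead_tendsto:
  assumes a: "1 \<le> a"
  shows "(\<lambda>n. log 2 (cover_overhead a m n) / n) \<longlonglongrightarrow> 0"
proof (rule tendsto_sandwich[where f="\<lambda>_. 0"])
  let ?c = "log 2 (ln a + 1) + m * log 2 (exp 1)"
  show "(\<lambda>n. ?c / real n + (1 + real m) * (log 2 (real n + 1) / real n)) \<longlonglongrightarrow> 0"
    using tendsto_add[OF const_over_n[of ?c] tendsto_mult_left[OF log_Suc_over_n, of "1 + real m"]] by simp
  have "log 2 (cover_overhead a m n) \<le> ?c + (1 + real m) * log 2 (real n + 1)" for n
  proof -
    have l: "0 \<le> ln a" using a by simp
    have "n * ln a + 1 \<le> (real n + 1) * (ln a + 1)" using l by (simp add: algebra_simps)
    then have "cover_overhead a m n \<le> ((real n + 1) * (ln a + 1)) * (exp 1 * (real n + 1)) ^ m"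
      unfolding cover_overhead_def by (intro mult_right_mono) auto
    then have "log 2 (cover_overhead a m n) \<le> log 2 (((real n + 1) * (ln a + 1)) * (exp 1 * (real n + 1)) ^ m)"
      using cover_overhead_ge_1[OF a, of m n] by (intro log_mono) auto
    also have "\<dots> = log 2 (real n + 1) + log 2 (ln a + 1) + m * (log 2 (exp 1) + log 2 (real n + 1))"
      using l by (simp add: log_mult_pos log_nat_power)
    finally show ?thesis by (simp add: algebra_simps)
  qed
  then have "log 2 (cover_overhead a m n) / n \<le> ?c / real n + (1 + real m) * (log 2 (real n + 1) / real n)" for n
    using divide_right_mono[of "log 2 (cover_overhead a m n)" "?c + (1 + real m) * log 2 (real n + 1)" "real n"]
    by (simp add: add_divide_distrib)
  then show "\<forall>\<^sub>F n in sequentially. log 2 (cover_overhead a m n) / n \<le> ?c / real n + (1 + real m) * (log 2 (real n + 1) / real n)"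
    by simp
  show "\<forall>\<^sub>F n in sequentially. 0 \<le> log 2 (cover_overhead a m n) / real n"
    using cover_overhead_ge_1[OF a] by (intro always_eventually allI divide_nonneg_nonneg zero_le_log_cancel_iff[THEN iffD2]) (auto intro: less_le_trans[OF zero_less_one])
qed simp

lemma type_divergence_tendsto:
  assumes nn: "\<And>n x y v. 0 \<le> t n x y v" and lim: "\<And>x y v. v < k \<Longrightarrow> (\<lambda>n. t n x y v) \<longlonglongrightarrow> t' x y v"
  shows "(\<lambda>n. type_divergence P k (t n)) \<longlonglongrightarrow> type_divergence P k t'"
  unfolding type_divergence_def
  by (intro tendsto_intros tendsto_xlog lim sum_nonneg nn) auto

text \<open>The excess goes to \<open>b0\<close>: when this is a least costly entry, a distortion constraint survives the rounding exactly.\<close>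

definition round_to :: "'b set \<Rightarrow> 'b \<Rightarrow> nat \<Rightarrow> ('b \<Rightarrow> real) \<Rightarrow> 'b \<Rightarrow> nat" where
  "round_to B b0 m z b = (if b = b0 then m - (\<Sum>b\<in>B - {b0}. nat \<lfloor>z b\<rfloor>) else if b \<in> B then nat \<lfloor>z b\<rfloor> else 0)"

lemma round_to:
  fixes B :: "'b set"
  assumes fin: "finite B" and b0: "b0 \<in> B" and z: "\<And>b. b \<in> B \<Longrightarrow> 0 \<le> z b" and m: "(\<Sum>b\<in>B. z b) = real m"
  shows "(\<Sum>b\<in>B. round_to B b0 m z b) = m"
    and "\<And>b. b \<in> B \<Longrightarrow> \<bar>real (round_to B b0 m z b) - z b\<bar> \<le> card B"
    and "\<And>e. (\<And>b. b \<in> B \<Longrightarrow> e b0 \<le> e b) \<Longrightarrow> (\<Sum>b\<in>B. real (round_to B b0 m z b) * e b) \<le> (\<Sum>b\<in>B. z b * e b)"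
proof -
  let ?r = "round_to B b0 m z"
  let ?F = "\<Sum>b\<in>B - {b0}. nat \<lfloor>z b\<rfloor>"
  have split: "(\<Sum>b\<in>B. h b) = h b0 + (\<Sum>b\<in>B - {b0}. h b)" for h :: "'b \<Rightarrow> real"
    by (rule sum.remove[OF fin b0])
  have fl: "real (nat \<lfloor>z b\<rfloor>) \<le> z b" "z b \<le> real (nat \<lfloor>z b\<rfloor>) + 1" if "b \<in> B" for b
    using z[OF that] by linarith+
  have "real ?F \<le> (\<Sum>b\<in>B - {b0}. z b)" unfolding of_nat_sum by (intro sum_mono fl) auto
  also have "\<dots> \<le> real m" using split[of z] z[OF b0] m by simp
  finally have F: "?F \<le> m" by (simp only: of_nat_le_iff)
  have r: "?r b = nat \<lfloor>z b\<rfloor>" if "b \<in> B - {b0}" for b using that by (auto simp: round_to_def)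
  have r0: "real (?r b0) = real m - real ?F" using F by (simp add: round_to_def of_nat_diff)
  have rs: "(\<Sum>b\<in>B - {b0}. real (?r b) * h b) = (\<Sum>b\<in>B - {b0}. real (nat \<lfloor>z b\<rfloor>) * h b)" for h
    by (intro sum.cong refl) (simp only: r)
  have "real (\<Sum>b\<in>B. ?r b) = real m" using split[of ?r] r0 rs[of "\<lambda>_. 1"] by simp
  then show "(\<Sum>b\<in>B. ?r b) = m" by (simp only: of_nat_eq_iff)
  show "\<bar>real (?r b) - z b\<bar> \<le> card B" if b: "b \<in> B" for b
  proof (cases "b = b0")
    case True
    have "z b0 + (\<Sum>b\<in>B - {b0}. z b) = real m" using split[of z] m by simp
    then have "real (?r b0) - z b0 = (\<Sum>b\<in>B - {b0}. z b - real (nat \<lfloor>z b\<rfloor>))"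
      by (simp add: r0 sum_subtractf)
    moreover have "0 \<le> (\<Sum>b\<in>B - {b0}. z b - real (nat \<lfloor>z b\<rfloor>))"
      by (intro sum_nonneg) (use fl in auto)
    moreover have "(\<Sum>b\<in>B - {b0}. z b - real (nat \<lfloor>z b\<rfloor>)) \<le> (\<Sum>b\<in>B - {b0}. 1)"
      by (intro sum_mono) (use fl(2) in force)
    moreover have "(\<Sum>b\<in>B - {b0}. 1) \<le> real (card B)" using fin by (simp add: card_mono)
    ultimately show ?thesis using True by simp
  next
    case False
    then have "?r b = nat \<lfloor>z b\<rfloor>" using b r by simp
    moreover have "1 \<le> card B" using fin b by (simp add: Suc_le_eq card_gt_0_iff) blast
    ultimately show ?thesis using fl[OF b] by (simp add: abs_le_iff) linarith
  qed
  show "(\<Sum>b\<in>B. real (?r b) * e b) \<le> (\<Sum>b\<in>B. z b * e b)" if e: "\<And>b. b \<in> B \<Longrightarrow> e b0 \<le> e b" for e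
  proof -
    \<comment> \<open>Measured relative to \<open>e b0\<close>, all costs are nonnegative, so
      rounding the other entries down can only lower the total.\<close>
    have "(\<Sum>b\<in>B. real (?r b) * e b) = real m * e b0 + (\<Sum>b\<in>B - {b0}. real (nat \<lfloor>z b\<rfloor>) * (e b - e b0))"
      unfolding split[of "\<lambda>b. real (?r b) * e b"] rs r0
      by (simp add: left_diff_distrib right_diff_distrib sum_subtractf sum_distrib_right)
    also have "\<dots> \<le> real m * e b0 + (\<Sum>b\<in>B - {b0}. z b * (e b - e b0))"
      by (intro add_left_mono sum_mono mult_right_mono fl) (use e in auto)
    also have "\<dots> = (\<Sum>b\<in>B. z b * e b)"
      unfolding m[symmetric] split[of "\<lambda>b. z b * e b"] split[of z]
      by (simp add: distrib_right right_diff_distrib sum_subtractf sum_distrib_right)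
    finally show ?thesis .
  qed
qed

lemma count_list_replicate_unit: "count_list (zip ys (replicate (length ys) ())) (y, ()) = count_list ys y"
  by (induction ys) auto

lemma dbar_count:
  fixes d :: "'x::finite \<Rightarrow> 'xh::finite \<Rightarrow> real" and u :: "nat list"
  assumes len: "length x = n" "length xh = n" "length u = n" and u: "set u \<subseteq> {..<k}"
    and N: "\<And>a b c. count_list (zip x (zip xh u)) (a, b, c) = N a b c"
  shows "dbar d x xh = (\<Sum>a\<in>UNIV. \<Sum>b\<in>UNIV. \<Sum>c<k. N a b c * d a b) / n"
proof -
  let ?zs = "zip x (zip xh u)"
  have sub: "set ?zs \<subseteq> UNIV \<times> UNIV \<times> {..<k}" using u by (auto dest!: set_zip_rightD)
  have "(\<Sum>i<n. d (x ! i) (xh ! i)) = (\<Sum>i<length ?zs. (\<lambda>(a, b, c). d a b) (?zs ! i))"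
    using len by (intro sum.cong) auto
  also have "\<dots> = (\<Sum>z\<in>UNIV \<times> UNIV \<times> {..<k}. count_list ?zs z * (\<lambda>(a, b, c). d a b) z)"
    by (rule sum_nth_count[OF sub]) simp
  also have "\<dots> = (\<Sum>a\<in>UNIV. \<Sum>b\<in>UNIV. \<Sum>c<k. N a b c * d a b)"
    by (simp add: sum.cartesian_product' N)
  finally show ?thesis using len by (simp add: dbar_def)
qed

lemma count_list_marginal:
  assumes len: "length x = n" "length y = n" "length u = n" and sub: "set x \<subseteq> A" "set u \<subseteq> C" "set y \<subseteq> B"
    and fin: "finite A" "finite B" "finite C"
  shows "(\<Sum>a\<in>A. count_list (zip x (zip y u)) (a, b, c)) = count_list (zip y u) (b, c)"
    and "(\<Sum>b\<in>B. count_list (zip x (zip y u)) (a, b, c)) = count_list (zip x u) (a, c)"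
proof -
  let ?zs = "zip x (zip y u)"
  have zs: "set ?zs \<subseteq> A \<times> B \<times> C"
  proof
    fix z assume "z \<in> set ?zs"
    then obtain i where i: "i < n" "z = (x ! i, y ! i, u ! i)" using len by (auto simp: set_zip)
    then have "x ! i \<in> set x" "y ! i \<in> set y" "u ! i \<in> set u" using len by simp_all
    then show "z \<in> A \<times> B \<times> C" using i(2) sub by blast
  qed
  have z1: "zip y u = map snd ?zs" using len by simp
  have z2: "zip x u = map (\<lambda>z. (fst z, snd (snd z))) ?zs" using len by (intro nth_equalityI) auto
  have c0: "count_list ?zs z = 0" if "z \<notin> A \<times> B \<times> C" for z
    using that zs by (intro count_notin) blast
  have "count_list (zip y u) (b, c) = (\<Sum>z\<in>{z\<in>A \<times> B \<times> C. snd z = (b, c)}. count_list ?zs z)"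
    by (subst z1, rule count_list_map_sum[OF zs]) (use fin in auto)
  also have "\<dots> = (\<Sum>z\<in>(\<lambda>a. (a, b, c)) ` A. count_list ?zs z)"
  proof (rule sum.mono_neutral_left)
    show "\<forall>z\<in>(\<lambda>a. (a, b, c)) ` A - {z\<in>A \<times> B \<times> C. snd z = (b, c)}. count_list ?zs z = 0" by (intro ballI c0) auto
  qed (use fin in auto)
  finally show "(\<Sum>a\<in>A. count_list ?zs (a, b, c)) = count_list (zip y u) (b, c)"
    by (subst (asm) sum.reindex) (auto simp: inj_on_def)
  have "count_list (zip x u) (a, c) = (\<Sum>z\<in>{z\<in>A \<times> B \<times> C. (fst z, snd (snd z)) = (a, c)}. count_list ?zs z)"
    unfolding z2 by (rule count_list_map_sum[OF zs]) (use fin in auto)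
  also have "\<dots> = (\<Sum>z\<in>(\<lambda>b. (a, b, c)) ` B. count_list ?zs z)"
  proof (rule sum.mono_neutral_left)
    show "\<forall>z\<in>(\<lambda>b. (a, b, c)) ` B - {z\<in>A \<times> B \<times> C. (fst z, snd (snd z)) = (a, c)}. count_list ?zs z = 0" by (intro ballI c0) auto
  qed (use fin in auto)
  finally show "(\<Sum>b\<in>B. count_list ?zs (a, b, c)) = count_list (zip x u) (a, c)"
    by (subst (asm) sum.reindex) (auto simp: inj_on_def)
qed

text \<open>The distortion of a pair is a linear function of its joint type with u, so a type
  covering by words of joint type N is also a covering within distortion D.\<close>

lemma cover_number_type_le:
  fixes d :: "'x::finite \<Rightarrow> 'xh::finite \<Rightarrow> real"
  assumes n: "1 \<le> n" and x: "length x = n" and u: "length u = n" "set u \<subseteq> {..<k}"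
    and N0: "\<And>a b c. k \<le> c \<Longrightarrow> N a b c = 0"
    and marg: "\<And>a c. (\<Sum>b\<in>UNIV. N a b c) = count_list (zip x u) (a, c)"
    and dist: "(\<Sum>a\<in>UNIV. \<Sum>b\<in>UNIV. \<Sum>c<k. N a b c * d a b) \<le> n * D"
  shows "cover_number d D n {x'. length x' = n \<and> count_list (zip x' u) = count_list (zip x u)} \<le>
    2 powr (n * cond_mutual_info UNIV UNIV {..<k} (\<lambda>a b c. real (N a b c) / n)) *
      cover_overhead CARD('x) (CARD('x) * CARD('xh) * k + k) n"
proof -
  have "\<exists>S. finite S \<and> S \<subseteq> {bs. length bs = n \<and> set bs \<subseteq> (UNIV :: 'xh set)} \<and>
    real (card S) \<le> 2 powr (n * cond_mutual_info UNIV UNIV {..<k} (\<lambda>a b c. real (N a b c) / n)) *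
      ((n * ln (card (UNIV :: 'x set)) + 1) * (exp 1 * (real n + 1)) ^ (card (UNIV :: 'x set) * card (UNIV :: 'xh set) * card {..<k} + card {..<k})) \<and>
    (\<forall>as. length as = n \<longrightarrow> (\<forall>a c. count_list (zip as u) (a, c) = (\<Sum>b\<in>UNIV. N a b c)) \<longrightarrow>
      (\<exists>bs\<in>S. \<forall>a b c. count_list (zip as (zip bs u)) (a, b, c) = N a b c))"
    by (rule type_cover) (use n u N0 in auto)
  then obtain S where S: "S \<subseteq> {bs. length bs = n}"
    "real (card S) \<le> 2 powr (n * cond_mutual_info UNIV UNIV {..<k} (\<lambda>a b c. real (N a b c) / n)) *
      cover_overhead CARD('x) (CARD('x) * CARD('xh) * k + k) n"
    "\<And>as. length as = n \<Longrightarrow> (\<And>a c. count_list (zip as u) (a, c) = (\<Sum>b\<in>UNIV. N a b c)) \<Longrightarrow>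
      \<exists>bs\<in>S. \<forall>a b c. count_list (zip as (zip bs u)) (a, b, c) = N a b c"
    by (auto simp: cover_overhead_def)
  have "\<exists>xh\<in>S. dbar d x' xh \<le> D" if x': "x' \<in> {x'. length x' = n \<and> count_list (zip x' u) = count_list (zip x u)}" for x'
  proof -
    obtain xh where xh: "xh \<in> S" "\<And>a b c. count_list (zip x' (zip xh u)) (a, b, c) = N a b c"
      using S(3)[of x'] x' marg by auto
    have "dbar d x' xh = (\<Sum>a\<in>UNIV. \<Sum>b\<in>UNIV. \<Sum>c<k. N a b c * d a b) / n"
      by (rule dbar_count[OF _ _ u xh(2)]) (use x' xh(1) S(1) in auto)
    also have "\<dots> \<le> D" using dist n by (simp add: divide_le_eq mult.commute)
    finally show ?thesis using xh(1) by blast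
  qed
  with S(1) have "cover_number d D n {x'. length x' = n \<and> count_list (zip x' u) = count_list (zip x u)} \<le> card S"
    by (intro cover_number_le) auto
  then show ?thesis using S(2) by linarith
qed

section \<open>The bound for one type of y at finite blocklength\<close>

text \<open>The logarithm of all subexponential factors in \<open>block_bound\<close>: the number of
  joint types of (x, y, u) and, to the power \<rho>, the factor 4 and the codebook overhead from
  \<open>B\<close>, the number of joint types of (x, u), and the overhead of the reconstruction
  covering.\<close>

definition block_overhead :: "nat \<Rightarrow> nat \<Rightarrow> nat \<Rightarrow> nat \<Rightarrow> real \<Rightarrow> nat \<Rightarrow> real" where
  "block_overhead cx cy ch k \<rho> n = cx * cy * k * log 2 (real n + 1) +
     \<rho> * (2 + log 2 (cover_overhead cy (cy * k + 1) n) + cx * k * log 2 (real n + 1)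
        + log 2 (cover_overhead cx (cx * ch * k + k) n))"

lemma block_overhead_tendsto:
  assumes "1 \<le> cx" "1 \<le> cy"
  shows "(\<lambda>n. block_overhead cx cy ch k \<rho> n / n) \<longlonglongrightarrow> 0"
proof -
  have "(\<lambda>n. real (cx * cy * k) * (log 2 (real n + 1) / n) +
     \<rho> * (2 / real n + log 2 (cover_overhead cy (cy * k + 1) n) / n + real (cx * k) * (log 2 (real n + 1) / n)
        + log 2 (cover_overhead cx (cx * ch * k + k) n) / n)) \<longlonglongrightarrow>
     real (cx * cy * k) * 0 + \<rho> * (0 + 0 + real (cx * k) * 0 + 0)"
    by (intro tendsto_intros log_Suc_over_n const_over_n cover_overhead_tendsto assms)
  then show ?thesis by (simp add: block_overhead_def add_divide_distrib distrib_left)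
qed

lemma num_desc_ge: "0 \<le> R \<Longrightarrow> 2 powr (n * R - 1) \<le> num_desc n R"
proof -
  assume "0 \<le> R"
  then have "n * R - 1 \<le> real (nat \<lfloor>n * R\<rfloor>)" by (simp add: mult_nonneg_nonneg)
  then have "2 powr (n * R - 1) \<le> 2 powr real (nat \<lfloor>n * R\<rfloor>)" by simp
  then show ?thesis by (simp add: num_desc_def powr_realpow)
qed

text \<open>The hypothesis is that every code fails at level X, as the compactness argument supplies
  it; the code built from J then exhibits a joint type t responsible for the failure. As t is fixed
  before N, the latter can be adapted to it. The term with \<open>max 0\<close> is the excess of the
  codebook over the number of descriptions, paid for in guesses.\<close>

lemma block_bound:
  fixes P :: "'x::finite \<times> 'y::finite \<Rightarrow> real" and d :: "'x \<Rightarrow> 'xh::finite \<Rightarrow> real" and J :: "'y \<Rightarrow> nat \<Rightarrow> nat"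
  assumes P: "\<And>z. 0 \<le> P z" and R: "0 \<le> R" and rho: "0 < \<rho>" and n: "1 \<le> n" and X: "0 < X"
    and feas: "\<And>x :: 'x list. length x = n \<Longrightarrow> \<exists>xh. length xh = n \<and> dbar d x xh \<le> D"
    and J0: "\<And>y v. k \<le> v \<Longrightarrow> J y v = 0"
    and bad: "\<And>f g. is_helper n R f \<Longrightarrow> is_guessing_strategy n R g \<Longrightarrow>
      X < (\<Sum>(x, y)\<in>{(x, y). length x = n \<and> length y = n \<and> count_list y = (\<lambda>y. \<Sum>v<k. J y v)}.
        (\<Prod>i<n. P (x ! i, y ! i)) * real (num_guesses d D g x (f y)) powr \<rho>)"
  shows "\<exists>t :: 'x \<Rightarrow> 'y \<Rightarrow> nat \<Rightarrow> nat. (\<forall>y v. (\<Sum>x\<in>UNIV. t x y v) = J y v) \<and>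
    (\<forall>x y v. 0 < t x y v \<longrightarrow> 0 < P (x, y)) \<and> (\<Sum>x\<in>UNIV. \<Sum>y\<in>UNIV. \<Sum>v<k. t x y v) = n \<and>
    (\<forall>N. (\<forall>a b c. k \<le> c \<longrightarrow> N a b c = 0) \<longrightarrow> (\<forall>a c. (\<Sum>b\<in>UNIV. N a b c) = (\<Sum>y\<in>UNIV. t a y c)) \<longrightarrow>
      (\<Sum>a\<in>UNIV. \<Sum>b\<in>UNIV. \<Sum>c<k. real (N a b c) * d a b) \<le> n * D \<longrightarrow>
      log 2 X \<le> \<rho> * (n * cond_mutual_info UNIV UNIV {..<k} (\<lambda>a b c. real (N a b c) / n) +
          max 0 (n * cond_mutual_info UNIV {..<k} {()} (\<lambda>y v _. real (J y v) / n) - n * R))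
        - n * type_divergence P k (\<lambda>x y v. real (t x y v) / n)
        + block_overhead CARD('x) CARD('y) CARD('xh) k \<rho> n)"
proof -
  define Y0 where "Y0 = {y :: 'y list. length y = n \<and> count_list y = (\<lambda>y. \<Sum>v<k. J y v)}"
  define I where "I = cond_mutual_info UNIV {..<k} {()} (\<lambda>y v _. real (J y v) / n)"
  define e1 where "e1 = cover_overhead CARD('y) (CARD('y) * k + 1) n"
  define e2 where "e2 = cover_overhead CARD('x) (CARD('x) * CARD('xh) * k + k) n"
  let ?M = "num_desc n R"
  have e1: "1 \<le> e1" and e2: "1 \<le> e2" by (auto simp: e1_def e2_def intro!: cover_overhead_ge_1)
  have "\<exists>S. finite S \<and> S \<subseteq> {bs. length bs = n \<and> set bs \<subseteq> {..<k}} \<and>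
    real (card S) \<le> 2 powr (n * cond_mutual_info (UNIV :: 'y set) {..<k} {()} (\<lambda>y v c. real (J y v) / n)) *
      ((n * ln (card (UNIV :: 'y set)) + 1) * (exp 1 * (real n + 1)) ^ (card (UNIV :: 'y set) * card {..<k} * card {()} + card {()})) \<and>
    (\<forall>as. length as = n \<longrightarrow> (\<forall>a c. count_list (zip as (replicate n ())) (a, c) = (\<Sum>b<k. J a b)) \<longrightarrow>
      (\<exists>bs\<in>S. \<forall>a b c. count_list (zip as (zip bs (replicate n ()))) (a, b, c) = J a b))"
    by (rule type_cover[where N="\<lambda>a b c. J a b" and C="{()}"]) (use n J0 in auto)
  then obtain C where C: "finite C" "C \<subseteq> {bs. length bs = n \<and> set bs \<subseteq> {..<k}}" "card C \<le> 2 powr (n * I) * e1"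
    "\<And>as. length as = n \<Longrightarrow> (\<And>a. count_list (zip as (replicate n ())) (a, ()) = (\<Sum>b<k. J a b)) \<Longrightarrow>
      \<exists>bs\<in>C. \<forall>a b. count_list (zip as (zip bs (replicate n ()))) (a, b, ()) = J a b"
    by (auto simp: cover_overhead_def I_def e1_def)
  have "\<exists>v\<in>C. \<forall>a b. count_list (zip y v) (a, b) = J a b" if y: "y \<in> Y0" for y
  proof -
    have "\<exists>bs\<in>C. \<forall>a b. count_list (zip y (zip bs (replicate n ()))) (a, b, ()) = J a b"
      using y count_list_replicate_unit[of y] by (intro C(4)) (auto simp: Y0_def)
    then obtain v where v: "v \<in> C" "\<And>a b. count_list (zip y (zip v (replicate n ()))) (a, b, ()) = J a b" by blast
    have len: "length v = n" "length y = n" using v C(2) y by (auto simp: Y0_def)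
    have "inj (\<lambda>z :: 'y \<times> nat. (fst z, snd z, ()))" by (auto simp: inj_on_def)
    from count_list_map_conv[OF this]
    have "count_list (map (\<lambda>z. (fst z, snd z, ())) (zip y v)) (a, b, ()) = count_list (zip y v) (a, b)" for a b
      by (metis fst_conv snd_conv)
    moreover have "map (\<lambda>z. (fst z, snd z, ())) (zip y v) = zip y (zip v (replicate n ()))"
      using len by (intro nth_equalityI) auto
    ultimately show ?thesis using v by auto
  qed
  then obtain u where u: "\<And>y. y \<in> Y0 \<Longrightarrow> u y \<in> C" "\<And>y a b. y \<in> Y0 \<Longrightarrow> count_list (zip y (u y)) (a, b) = J a b"
    by metis
  have uC: "length (u y) = n" "set (u y) \<subseteq> {..<k}" "length y = n" if "y \<in> Y0" for y
    using u(1)[OF that] C(2) that by (auto simp: Y0_def)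
  \<comment> \<open>The number of codewords that must share a description, rounded up to at least
    1.\<close>
  define B where "B = Suc (card C div ?M)"
  have M: "0 < ?M" by (simp add: num_desc_def)
  have BM: "card C \<le> B * ?M"
    unfolding B_def using M by (metis dividend_less_times_div less_imp_le mult.commute mult_Suc_right)
  have B1: "1 \<le> B" by (simp add: B_def)
  have C_lists: "length v = n \<and> set v \<subseteq> {..<k}" if "v \<in> C" for v using C(2) that by auto
  \<comment> \<open>Of the factor 4, one factor 2 comes from the rounding of n R in
    \<open>num_desc\<close>, the other absorbs the added 1 in \<open>B\<close>.\<close>
  have B_le: "real B \<le> 4 * e1 * 2 powr (max 0 (n * I - n * R))"
  proof -
    have "real (card C div ?M) \<le> card C / ?M" by (rule of_nat_div_le_of_nat)
    also have "\<dots> \<le> (2 powr (n * I) * e1) / 2 powr (n * R - 1)"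
      using C(3) num_desc_ge[OF R, of n] e1 by (intro frac_le) auto
    also have "\<dots> = 2 * e1 * 2 powr (n * I - n * R)" by (simp add: powr_diff)
    also have "\<dots> \<le> 2 * e1 * 2 powr (max 0 (n * I - n * R))" using e1 by (intro mult_left_mono) auto
    finally have "real B \<le> 2 * e1 * 2 powr (max 0 (n * I - n * R)) + 1" by (simp add: B_def)
    moreover have "1 * 1 \<le> e1 * 2 powr (max 0 (n * I - n * R))" using e1 by (intro mult_mono ge_one_powr_ge_zero) auto
    ultimately show ?thesis by simp
  qed
  let ?K = "(n + 1) ^ (CARD('x) * k)"
  let ?cov = "\<lambda>w. cover_number d D n {x'. length x' = n \<and> count_list (zip x' (u (snd w))) = count_list (zip (fst w) (u (snd w)))}"
  let ?S = "{(x :: 'x list, y). length x = n \<and> y \<in> Y0}"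
  let ?Pn = "\<lambda>w. \<Prod>i<n. P (fst w ! i, snd w ! i)"
  let ?h = "\<lambda>w. real ((B * ?K) * ?cov w) powr \<rho>"
  let ?\<tau> = "\<lambda>w. count_list (zip (fst w) (zip (snd w) (u (snd w))))"
  obtain f g where fg: "is_helper n R f" "is_guessing_strategy n R g"
    "\<And>x y. y \<in> Y0 \<Longrightarrow> length x = n \<Longrightarrow> num_guesses d D g x (f y) \<le> (B * ?K) * ?cov (x, y)"
    using helper_from_codebook[where C=C and B=B and ?Y0.0=Y0 and u=u and k=k and R=R, OF feas C(1) C_lists BM B1 u(1)]
    unfolding fst_conv snd_conv by blast
  have finS: "finite ?S"
    by (rule finite_subset[OF _ finite_cartesian_product[OF finite_lists_UNIV[of n] finite_lists_UNIV[of n]]]) (auto simp: Y0_def)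
  have "X < (\<Sum>(x, y)\<in>?S. (\<Prod>i<n. P (x ! i, y ! i)) * real (num_guesses d D g x (f y)) powr \<rho>)"
    using bad[OF fg(1,2)] by (simp add: Y0_def)
  also have "\<dots> = (\<Sum>w\<in>?S. ?Pn w * real (num_guesses d D g (fst w) (f (snd w))) powr \<rho>)"
    by (intro sum.cong refl) auto
  also have "\<dots> \<le> (\<Sum>w\<in>?S. ?Pn w * ?h w)"
  proof (intro sum_mono mult_left_mono powr_mono2)
    fix w assume "w \<in> ?S"
    then have "snd w \<in> Y0" "length (fst w) = n" by auto
    from fg(3)[OF this] show "real (num_guesses d D g (fst w) (f (snd w))) \<le> real ((B * ?K) * ?cov w)"
      by (simp only: of_nat_le_iff prod.collapse fst_conv snd_conv)
  qed (use rho P in \<open>auto intro!: prod_nonneg\<close>)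
  finally have Xlt: "X < (\<Sum>w\<in>?S. ?Pn w * ?h w)" .
  have Pnn: "0 \<le> ?Pn w" for w by (intro prod_nonneg ballI P)
  obtain w where w: "w \<in> ?S" "X < card (?\<tau> ` ?S) * ((\<Sum>w'\<in>{w'\<in>?S. ?\<tau> w' = ?\<tau> w}. ?Pn w') * ?h w)"
    "0 < ?h w" "0 < (\<Sum>w'\<in>{w'\<in>?S. ?\<tau> w' = ?\<tau> w}. ?Pn w')"
    by (rule sum_type_pigeonhole[where p="?Pn" and h="?h" and \<tau>="?\<tau>", OF finS Pnn less_imp_le[OF X] Xlt])
  obtain x0 y0 where w0: "w = (x0, y0)" "length x0 = n" "y0 \<in> Y0" using w(1) by auto
  define \<tau> where "\<tau> = ?\<tau> w"
  define t where "t x y v = \<tau> (x, y, v)" for x y v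
  define tr where "tr x y v = real (t x y v) / n" for x y v
  have sub: "set (zip x (zip y (u y))) \<subseteq> UNIV \<times> UNIV \<times> {..<k}" if "y \<in> Y0" for x :: "'x list" and y
    using uC(2)[OF that] by (auto dest!: set_zip_rightD)
  have \<tau>: "\<tau> = count_list (zip x0 (zip y0 (u y0)))" by (simp add: \<tau>_def w0)
  note marg = count_list_marginal[where x=x0 and y=y0 and u="u y0" and A=UNIV and B=UNIV and C="{..<k}" and n=n,
      OF w0(2) uC(3,1)[OF w0(3)] subset_UNIV uC(2)[OF w0(3)] subset_UNIV finite finite finite_lessThan]
  have marg1: "(\<Sum>x\<in>UNIV. t x y v) = J y v" for y v
    using marg(1) u(2)[OF w0(3)] by (simp only: t_def \<tau>)
  have marg2: "(\<Sum>y\<in>UNIV. t x y v) = count_list (zip x0 (u y0)) (x, v)" for x v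
    using marg(2) by (simp only: t_def \<tau>)
  \<comment> \<open>The class has positive probability, so one of its words does; every triple with
    positive count occurs along that word.\<close>
  have ac: "0 < P (x, y)" if "0 < t x y v" for x y v
  proof -
    have "\<exists>w'\<in>{w'\<in>?S. ?\<tau> w' = \<tau>}. ?Pn w' \<noteq> 0"
    proof (rule ccontr)
      assume "\<not> ?thesis"
      then have "(\<Sum>w'\<in>{w'\<in>?S. ?\<tau> w' = \<tau>}. ?Pn w') = 0" by (intro sum.neutral) blast
      then show False using w(4) by (simp only: \<tau>_def less_irrefl)
    qed
    then obtain w' where w': "w' \<in> ?S" "?\<tau> w' = \<tau>" "?Pn w' \<noteq> 0" by blast
    have "\<tau> (x, y, v) \<noteq> 0" using that by (simp add: t_def)
    then have "(x, y, v) \<in> set (zip (fst w') (zip (snd w') (u (snd w'))))"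
      unfolding w'(2)[symmetric] by (simp add: count_list_0_iff)
    then obtain i where "i < n" "fst w' ! i = x" "snd w' ! i = y"
      using w'(1) uC by (auto simp: set_zip)
    then have "P (x, y) \<noteq> 0" using w'(3) by auto
    then show ?thesis using P[of "(x, y)"] by simp
  qed
  have tot: "(\<Sum>x\<in>UNIV. \<Sum>y\<in>UNIV. \<Sum>v<k. t x y v) = n"
  proof -
    have "(\<Sum>z\<in>UNIV \<times> UNIV \<times> {..<k}. \<tau> z) = length (zip x0 (zip y0 (u y0)))"
      unfolding \<tau>_def w0 fst_conv snd_conv by (rule sum_count_set[OF sub[OF w0(3)]]) simp
    then show ?thesis using w0 uC by (simp add: sum.cartesian_product' t_def)
  qed
  have Pr: "(\<Sum>w'\<in>{w'\<in>?S. ?\<tau> w' = \<tau>}. ?Pn w') \<le> 2 powr (- (n * type_divergence P k tr))"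
  proof -
    have "(\<Sum>(x, y)\<in>{(x, y). length x = n \<and> y \<in> Y0 \<and> count_list (zip x (zip y (u y))) = \<tau>}. \<Prod>i<n. P (x ! i, y ! i))
      \<le> 2 powr (- (n * type_divergence P k tr))"
    proof (rule type_class_prob[where t=tr])
      show "0 < P (x, y)" if "0 < tr x y v" for x y v
        using ac[of x y v] that by (simp add: tr_def zero_less_divide_iff)
    qed (use P n uC in \<open>auto simp: tr_def t_def\<close>)
    moreover have "{(x, y). length x = n \<and> y \<in> Y0 \<and> count_list (zip x (zip y (u y))) = \<tau>} = {w'\<in>?S. ?\<tau> w' = \<tau>}"
      by auto
    ultimately show ?thesis by (simp add: case_prod_beta)
  qed
  have T: "card (?\<tau> ` ?S) \<le> (n + 1) ^ (CARD('x) * CARD('y) * k)"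
  proof -
    have "?\<tau> ` ?S \<subseteq> count_list ` {zs. length zs = n \<and> set zs \<subseteq> (UNIV :: 'x set) \<times> (UNIV :: 'y set) \<times> {..<k}}"
    proof
      fix c assume "c \<in> ?\<tau> ` ?S"
      then obtain x y where "c = count_list (zip x (zip y (u y)))" "length x = n" "y \<in> Y0" by auto
      then show "c \<in> count_list ` {zs. length zs = n \<and> set zs \<subseteq> (UNIV :: 'x set) \<times> (UNIV :: 'y set) \<times> {..<k}}"
        using sub[of y x] uC[of y] by (intro image_eqI[of _ _ "zip x (zip y (u y))"]) auto
    qed
    from card_mono[OF _ this] card_types_le[of "(UNIV :: 'x set) \<times> (UNIV :: 'y set) \<times> {..<k}" n]
    show ?thesis by (simp add: card_cartesian_product mult.assoc)
  qed
  have main: "log 2 X \<le> \<rho> * (n * cond_mutual_info UNIV UNIV {..<k} (\<lambda>a b c. real (N a b c) / n) + max 0 (n * I - n * R))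
        - n * type_divergence P k tr + block_overhead CARD('x) CARD('y) CARD('xh) k \<rho> n"
    if N: "\<forall>a b c. k \<le> c \<longrightarrow> N a b c = 0" "\<forall>a c. (\<Sum>b\<in>UNIV. N a b c) = (\<Sum>y\<in>UNIV. t a y c)"
      "(\<Sum>a\<in>UNIV. \<Sum>b\<in>UNIV. \<Sum>c<k. real (N a b c) * d a b) \<le> n * D" for N
  proof -
    define c where "c = cond_mutual_info UNIV UNIV {..<k} (\<lambda>a b c. real (N a b c) / n)"
    define m where "m = max 0 (n * I - n * R)"
    have "real (?cov w) \<le> 2 powr (n * c) * e2"
      unfolding c_def e2_def w0 fst_conv snd_conv
      by (rule cover_number_type_le) (use n w0 uC[of y0] N marg2 in auto)
    then have "real ((B * ?K) * ?cov w) \<le> ((4 * e1 * 2 powr m) * (real n + 1) ^ (CARD('x) * k)) * (2 powr (n * c) * e2)"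
      unfolding of_nat_mult using B_le e1 by (intro mult_mono) (auto simp: m_def add.commute)
    then have "?h w \<le> (((4 * e1 * 2 powr m) * (real n + 1) ^ (CARD('x) * k)) * (2 powr (n * c) * e2)) powr \<rho>"
      using rho by (intro powr_mono2) auto
    moreover have "real (card (?\<tau> ` ?S)) \<le> (real n + 1) ^ (CARD('x) * CARD('y) * k)"
      using T by (metis (no_types, lifting) of_nat_1 of_nat_add of_nat_le_iff of_nat_power)
    ultimately have "X \<le> (real n + 1) ^ (CARD('x) * CARD('y) * k) * (2 powr (- (n * type_divergence P k tr)) *
        (((4 * e1 * 2 powr m) * (real n + 1) ^ (CARD('x) * k)) * (2 powr (n * c) * e2)) powr \<rho>)"
      using w(2) w(3) Pr w(4) unfolding \<tau>_def[symmetric]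
      by (intro order_trans[OF less_imp_le[OF w(2)[folded \<tau>_def]]] mult_mono) (auto simp: less_imp_le)
    then have "log 2 X \<le> log 2 ((real n + 1) ^ (CARD('x) * CARD('y) * k) * (2 powr (- (n * type_divergence P k tr)) *
        (((4 * e1 * 2 powr m) * (real n + 1) ^ (CARD('x) * k)) * (2 powr (n * c) * e2)) powr \<rho>))"
      using X by (intro log_mono) auto
    also have "\<dots> = (CARD('x) * CARD('y) * k) * log 2 (real n + 1) - n * type_divergence P k tr
        + \<rho> * (2 + log 2 e1 + m + (CARD('x) * k) * log 2 (real n + 1) + (n * c + log 2 e2))"
    proof -
      have "log 2 4 = (2 :: real)" using log_nat_power[of 2 2 2] by simp
      moreover have "0 < (4 * e1 * 2 powr m) * (real n + 1) ^ (CARD('x) * k) * (2 powr (n * c) * e2)" using e1 e2 by auto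
      ultimately show ?thesis using e1 e2
        by (simp add: log_mult_pos log_nat_power log_powr)
    qed
    finally show ?thesis unfolding block_overhead_def e1_def[symmetric] e2_def[symmetric] c_def[symmetric] m_def[symmetric]
      by (simp add: algebra_simps)
  qed
  have "tr = (\<lambda>x y v. real (t x y v) / n)" by (simp add: tr_def fun_eq_iff)
  from main[unfolded this] show ?thesis
    unfolding I_def[symmetric] using marg1 ac tot by (intro exI[of _ t]) blast
qed

section \<open>Limits of types\<close>

text \<open>This is the upper semicontinuity of the rate-distortion function, at the level of
  integer counts: a test channel admissible for the limit is approximated by counts with the exact
  marginals \<open>s j\<close> that satisfy the distortion constraint for every j, not just
  asymptotically.\<close>

lemma rate_distortion_types:
  fixes D :: real and d :: "'x::finite \<Rightarrow> 'xh::finite \<Rightarrow> real" and s :: "nat \<Rightarrow> 'x \<Rightarrow> nat \<Rightarrow> nat" and m :: "nat \<Rightarrow> nat"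
  assumes m: "\<And>j. 1 \<le> m j" "filterlim m at_top sequentially"
    and s_sum: "\<And>j. (\<Sum>x\<in>UNIV. \<Sum>v<k. s j x v) = m j"
    and s_lim: "\<And>x v. v < k \<Longrightarrow> (\<lambda>j. real (s j x v) / m j) \<longlonglongrightarrow> s' x v"
    and K: "\<And>x v. v < k \<Longrightarrow> pmf_on UNIV (K x v)"
    and K_dist: "(\<Sum>x\<in>UNIV. \<Sum>v<k. \<Sum>b\<in>UNIV. s' x v * K x v b * d x b) \<le> D"
    and x0: "\<And>x b. d x (x0 x) \<le> d x b" "\<And>x. d x (x0 x) \<le> D"
  shows "\<exists>N :: nat \<Rightarrow> 'x \<Rightarrow> 'xh \<Rightarrow> nat \<Rightarrow> nat. (\<forall>j. (\<forall>a b c. k \<le> c \<longrightarrow> N j a b c = 0) \<and>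
      (\<forall>a c. c < k \<longrightarrow> (\<Sum>b\<in>UNIV. N j a b c) = s j a c) \<and>
      (\<Sum>a\<in>UNIV. \<Sum>b\<in>UNIV. \<Sum>c<k. real (N j a b c) * d a b) \<le> m j * D) \<and>
    (\<forall>a b c. c < k \<longrightarrow> (\<lambda>j. real (N j a b c) / m j) \<longlonglongrightarrow> s' a c * K a c b)"
proof -
  define S where "S j x v = real (s j x v) / m j" for j x v
  \<comment> \<open>The sum dominates every relative deviation of \<open>S\<close> from s'. Entries
    with s' = 0 contribute 0 by the division convention and need no bound in \<open>S_ge\<close>;
    the minimum with 1 keeps 1 - \<open>\<epsilon>\<close> nonnegative.\<close>
  define \<epsilon> where "\<epsilon> j = min 1 (\<Sum>x\<in>UNIV. \<Sum>v<k. \<bar>S j x v - s' x v\<bar> / s' x v)" for j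
  \<comment> \<open>\<open>K\<close> meets the distortion constraint for \<open>s'\<close> only. A fraction \<open>1 - \<epsilon>\<close> of \<open>s'\<close> fits below \<open>S\<close>;
    the rest of \<open>S\<close> is sent to \<open>x0\<close>, at cost at most \<open>D\<close> per unit mass.\<close>
  define q where "q j x b v = (1 - \<epsilon> j) * s' x v * K x v b + (if b = x0 x then S j x v - (1 - \<epsilon> j) * s' x v else 0)" for j x b v
  define N where "N j x b v = (if v < k then round_to UNIV (x0 x) (s j x v) (\<lambda>b. m j * q j x b v) b else 0)" for j x b v
  have S_lim: "(\<lambda>j. S j x v) \<longlonglongrightarrow> s' x v" if "v < k" for x v using s_lim[OF that] by (simp add: S_def)
  have S_nn: "0 \<le> S j x v" for j x v by (simp add: S_def)
  have s'_nn: "0 \<le> s' x v" if "v < k" for x v using S_lim[OF that] S_nn by (meson LIMSEQ_le_const)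
  have S_sum: "(\<Sum>x\<in>UNIV. \<Sum>v<k. S j x v) = 1" for j
  proof -
    have "(\<Sum>x\<in>UNIV. \<Sum>v<k. S j x v) = real (\<Sum>x\<in>UNIV. \<Sum>v<k. s j x v) / m j"
      by (simp add: S_def sum_divide_distrib)
    then show ?thesis using m(1)[of j] by (simp add: s_sum)
  qed
  have s'_sum: "(\<Sum>x\<in>UNIV. \<Sum>v<k. s' x v) = 1"
  proof -
    have "(\<lambda>j. \<Sum>x\<in>UNIV. \<Sum>v<k. S j x v) \<longlonglongrightarrow> (\<Sum>x\<in>UNIV. \<Sum>v<k. s' x v)"
      by (intro tendsto_sum S_lim) simp
    then show ?thesis by (simp add: S_sum LIMSEQ_const_iff)
  qed
  have K_nn: "0 \<le> K x v b" and K_sum: "(\<Sum>b\<in>UNIV. K x v b) = 1" if "v < k" for x v b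
    using K[OF that, of x] by (auto simp: pmf_on_def)
  have \<epsilon>_lim: "\<epsilon> \<longlonglongrightarrow> 0"
  proof -
    have "(\<lambda>j. \<bar>S j x v - s' x v\<bar> / s' x v) \<longlonglongrightarrow> 0" if "v < k" for x v
    proof -
      have "(\<lambda>j. \<bar>S j x v - s' x v\<bar>) \<longlonglongrightarrow> \<bar>s' x v - s' x v\<bar>" by (intro tendsto_intros S_lim that)
      then have "(\<lambda>j. \<bar>S j x v - s' x v\<bar> * (1 / s' x v)) \<longlonglongrightarrow> 0 * (1 / s' x v)"
        by (intro tendsto_mult_right) simp
      then show ?thesis by simp
    qed
    then have "(\<lambda>j. \<Sum>x\<in>UNIV. \<Sum>v<k. \<bar>S j x v - s' x v\<bar> / s' x v) \<longlonglongrightarrow> (\<Sum>x\<in>(UNIV :: 'x set). \<Sum>v<k. 0)"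
      by (intro tendsto_sum) simp
    then have "(\<lambda>j. min 1 (\<Sum>x\<in>UNIV. \<Sum>v<k. \<bar>S j x v - s' x v\<bar> / s' x v)) \<longlonglongrightarrow> min 1 0"
      by (intro tendsto_min tendsto_const) simp
    then show ?thesis by (simp add: \<epsilon>_def[abs_def])
  qed
  have \<epsilon>1: "\<epsilon> j \<le> 1" for j by (simp add: \<epsilon>_def)
  have S_ge: "(1 - \<epsilon> j) * s' x v \<le> S j x v" if v: "v < k" for j x v
  proof (cases "s' x v = 0 \<or> \<epsilon> j = 1")
    case True
    then show ?thesis using S_nn[of j x v] by auto
  next
    case False
    then have pos: "0 < s' x v" using s'_nn[OF v, of x] by simp
    have "\<bar>S j x v - s' x v\<bar> / s' x v \<le> (\<Sum>v<k. \<bar>S j x v - s' x v\<bar> / s' x v)"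
      by (rule member_le_sum[of v "{..<k}" "\<lambda>v. \<bar>S j x v - s' x v\<bar> / s' x v"]) (use v s'_nn in auto)
    also have "\<dots> \<le> (\<Sum>x\<in>UNIV. \<Sum>v<k. \<bar>S j x v - s' x v\<bar> / s' x v)"
      by (rule member_le_sum[of x UNIV "\<lambda>x. \<Sum>v<k. \<bar>S j x v - s' x v\<bar> / s' x v"]) (auto intro!: sum_nonneg divide_nonneg_nonneg s'_nn)
    also have "\<dots> = \<epsilon> j" using False by (auto simp: \<epsilon>_def min_def split: if_splits)
    finally have "\<bar>S j x v - s' x v\<bar> \<le> \<epsilon> j * s' x v" using pos by (simp add: divide_le_eq)
    then show ?thesis by (simp add: algebra_simps abs_le_iff)
  qed
  have q_nn: "0 \<le> q j x b v" if "v < k" for j x b v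
    unfolding q_def using S_ge[OF that] K_nn[OF that] s'_nn[OF that] \<epsilon>1[of j] by (auto intro!: add_nonneg_nonneg mult_nonneg_nonneg)
  have q_sum: "(\<Sum>b\<in>UNIV. q j x b v) = S j x v" if "v < k" for j x v
    by (simp add: q_def sum.distrib sum_distrib_left[symmetric] K_sum[OF that])
  have mq_sum: "(\<Sum>b\<in>UNIV. m j * q j x b v) = real (s j x v)" if "v < k" for j x v
    using m(1)[of j] by (simp add: sum_distrib_left[symmetric] q_sum[OF that] S_def)
  have mq_nn: "0 \<le> m j * q j x b v" if "v < k" for j x b v using q_nn[OF that] by simp
  have N_sum: "(\<Sum>b\<in>UNIV. N j a b c) = s j a c" if "c < k" for j a c
    using round_to(1)[where B="UNIV :: 'xh set" and z="\<lambda>b. m j * q j a b c" and ?b0.0="x0 a", OF _ _ mq_nn[OF that] mq_sum[OF that]] that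
    by (simp add: N_def)
  have N_dist: "(\<Sum>a\<in>UNIV. \<Sum>b\<in>UNIV. \<Sum>c<k. real (N j a b c) * d a b) \<le> m j * D" for j
  proof -
    have "(\<Sum>a\<in>UNIV. \<Sum>b\<in>UNIV. \<Sum>c<k. real (N j a b c) * d a b) = (\<Sum>a\<in>UNIV. \<Sum>c<k. \<Sum>b\<in>UNIV. real (N j a b c) * d a b)"
      by (intro sum.cong refl) (rule sum.swap)
    also have "\<dots> \<le> (\<Sum>a\<in>UNIV. \<Sum>c<k. \<Sum>b\<in>UNIV. m j * q j a b c * d a b)"
    proof (rule sum_mono, rule sum_mono)
      fix a c assume "c \<in> {..<k}"
      then have c: "c < k" by simp
      show "(\<Sum>b\<in>UNIV. real (N j a b c) * d a b) \<le> (\<Sum>b\<in>UNIV. m j * q j a b c * d a b)"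
        using round_to(3)[where B="UNIV :: 'xh set" and z="\<lambda>b. m j * q j a b c" and ?b0.0="x0 a" and e="d a", OF _ _ mq_nn[OF c] mq_sum[OF c] x0(1)] c
        by (simp add: N_def)
    qed
    also have "\<dots> = m j * (\<Sum>a\<in>UNIV. \<Sum>c<k. \<Sum>b\<in>UNIV. q j a b c * d a b)"
      by (simp add: sum_distrib_left mult.assoc)
    also have "(\<Sum>a\<in>UNIV. \<Sum>c<k. \<Sum>b\<in>UNIV. q j a b c * d a b) =
        (\<Sum>a\<in>UNIV. \<Sum>c<k. (\<Sum>b\<in>UNIV. (1 - \<epsilon> j) * (s' a c * K a c b * d a b)) + (S j a c - (1 - \<epsilon> j) * s' a c) * d a (x0 a))"
      by (intro sum.cong refl) (simp add: q_def distrib_right sum.distrib if_distrib[of "\<lambda>z. z * _"] mult.assoc cong: if_cong)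
    also have "\<dots> \<le> (\<Sum>a\<in>UNIV. \<Sum>c<k. (\<Sum>b\<in>UNIV. (1 - \<epsilon> j) * (s' a c * K a c b * d a b)) + (S j a c - (1 - \<epsilon> j) * s' a c) * D)"
      by (intro sum_mono add_left_mono mult_left_mono x0) (use S_ge in auto)
    also have "\<dots> = (1 - \<epsilon> j) * (\<Sum>a\<in>UNIV. \<Sum>c<k. \<Sum>b\<in>UNIV. s' a c * K a c b * d a b) +
        ((\<Sum>a\<in>UNIV. \<Sum>c<k. S j a c) - (1 - \<epsilon> j) * (\<Sum>a\<in>UNIV. \<Sum>c<k. s' a c)) * D"
      by (simp add: sum.distrib sum_subtractf sum_distrib_left sum_distrib_right left_diff_distrib)
    also have "\<dots> \<le> (1 - \<epsilon> j) * D + (1 - (1 - \<epsilon> j) * 1) * D"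
      unfolding S_sum s'_sum using \<epsilon>1[of j] K_dist by (intro add_right_mono mult_left_mono) auto
    also have "\<dots> = D" by (simp add: algebra_simps)
    finally show ?thesis by (simp add: mult_left_mono)
  qed
  have N_lim: "(\<lambda>j. real (N j a b c) / m j) \<longlonglongrightarrow> s' a c * K a c b" if c: "c < k" for a b c
  proof -
    have 1: "(\<lambda>j. (1 - \<epsilon> j) * s' a c * K a c b) \<longlonglongrightarrow> (1 - 0) * s' a c * K a c b"
      by (intro tendsto_intros \<epsilon>_lim)
    have "(\<lambda>j. S j a c - (1 - \<epsilon> j) * s' a c) \<longlonglongrightarrow> s' a c - (1 - 0) * s' a c"
      by (intro tendsto_intros \<epsilon>_lim S_lim c)
    then have 2: "(\<lambda>j. if b = x0 a then S j a c - (1 - \<epsilon> j) * s' a c else 0) \<longlonglongrightarrow> 0"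
      by (cases "b = x0 a") simp_all
    from tendsto_add[OF 1 2] have q_lim: "(\<lambda>j. q j a b c) \<longlonglongrightarrow> s' a c * K a c b"
      by (simp add: q_def)
    have 3: "(\<lambda>j. real CARD('xh) / m j) \<longlonglongrightarrow> 0"
      using filterlim_compose[OF const_over_n m(2)] by (simp add: o_def)
    have 4: "\<bar>real (N j a b c) / m j - q j a b c\<bar> \<le> real CARD('xh) / m j" for j
    proof -
      have "\<bar>real (N j a b c) - m j * q j a b c\<bar> \<le> CARD('xh)"
        using round_to(2)[where B="UNIV :: 'xh set" and z="\<lambda>b. m j * q j a b c" and ?b0.0="x0 a", OF _ _ mq_nn[OF c] mq_sum[OF c]] c
        by (simp add: N_def)
      moreover have "real (N j a b c) / m j - q j a b c = (real (N j a b c) - m j * q j a b c) / m j"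
        using m(1)[of j] by (simp add: diff_divide_distrib)
      ultimately show ?thesis
        using divide_right_mono[of "\<bar>real (N j a b c) - m j * q j a b c\<bar>" "CARD('xh)" "real (m j)"]
        by (simp only: abs_divide abs_of_nat of_nat_0_le_iff)
    qed
    have "(\<lambda>j. real (N j a b c) / m j - q j a b c) \<longlonglongrightarrow> 0"
    proof (rule Lim_null_comparison[OF _ 3])
      show "\<forall>\<^sub>F j in sequentially. norm (real (N j a b c) / m j - q j a b c) \<le> real CARD('xh) / m j"
        unfolding real_norm_def by (rule always_eventually) (rule allI, rule 4)
    qed
    from tendsto_add[OF this q_lim] show ?thesis by simp
  qed
  have N0: "N j a b c = 0" if "k \<le> c" for j a b c using that by (simp add: N_def)
  show ?thesis using N0 N_sum N_dist N_lim by (intro exI[of _ N]) blast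
qed

text \<open>Because the marginal of t on (y, v) is Q y V y v, the factor V cancels from the ratio.
  The result identifies the divergence in the objective with the exponent obtained by the method of
  types.\<close>

lemma rel_entropy_type:
  fixes t :: "'x::finite \<Rightarrow> 'y::finite \<Rightarrow> nat \<Rightarrow> real"
  assumes t: "\<And>x y v. v < k \<Longrightarrow> 0 \<le> t x y v" and ac: "\<And>x y v. v < k \<Longrightarrow> 0 < t x y v \<Longrightarrow> 0 < P (x, y)"
    and q: "\<And>x y v. v < k \<Longrightarrow> q x y v = t x y v"
    and J: "\<And>y v. v < k \<Longrightarrow> (\<Sum>x\<in>UNIV. t x y v) = Q y * V y v" and V: "\<And>y. (\<Sum>v<k. V y v) = 1"
  shows "rel_entropy (UNIV \<times> UNIV \<times> {..<k}) (\<lambda>(x, y, v). q x y v) (\<lambda>(x, y, v). P (x, y) * V y v) =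
    ereal (type_divergence P k t)"
proof -
  \<comment> \<open>In the application t is a limit specified only for v < k, whereas
    \<open>type_divergence_eq\<close> needs nonnegativity for all v.\<close>
  define t' where "t' x y v = (if v < k then t x y v else 0)" for x y v
  have td: "type_divergence P k t' = type_divergence P k t"
    unfolding type_divergence_def by (simp add: t'_def cong: sum.cong_simp)
  have t'0: "0 \<le> t' x y v" for x y v by (simp add: t'_def t)
  have Jt': "(\<Sum>x\<in>UNIV. t' x y v) = Q y * V y v" if "v < k" for y v using J[OF that] that by (simp add: t'_def)
  have Qt': "(\<Sum>v<k. \<Sum>x\<in>UNIV. t' x y v) = Q y" for y
    by (simp add: Jt' sum_distrib_left[symmetric] V)
  have V_nz: "V y v \<noteq> 0 \<and> Q y \<noteq> 0" if "v < k" "0 < t x y v" for x y v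
  proof -
    have "0 < (\<Sum>x\<in>UNIV. t' x y v)" by (rule joint_marginals_pos(1)[of t', OF t'0 that(1)]) (use that in \<open>auto simp: t'_def\<close>)
    then show ?thesis using Jt'[OF that(1)] by auto
  qed
  have "\<not> (\<exists>a\<in>UNIV \<times> UNIV \<times> {..<k}. (case a of (x, y, v) \<Rightarrow> q x y v) > 0 \<and> (case a of (x, y, v) \<Rightarrow> P (x, y) * V y v) = 0)"
  proof
    assume "\<exists>a\<in>UNIV \<times> UNIV \<times> {..<k}. (case a of (x, y, v) \<Rightarrow> q x y v) > 0 \<and> (case a of (x, y, v) \<Rightarrow> P (x, y) * V y v) = 0"
    then obtain x y v where v: "v < k" "0 < q x y v" "P (x, y) * V y v = 0" by auto
    then have "0 < t x y v" using q by simp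
    then show False using v(3) ac[OF v(1)] V_nz[OF v(1)] by fastforce
  qed
  then have "rel_entropy (UNIV \<times> UNIV \<times> {..<k}) (\<lambda>(x, y, v). q x y v) (\<lambda>(x, y, v). P (x, y) * V y v) =
    ereal (\<Sum>a\<in>UNIV \<times> UNIV \<times> {..<k}. if (case a of (x, y, v) \<Rightarrow> q x y v) = 0 then 0 else
      (case a of (x, y, v) \<Rightarrow> q x y v) * log 2 ((case a of (x, y, v) \<Rightarrow> q x y v) / (case a of (x, y, v) \<Rightarrow> P (x, y) * V y v)))"
    unfolding rel_entropy_def by (rule if_not_P)
  also have "(\<Sum>a\<in>UNIV \<times> UNIV \<times> {..<k}. if (case a of (x, y, v) \<Rightarrow> q x y v) = 0 then 0 else
      (case a of (x, y, v) \<Rightarrow> q x y v) * log 2 ((case a of (x, y, v) \<Rightarrow> q x y v) / (case a of (x, y, v) \<Rightarrow> P (x, y) * V y v))) =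
    (\<Sum>x\<in>UNIV. \<Sum>y\<in>UNIV. \<Sum>v<k. if q x y v = 0 then 0 else q x y v * log 2 (q x y v / (P (x, y) * V y v)))"
    by (simp add: sum.cartesian_product' cong: if_cong)
  also have "\<dots> = (\<Sum>x\<in>UNIV. \<Sum>y\<in>UNIV. \<Sum>v<k. t' x y v *
      log 2 ((\<Sum>v<k. \<Sum>x\<in>UNIV. t' x y v) * (t' x y v / (\<Sum>x\<in>UNIV. t' x y v)) / P (x, y)))"
  proof (intro sum.cong refl)
    fix x y v assume "v \<in> {..<k}"
    then have v: "v < k" by simp
    show "(if q x y v = 0 then 0 else q x y v * log 2 (q x y v / (P (x, y) * V y v))) = t' x y v *
      log 2 ((\<Sum>v<k. \<Sum>x\<in>UNIV. t' x y v) * (t' x y v / (\<Sum>x\<in>UNIV. t' x y v)) / P (x, y))"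
    proof (cases "t x y v = 0")
      case True
      then show ?thesis using q[OF v] v by (simp add: t'_def)
    next
      case False
      then have pos: "0 < t x y v" using t[OF v, of x y] by simp
      have "Q y * (t x y v / (Q y * V y v)) / P (x, y) = t x y v / (P (x, y) * V y v)"
        using V_nz[OF v pos] ac[OF v pos] by (simp add: field_simps)
      then show ?thesis unfolding Qt' Jt'[OF v] using False v by (simp add: q[OF v] t'_def)
    qed
  qed
  also have "\<dots> = type_divergence P k t'"
    by (rule type_divergence_eq[OF t'0]) (use ac in \<open>auto simp: t'_def split: if_splits\<close>)
  finally show ?thesis by (simp add: td)
qed

text \<open>One n0 has to serve all types of y, although k and V depend on \<open>QY\<close> and k
  is unbounded as \<open>QY\<close> varies. Arguing by contradiction avoids any uniform choice: the
  pair (k, V) belonging to the limit of the failing types is used along the whole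
  subsequence.\<close>

lemma type_achievability:
  fixes P :: "'x::finite \<times> 'y::finite \<Rightarrow> real" and d :: "'x \<Rightarrow> 'xh::finite \<Rightarrow> real"
  assumes P: "\<And>z. 0 \<le> P z" and R: "0 \<le> R" and rho: "0 < \<rho>"
    and feas: "\<And>n (x :: 'x list). 1 \<le> n \<Longrightarrow> length x = n \<Longrightarrow> \<exists>xh. length xh = n \<and> dbar d x xh \<le> D"
    and x0: "\<And>x b. d x (x0 x) \<le> d x b" "\<And>x. d x (x0 x) \<le> D"
    and good: "\<And>QY. pmf_on UNIV QY \<Longrightarrow> \<exists>k V c'. 1 \<le> k \<and> (\<forall>y. pmf_on {..<k} (V y)) \<and>
      mutual_info UNIV {..<k} (\<lambda>y u. QY y * V y u) \<le> R \<and> c' < c \<and>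
      (\<forall>W. (\<forall>y. \<forall>u\<in>{..<k}. pmf_on UNIV (W y u)) \<longrightarrow>
        guess_exponent P d D \<rho> QY k V W \<le> ereal c')"
  shows "\<exists>n0. \<forall>n\<ge>n0. \<forall>yl :: 'y list. length yl = n \<longrightarrow> (\<exists>f g. is_helper n R f \<and> is_guessing_strategy n R g \<and>
    (\<Sum>(x, y)\<in>{(x, y). length x = n \<and> length y = n \<and> count_list y = count_list yl}.
        (\<Prod>i<n. P (x ! i, y ! i)) * real (num_guesses d D g x (f y)) powr \<rho>) \<le> 2 powr (n * c))"
proof (rule ccontr)
  define mom where "mom n yl f g = (\<Sum>(x, y)\<in>{(x, y). length x = n \<and> length y = n \<and> count_list y = count_list yl}.
        (\<Prod>i<n. P (x ! i, y ! i)) * real (num_guesses d D g x (f y)) powr \<rho>)" for n and yl :: "'y list" and f g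
  assume "\<not> ?thesis"
  \<comment> \<open>\<open>Suc j\<close> makes the blocklengths positive and forces them to
    infinity.\<close>
  then have "\<forall>j. \<exists>n yl. Suc j \<le> n \<and> length yl = n \<and> (\<forall>f g. is_helper n R f \<longrightarrow> is_guessing_strategy n R g \<longrightarrow> 2 powr (n * c) < mom n yl f g)"
    unfolding mom_def by (meson not_less)
  then obtain n0 yl0 where n0: "\<And>j. Suc j \<le> n0 j" and yl0: "\<And>j. length (yl0 j) = n0 j"
    and bad0: "\<And>j f g. is_helper (n0 j) R f \<Longrightarrow> is_guessing_strategy (n0 j) R g \<Longrightarrow> 2 powr (n0 j * c) < mom (n0 j) (yl0 j) f g"
    by metis
  have cnt_le: "\<bar>real (count_list (yl0 j) y) / n0 j\<bar> \<le> 1" for j y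
    using count_le_length[of "yl0 j" y] n0[of j] by (simp add: yl0)
  obtain r QY where r: "strict_mono r" "\<And>y. (\<lambda>j. real (count_list (yl0 (r j)) y) / n0 (r j)) \<longlonglongrightarrow> QY y"
    using bounded_fun_subseq[of "UNIV :: 'y set" "\<lambda>j y. real (count_list (yl0 j) y) / n0 j" 1, OF finite cnt_le]
    by blast
  define n1 where "n1 j = n0 (r j)" for j
  define yl where "yl j = yl0 (r j)" for j
  have n1: "Suc j \<le> n1 j" for j
    using n0[of "r j"] strict_mono_imp_increasing[OF r(1), of j] by (simp add: n1_def)
  have n1_pos: "1 \<le> n1 j" for j using n1[of j] by simp
  have yl: "length (yl j) = n1 j" for j by (simp add: yl_def n1_def yl0)
  have QY_lim: "(\<lambda>j. real (count_list (yl j) y) / n1 j) \<longlonglongrightarrow> QY y" for y using r(2) by (simp add: yl_def n1_def)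
  have bad: "2 powr (n1 j * c) < mom (n1 j) (yl j) f g" if "is_helper (n1 j) R f" "is_guessing_strategy (n1 j) R g" for j f g
    using bad0 that by (simp add: n1_def yl_def)
  have cnt_sum: "(\<Sum>y\<in>UNIV. count_list (yl j) y) = n1 j" for j
    using sum_count_set[of "yl j" UNIV] by (simp add: yl)
  have QY_nn: "0 \<le> QY y" for y using QY_lim[of y] by (rule LIMSEQ_le_const) auto
  have "(\<lambda>j. \<Sum>y\<in>UNIV. real (count_list (yl j) y) / n1 j) \<longlonglongrightarrow> (\<Sum>y\<in>UNIV. QY y)"
    by (intro tendsto_sum QY_lim)
  moreover have "(\<Sum>y\<in>UNIV. real (count_list (yl j) y) / n1 j) = 1" for j
    using n1_pos[of j] by (simp add: sum_divide_distrib[symmetric] of_nat_sum[symmetric] cnt_sum del: of_nat_sum)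
  ultimately have "(\<Sum>y\<in>UNIV. QY y) = 1" by (simp add: LIMSEQ_const_iff)
  then have QY: "pmf_on UNIV QY" by (simp add: pmf_on_def QY_nn)
  obtain k V c' where k: "1 \<le> k" and V: "\<And>y. pmf_on {..<k} (V y)"
    and MI: "mutual_info UNIV {..<k} (\<lambda>y u. QY y * V y u) \<le> R" and c': "c' < c"
    and obj: "\<And>W. (\<forall>y. \<forall>u\<in>{..<k}. pmf_on UNIV (W y u)) \<Longrightarrow>
        guess_exponent P d D \<rho> QY k V W \<le> ereal c'"
    using good[OF QY] by blast
  have V_nn: "0 \<le> V y v" and V_sum: "(\<Sum>v<k. V y v) = 1" for y v using V[of y] by (auto simp: pmf_on_def)
  \<comment> \<open>Integer counts approximating the type of y times V. The marginal on y must be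
    exact, since the codebook is for that very type; the rounding excess goes to the letter
    0.\<close>
  define J where "J j y v = (if v < k then round_to {..<k} 0 (count_list (yl j) y) (\<lambda>v. count_list (yl j) y * V y v) v else 0)" for j y v
  have J_mass: "(\<Sum>v<k. count_list (yl j) y * V y v) = real (count_list (yl j) y)" for j y
    by (simp add: sum_distrib_left[symmetric] V_sum)
  have J_sum: "(\<Sum>v<k. J j y v) = count_list (yl j) y" for j y
    using round_to(1)[where B="{..<k}" and ?b0.0=0 and z="\<lambda>v. count_list (yl j) y * V y v", OF _ _ _ J_mass] k V_nn
    by (simp add: J_def cong: sum.cong_simp)
  have J_lim: "(\<lambda>j. real (J j y v) / n1 j) \<longlonglongrightarrow> QY y * V y v" if v: "v < k" for y v
  proof -
    have n1_inf: "filterlim n1 at_top sequentially"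
      by (rule filterlim_at_top_mono[OF filterlim_Suc]) (simp add: n1)
    have 1: "(\<lambda>j. real k / n1 j) \<longlonglongrightarrow> 0"
      using filterlim_compose[OF const_over_n n1_inf] by (simp add: o_def)
    have 2: "\<bar>real (J j y v) / n1 j - real (count_list (yl j) y) / n1 j * V y v\<bar> \<le> real k / n1 j" for j
    proof -
      have "\<bar>real (J j y v) - count_list (yl j) y * V y v\<bar> \<le> k"
        using round_to(2)[where B="{..<k}" and ?b0.0=0 and z="\<lambda>v. count_list (yl j) y * V y v" and b=v, OF _ _ _ J_mass] k V_nn v
        by (simp add: J_def)
      moreover have "real (J j y v) / n1 j - real (count_list (yl j) y) / n1 j * V y v = (real (J j y v) - count_list (yl j) y * V y v) / n1 j"
        by (simp add: diff_divide_distrib)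
      ultimately show ?thesis
        using divide_right_mono[of "\<bar>real (J j y v) - count_list (yl j) y * V y v\<bar>" k "real (n1 j)"]
        by (simp only: abs_divide abs_of_nat of_nat_0_le_iff)
    qed
    have 3: "(\<lambda>j. real (J j y v) / n1 j - real (count_list (yl j) y) / n1 j * V y v) \<longlonglongrightarrow> 0"
    proof (rule Lim_null_comparison[OF _ 1])
      show "\<forall>\<^sub>F j in sequentially. norm (real (J j y v) / n1 j - real (count_list (yl j) y) / n1 j * V y v) \<le> real k / n1 j"
        unfolding real_norm_def by (rule always_eventually) (rule allI, rule 2)
    qed
    from tendsto_add[OF 3 tendsto_mult_right[OF QY_lim[of y], of "V y v"]] show ?thesis by simp
  qed
  have J0: "J j y v = 0" if "k \<le> v" for j y v using that by (simp add: J_def)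
  define joint where "joint j t \<longleftrightarrow> (\<forall>y v. (\<Sum>x\<in>UNIV. t x y v) = J j y v) \<and>
    (\<forall>x y v. 0 < t x y v \<longrightarrow> 0 < P (x, y)) \<and> (\<Sum>x\<in>UNIV. \<Sum>y\<in>UNIV. \<Sum>v<k. t x y v) = n1 j \<and>
    (\<forall>N. (\<forall>a b c. k \<le> c \<longrightarrow> N a b c = 0) \<longrightarrow> (\<forall>a c. (\<Sum>b\<in>UNIV. N a b c) = (\<Sum>y\<in>UNIV. t a y c)) \<longrightarrow>
      (\<Sum>a\<in>UNIV. \<Sum>b\<in>UNIV. \<Sum>c<k. real (N a b c) * d a b) \<le> n1 j * D \<longrightarrow>
      log 2 (2 powr (n1 j * c)) \<le> \<rho> * (n1 j * cond_mutual_info UNIV UNIV {..<k} (\<lambda>a b c. real (N a b c) / n1 j) +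
          max 0 (n1 j * cond_mutual_info UNIV {..<k} {()} (\<lambda>y v _. real (J j y v) / n1 j) - n1 j * R))
        - n1 j * type_divergence P k (\<lambda>x y v. real (t x y v) / n1 j)
        + block_overhead CARD('x) CARD('y) CARD('xh) k \<rho> (n1 j))" for j and t :: "'x \<Rightarrow> 'y \<Rightarrow> nat \<Rightarrow> nat"
  have "\<exists>t. joint j t" for j
    unfolding joint_def
    by (rule block_bound[OF P R rho n1_pos _ feas[OF n1_pos] J0])
      (simp, assumption, assumption, unfold J_sum, rule bad[unfolded mom_def])
  then obtain t where t: "\<And>j. joint j (t j)" by metis
  have tJ: "\<And>j y v. (\<Sum>x\<in>UNIV. t j x y v) = J j y v"
    using t unfolding joint_def by blast
  have tP: "\<And>j x y v. 0 < t j x y v \<Longrightarrow> 0 < P (x, y)" and t_sum: "\<And>j. (\<Sum>x\<in>UNIV. \<Sum>y\<in>UNIV. \<Sum>v<k. t j x y v) = n1 j"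
    using t unfolding joint_def by blast+
  have t_bound: "\<And>j N. (\<forall>a b c. k \<le> c \<longrightarrow> N a b c = 0) \<Longrightarrow> (\<forall>a c. (\<Sum>b\<in>UNIV. N a b c) = (\<Sum>y\<in>UNIV. t j a y c)) \<Longrightarrow>
      (\<Sum>a\<in>UNIV. \<Sum>b\<in>UNIV. \<Sum>c<k. real (N a b c) * d a b) \<le> n1 j * D \<Longrightarrow>
      log 2 (2 powr (n1 j * c)) \<le> \<rho> * (n1 j * cond_mutual_info UNIV UNIV {..<k} (\<lambda>a b c. real (N a b c) / n1 j) +
          max 0 (n1 j * cond_mutual_info UNIV {..<k} {()} (\<lambda>y v _. real (J j y v) / n1 j) - n1 j * R))
        - n1 j * type_divergence P k (\<lambda>x y v. real (t j x y v) / n1 j)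
        + block_overhead CARD('x) CARD('y) CARD('xh) k \<rho> (n1 j)"
    using t unfolding joint_def by blast
  have t0: "t j x y v = 0" if "k \<le> v" for j x y v
    using tJ[of j y v] J0[OF that] by simp
  have t_le: "t j x y v \<le> n1 j" for j x y v
  proof (cases "v < k")
    case True
    have "t j x y v \<le> (\<Sum>v<k. t j x y v)" by (rule member_le_sum[of v "{..<k}" "t j x y"]) (use True in auto)
    also have "\<dots> \<le> (\<Sum>y\<in>UNIV. \<Sum>v<k. t j x y v)" by (rule member_le_sum[of y UNIV "\<lambda>y. \<Sum>v<k. t j x y v"]) auto
    also have "\<dots> \<le> (\<Sum>x\<in>UNIV. \<Sum>y\<in>UNIV. \<Sum>v<k. t j x y v)" by (rule member_le_sum[of x UNIV "\<lambda>x. \<Sum>y\<in>UNIV. \<Sum>v<k. t j x y v"]) auto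
    finally show ?thesis by (simp add: t_sum)
  qed (simp add: t0)
  have t_le1: "\<bar>real (t j (fst z) (fst (snd z)) (snd (snd z))) / n1 j\<bar> \<le> 1" for j z
    using t_le[of j "fst z" "fst (snd z)" "snd (snd z)"] n1_pos[of j] by simp
  have finZ: "finite ((UNIV :: 'x set) \<times> (UNIV :: 'y set) \<times> {..<k})" by simp
  obtain s T0 where s: "strict_mono s" and T0: "\<And>z. z \<in> (UNIV :: 'x set) \<times> (UNIV :: 'y set) \<times> {..<k} \<Longrightarrow>
      (\<lambda>j. real (t (s j) (fst z) (fst (snd z)) (snd (snd z))) / n1 (s j)) \<longlonglongrightarrow> T0 z"
    using bounded_fun_subseq[of "(UNIV :: 'x set) \<times> (UNIV :: 'y set) \<times> {..<k}" "\<lambda>j z. real (t j (fst z) (fst (snd z)) (snd (snd z))) / n1 j" 1, OF finZ t_le1]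
    by blast
  define m where "m j = n1 (s j)" for j
  define T where "T x y v = T0 (x, y, v)" for x y v
  have m1: "1 \<le> m j" for j by (simp add: m_def n1_pos[simplified])
  have m_inf: "filterlim m at_top sequentially"
  proof (rule filterlim_at_top_mono[OF filterlim_Suc], rule always_eventually, rule allI)
    fix j show "Suc j \<le> m j" using n1[of "s j"] strict_mono_imp_increasing[OF s, of j] by (simp add: m_def)
  qed
  have T_lim: "(\<lambda>j. real (t (s j) x y v) / m j) \<longlonglongrightarrow> T x y v" if "v < k" for x y v
    using T0[of "(x, y, v)"] that by (simp add: m_def T_def)
  have T_nn: "0 \<le> T x y v" if "v < k" for x y v using T_lim[OF that, of x y] by (rule LIMSEQ_le_const) auto
  have T_P: "0 < P (x, y)" if "v < k" "0 < T x y v" for x y v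
  proof (rule ccontr)
    assume "\<not> 0 < P (x, y)"
    then have "t (s j) x y v = 0" for j using tP[of "s j" x y v] by auto
    then show False using T_lim[OF that(1), of x y] that(2) by (simp add: LIMSEQ_const_iff)
  qed
  have JT: "(\<lambda>j. real (J (s j) y v) / m j) \<longlonglongrightarrow> QY y * V y v" if "v < k" for y v
    using LIMSEQ_subseq_LIMSEQ[OF J_lim[OF that] s] by (simp add: m_def o_def)
  have TJ: "(\<Sum>x\<in>UNIV. T x y v) = QY y * V y v" if "v < k" for y v
  proof (rule LIMSEQ_unique)
    show "(\<lambda>j. \<Sum>x\<in>UNIV. real (t (s j) x y v) / m j) \<longlonglongrightarrow> (\<Sum>x\<in>UNIV. T x y v)"
      by (intro tendsto_sum T_lim that)
    have "(\<Sum>x\<in>UNIV. real (t (s j) x y v) / m j) = real (J (s j) y v) / m j" for j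
      by (simp add: sum_divide_distrib[symmetric] tJ[symmetric])
    then show "(\<lambda>j. \<Sum>x\<in>UNIV. real (t (s j) x y v) / m j) \<longlonglongrightarrow> QY y * V y v"
      using JT[OF that] by simp
  qed
  \<comment> \<open>The channel from (y, v) to x in the limiting joint type, at which the assumed
    bound on the exponent is evaluated. On pairs of mass zero any PMF will do, since
    \<open>T\<close> vanishes there too.\<close>
  define W where "W y v x = (if QY y * V y v = 0 then if x = undefined then 1 else 0 else T x y v / (QY y * V y v))" for y v x
  have W_pmf: "pmf_on UNIV (W y v)" if v: "v < k" for y v
  proof (cases "QY y * V y v = 0")
    case True
    then show ?thesis unfolding pmf_on_def by (auto simp: W_def)
  next
    case False
    then show ?thesis using TJ[OF v, of y] T_nn[OF v] QY_nn[of y] V_nn[of y v]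
      by (auto simp: pmf_on_def W_def sum_divide_distrib[symmetric])
  qed
  have W: "QY y * V y v * W y v x = T x y v" if v: "v < k" for x y v
  proof (cases "QY y * V y v = 0")
    case True
    have "T x y v \<le> (\<Sum>x\<in>UNIV. T x y v)" by (rule member_le_sum[of x UNIV "\<lambda>x. T x y v"]) (auto simp: T_nn v)
    then show ?thesis using True TJ[OF v, of y] T_nn[OF v, of x y] by simp
  qed (simp add: W_def)
  define S where "S x v = (\<Sum>y\<in>UNIV. QY y * V y v * W y v x)" for x v
  have S: "S x v = (\<Sum>y\<in>UNIV. T x y v)" if "v < k" for x v by (simp add: S_def W that)
  let ?td = "type_divergence P k T"
  have "ereal \<rho> * cond_rd d D {..<k} S - ereal ?td \<le> ereal c'"
    using obj[of W] W_pmf rel_entropy_type[where t=T and q="\<lambda>x y v. QY y * V y v * W y v x" and V=V and Q=QY and P=P and k=k, OF T_nn T_P W TJ V_sum]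
    by (simp add: guess_exponent_def S_def[abs_def])
  \<comment> \<open>The gap between c' and c makes this strict, so an admissible \<open>K\<close>
    with information below the right-hand side can be taken from the infimum, whether or not it is
    attained.\<close>
  have "cond_rd d D {..<k} S < ereal ((c + ?td) / \<rho>)"
  proof (rule ccontr)
    assume "\<not> ?thesis"
    then have "ereal ((c + ?td) / \<rho>) \<le> cond_rd d D {..<k} S" by simp
    then have "ereal \<rho> * ereal ((c + ?td) / \<rho>) \<le> ereal \<rho> * cond_rd d D {..<k} S"
      using rho by (intro ereal_mult_left_mono) auto
    then have "ereal (c + ?td) - ereal ?td \<le> ereal \<rho> * cond_rd d D {..<k} S - ereal ?td"
      using rho by (intro ereal_minus_mono) auto
    then have "ereal c \<le> ereal \<rho> * cond_rd d D {..<k} S - ereal ?td" by simp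
    also note \<open>ereal \<rho> * cond_rd d D {..<k} S - ereal ?td \<le> ereal c'\<close>
    finally show False using c' by simp
  qed
  then obtain K :: "'x \<Rightarrow> nat \<Rightarrow> 'xh \<Rightarrow> real" where K: "\<And>x v. v < k \<Longrightarrow> pmf_on UNIV (K x v)"
    and K_dist: "(\<Sum>x\<in>UNIV. \<Sum>v<k. \<Sum>b\<in>UNIV. S x v * K x v b * d x b) \<le> D"
    and K_info: "cond_mutual_info UNIV UNIV {..<k} (\<lambda>x b v. S x v * K x v b) < (c + ?td) / \<rho>"
    unfolding cond_rd_def INF_less_iff by auto
  define sc where "sc j x v = (\<Sum>y\<in>UNIV. t (s j) x y v)" for j x v
  have sc_sum: "(\<Sum>x\<in>UNIV. \<Sum>v<k. sc j x v) = m j" for j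
  proof -
    have "(\<Sum>x\<in>UNIV. \<Sum>v<k. sc j x v) = (\<Sum>x\<in>UNIV. \<Sum>y\<in>UNIV. \<Sum>v<k. t (s j) x y v)"
      unfolding sc_def by (intro sum.cong refl) (rule sum.swap)
    then show ?thesis by (simp add: t_sum m_def)
  qed
  have sc_lim: "(\<lambda>j. real (sc j x v) / m j) \<longlonglongrightarrow> S x v" if "v < k" for x v
    unfolding S[OF that] sc_def of_nat_sum sum_divide_distrib by (intro tendsto_sum T_lim that)
  obtain N where N0: "\<And>j. \<forall>a b c. k \<le> c \<longrightarrow> N j a b c = 0" and N_sum: "\<And>j a c. c < k \<Longrightarrow> (\<Sum>b\<in>UNIV. N j a b c) = sc j a c"
    and N_dist: "\<And>j. (\<Sum>a\<in>UNIV. \<Sum>b\<in>UNIV. \<Sum>c<k. real (N j a b c) * d a b) \<le> m j * D"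
    and N_lim: "\<And>a b c. c < k \<Longrightarrow> (\<lambda>j. real (N j a b c) / m j) \<longlonglongrightarrow> S a c * K a c b"
    using rate_distortion_types[OF m1 m_inf sc_sum sc_lim K K_dist x0] by blast
  let ?I = "\<lambda>j. cond_mutual_info UNIV UNIV {..<k} (\<lambda>a b c. real (N j a b c) / m j)"
  let ?Iu = "\<lambda>j. cond_mutual_info UNIV {..<k} {()} (\<lambda>y v _. real (J (s j) y v) / m j)"
  let ?td' = "\<lambda>j. type_divergence P k (\<lambda>x y v. real (t (s j) x y v) / m j)"
  let ?bo = "\<lambda>j. block_overhead CARD('x) CARD('y) CARD('xh) k \<rho> (m j) / m j"
  have bound: "c \<le> \<rho> * (?I j + max 0 (?Iu j - R)) - ?td' j + ?bo j" for j
  proof -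
    have "\<forall>a c. (\<Sum>b\<in>UNIV. N j a b c) = (\<Sum>y\<in>UNIV. t (s j) a y c)"
    proof (intro allI)
      fix a c show "(\<Sum>b\<in>UNIV. N j a b c) = (\<Sum>y\<in>UNIV. t (s j) a y c)"
        using N_sum[of c j a] N0[of j] t0 by (cases "c < k") (auto simp: sc_def)
    qed
    from t_bound[of "N j" "s j", OF N0 this] N_dist[of j]
    have "m j * c \<le> \<rho> * (m j * ?I j + max 0 (m j * ?Iu j - m j * R)) - m j * ?td' j + m j * ?bo j"
      using m1[of j] by (simp add: m_def)
    also have "max 0 (m j * ?Iu j - m j * R) = m j * max 0 (?Iu j - R)"
      by (simp add: max_mult_distrib_left right_diff_distrib)
    finally have "m j * c \<le> m j * (\<rho> * (?I j + max 0 (?Iu j - R)) - ?td' j + ?bo j)"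
      by (simp only: distrib_left right_diff_distrib mult.left_commute)
    then show ?thesis using m1[of j] by simp
  qed
  have I_lim: "?I \<longlonglongrightarrow> cond_mutual_info UNIV UNIV {..<k} (\<lambda>x b v. S x v * K x v b)"
    by (rule cond_mutual_info_tendsto) (use N_lim in auto)
  have Iu_lim: "?Iu \<longlonglongrightarrow> cond_mutual_info UNIV {..<k} {()} (\<lambda>y v _. QY y * V y v)"
    by (rule cond_mutual_info_tendsto) (use JT in auto)
  have mi: "cond_mutual_info UNIV {..<k} {()} (\<lambda>y v _. QY y * V y v) \<le> R"
    using MI mutual_info_eq_cond[of UNIV "{..<k}" "\<lambda>y v. QY y * V y v" "()"] QY
    by (simp add: sum_distrib_left[symmetric] V_sum pmf_on_def)
  have td_lim: "?td' \<longlonglongrightarrow> ?td"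
    by (rule type_divergence_tendsto) (use T_lim in auto)
  have bo_lim: "?bo \<longlonglongrightarrow> 0"
    using filterlim_compose[OF block_overhead_tendsto m_inf, of "CARD('x)" "CARD('y)"] by (simp add: o_def Suc_le_eq)
  \<comment> \<open>The excess rate tends to the positive part of I(Y;U) - R, which is zero because
    V satisfies the rate constraint for the limiting type.\<close>
  have "(\<lambda>j. \<rho> * (?I j + max 0 (?Iu j - R)) - ?td' j + ?bo j) \<longlonglongrightarrow>
    \<rho> * (cond_mutual_info UNIV UNIV {..<k} (\<lambda>x b v. S x v * K x v b) +
      max 0 (cond_mutual_info UNIV {..<k} {()} (\<lambda>y v _. QY y * V y v) - R)) - ?td + 0"
    by (intro tendsto_intros tendsto_max I_lim Iu_lim td_lim bo_lim)
  then have "c \<le> \<rho> * (cond_mutual_info UNIV UNIV {..<k} (\<lambda>x b v. S x v * K x v b) +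
      max 0 (cond_mutual_info UNIV {..<k} {()} (\<lambda>y v _. QY y * V y v) - R)) - ?td + 0"
    by (rule LIMSEQ_le_const) (use bound in auto)
  then have "c + ?td \<le> \<rho> * cond_mutual_info UNIV UNIV {..<k} (\<lambda>x b v. S x v * K x v b)"
    using mi by simp
  with K_info rho show False by (simp add: less_divide_eq mult.commute)
qed

section \<open>From single types to the whole block, and the limit\<close>

text \<open>The helper applies the code of the actual type of y without revealing the type; the
  guesser merges the lists of all types. The number of types enters to the power \<rho> through the
  longer list and once more through the sum over types, whence the exponent 1 + \<rho>.\<close>

lemma combine_types:
  fixes P :: "'x::finite \<times> 'y::finite \<Rightarrow> real" and d :: "'x \<Rightarrow> 'xh::finite \<Rightarrow> real"
  assumes P: "\<And>z. 0 \<le> P z" and rho: "0 < \<rho>"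
    and feas: "\<And>x :: 'x list. length x = n \<Longrightarrow> \<exists>xh. length xh = n \<and> dbar d x xh \<le> D"
    and codes: "\<And>yl :: 'y list. length yl = n \<Longrightarrow> \<exists>f g. is_helper n R f \<and> is_guessing_strategy n R g \<and>
      (\<Sum>(x, y)\<in>{(x, y). length x = n \<and> length y = n \<and> count_list y = count_list yl}.
        (\<Prod>i<n. P (x ! i, y ! i)) * real (num_guesses d D g x (f y)) powr \<rho>) \<le> X"
    and X: "0 \<le> X"
  shows "\<exists>f g. is_helper n R f \<and> is_guessing_strategy n R g \<and>
    guess_moment P d D \<rho> n f g \<le> ((real n + 1) ^ CARD('y)) powr (1 + \<rho>) * X"
proof -
  define \<T> where "\<T> = count_list ` {y :: 'y list. length y = n}"
  have "{zs :: 'y list. length zs = n \<and> set zs \<subseteq> UNIV} = {y. length y = n}" by simp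
  then have fin\<T>: "finite \<T>" and card\<T>: "card \<T> \<le> (n + 1) ^ CARD('y)"
    using card_types_le[of "UNIV :: 'y set" n] by (simp_all add: \<T>_def)
  let ?mom = "\<lambda>t f g. \<Sum>(x, y)\<in>{(x, y). length x = n \<and> length y = n \<and> count_list y = t}.
        (\<Prod>i<n. P (x ! i, y ! i)) * real (num_guesses d D g x (f y)) powr \<rho>"
  have "\<forall>t\<in>\<T>. \<exists>fg. is_helper n R (fst fg) \<and> is_guessing_strategy n R (snd fg) \<and> ?mom t (fst fg) (snd fg) \<le> X"
  proof
    fix t assume "t \<in> \<T>"
    then obtain y :: "'y list" where y: "length y = n" "t = count_list y" by (auto simp: \<T>_def)
    obtain f g where "is_helper n R f" "is_guessing_strategy n R g" "?mom t f g \<le> X"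
      using codes[OF y(1)] unfolding y(2) by blast
    then show "\<exists>fg. is_helper n R (fst fg) \<and> is_guessing_strategy n R (snd fg) \<and> ?mom t (fst fg) (snd fg) \<le> X"
      by (intro exI[of _ "(f, g)"]) (simp only: fst_conv snd_conv simp_thms)
  qed
  from bchoice[OF this] obtain fg where fg: "\<forall>t\<in>\<T>. is_helper n R (fst (fg t)) \<and> is_guessing_strategy n R (snd (fg t)) \<and> ?mom t (fst (fg t)) (snd (fg t)) \<le> X" ..
  define fs where "fs t = fst (fg t)" for t
  define gs where "gs t = snd (fg t)" for t
  have fs: "is_helper n R (fs t)" and gs: "is_guessing_strategy n R (gs t)" and mom: "?mom t (fs t) (gs t) \<le> X" if "t \<in> \<T>" for t
    using fg that by (auto simp: fs_def gs_def)
  define f where "f y = fs (count_list y) y" for y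
  have f: "is_helper n R f" using fs by (auto simp: is_helper_def f_def \<T>_def)
  let ?N = "CARD('xh) ^ n" and ?\<Omega> = "{xh :: 'xh list. length xh = n}"
  \<comment> \<open>The earliest position of a word in any of the lists for m; at most
    \<open>card \<T> * t\<close> words have position at most t.\<close>
  define c where "c m xh = (LEAST i. i \<in> {1..?N} \<and> (\<exists>t\<in>\<T>. gs t m i = xh))" for m xh
  have gs_bij: "bij_betw (gs t m) {1..?N} ?\<Omega>" if "t \<in> \<T>" "m < num_desc n R" for t m
    using gs[OF that(1)] that(2) by (simp add: is_guessing_strategy_def)
  have "replicate n undefined \<in> {y :: 'y list. length y = n}" by simp
  then have \<T>_ne: "\<T> \<noteq> {}" unfolding \<T>_def by blast
  have order: "\<exists>g. bij_betw g {1..card ?\<Omega>} ?\<Omega> \<and> (\<forall>i\<in>{1..card ?\<Omega>}. i \<le> card \<T> * c m (g i))" if m: "m < num_desc n R" for m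
  proof (rule ex_ordering)
    show "finite ?\<Omega>" by (rule finite_lists_UNIV)
    fix \<tau>
    have "{\<omega> \<in> ?\<Omega>. c m \<omega> \<le> \<tau>} \<subseteq> (\<Union>t\<in>\<T>. gs t m ` {1..\<tau>})"
    proof
      fix \<omega> assume \<omega>: "\<omega> \<in> {\<omega> \<in> ?\<Omega>. c m \<omega> \<le> \<tau>}"
      obtain t where t: "t \<in> \<T>" using \<T>_ne by blast
      then have "\<omega> \<in> gs t m ` {1..?N}" using \<omega> gs_bij[OF t m] by (simp add: bij_betw_imp_surj_on)
      then have "\<exists>i. i \<in> {1..?N} \<and> (\<exists>t\<in>\<T>. gs t m i = \<omega>)" using t by blast
      then have "c m \<omega> \<in> {1..?N} \<and> (\<exists>t\<in>\<T>. gs t m (c m \<omega>) = \<omega>)" unfolding c_def by (rule LeastI_ex)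
      then show "\<omega> \<in> (\<Union>t\<in>\<T>. gs t m ` {1..\<tau>})" using \<omega> by force
    qed
    then have "card {\<omega> \<in> ?\<Omega>. c m \<omega> \<le> \<tau>} \<le> card (\<Union>t\<in>\<T>. gs t m ` {1..\<tau>})"
      by (rule card_mono[rotated]) (use fin\<T> in auto)
    also have "\<dots> \<le> (\<Sum>t\<in>\<T>. card (gs t m ` {1..\<tau>}))" by (rule card_UN_le[OF fin\<T>])
    also have "\<dots> \<le> (\<Sum>t\<in>\<T>. \<tau>)" by (rule sum_mono) (metis card_atLeastAtMost card_image_le diff_Suc_1 finite_atLeastAtMost)
    finally show "card {\<omega> \<in> ?\<Omega>. c m \<omega> \<le> \<tau>} \<le> card \<T> * \<tau>" by simp
  qed
  then have "\<forall>m\<in>{..<num_desc n R}. \<exists>g. bij_betw g {1..?N} ?\<Omega> \<and> (\<forall>i\<in>{1..?N}. i \<le> card \<T> * c m (g i))"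
    unfolding card_lists_UNIV by blast
  from bchoice[OF this] obtain g where g: "\<forall>m\<in>{..<num_desc n R}. bij_betw (g m) {1..?N} ?\<Omega> \<and> (\<forall>i\<in>{1..?N}. i \<le> card \<T> * c m (g m i))" ..
  then have strat: "is_guessing_strategy n R g" by (simp add: is_guessing_strategy_def)
  have G: "num_guesses d D g x (f y) \<le> card \<T> * num_guesses d D (gs (count_list y)) x (fs (count_list y) y)"
    if x: "length x = n" and y: "length y = n" for x y
  proof -
    let ?t = "count_list y" and ?i = "num_guesses d D (gs (count_list y)) x (fs (count_list y) y)"
    have t: "?t \<in> \<T>" using y by (simp add: \<T>_def)
    have m: "f y < num_desc n R" using f y by (simp add: is_helper_def)
    obtain xh :: "'xh list" where xh: "length xh = n" "dbar d x xh \<le> D" using feas[OF x] by blast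
    note i = num_guesses_spec[OF gs[OF t] m xh, folded f_def, unfolded f_def]
    let ?xh = "gs ?t (f y) ?i"
    have i1: "?i \<in> {1..?N}" "dbar d x ?xh \<le> D" using i by (simp_all add: f_def)
    have "c (f y) ?xh \<le> ?i" unfolding c_def by (rule Least_le) (use i1 t in auto)
    then have le: "card \<T> * c (f y) ?xh \<le> card \<T> * ?i" by simp
    have "?xh \<in> ?\<Omega>" by (rule bij_betw_apply[OF gs_bij[OF t m] i1(1)])
    show ?thesis
    proof (rule num_guesses_le[OF _ \<open>?xh \<in> ?\<Omega>\<close> i1(2)])
      show "bij_betw (g (f y)) {1..?N} ?\<Omega>" using g m by simp
      fix j assume "j \<in> {1..?N}" "g (f y) j = ?xh"
      then show "j \<le> card \<T> * ?i" using g m le by (metis lessThan_iff order_trans)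
    qed
  qed
  let ?Pn = "\<lambda>x y. \<Prod>i<n. P (x ! i, y ! i)"
  have Pn: "0 \<le> ?Pn x y" for x y by (intro prod_nonneg ballI P)
  have "guess_moment P d D \<rho> n f g = (\<Sum>w\<in>{x. length x = n} \<times> {y. length y = n}. ?Pn (fst w) (snd w) * real (num_guesses d D g (fst w) (f (snd w))) powr \<rho>)"
    unfolding guess_moment_def by (simp add: sum.cartesian_product case_prod_beta)
  also have "\<dots> = (\<Sum>t\<in>\<T>. \<Sum>w\<in>{w\<in>{x. length x = n} \<times> {y. length y = n}. count_list (snd w) = t}.
      ?Pn (fst w) (snd w) * real (num_guesses d D g (fst w) (f (snd w))) powr \<rho>)"
    by (rule sum.group[symmetric]) (use fin\<T> in \<open>auto simp: \<T>_def finite_lists_UNIV\<close>)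
  also have "\<dots> \<le> (\<Sum>t\<in>\<T>. card \<T> powr \<rho> * X)"
  proof (rule sum_mono)
    fix t assume t: "t \<in> \<T>"
    let ?S = "{(x :: 'x list, y :: 'y list). length x = n \<and> length y = n \<and> count_list y = t}"
    have "{w\<in>{x. length x = n} \<times> {y. length y = n}. count_list (snd w) = t} = ?S" by auto
    moreover have "(\<Sum>w\<in>?S. ?Pn (fst w) (snd w) * real (num_guesses d D g (fst w) (f (snd w))) powr \<rho>) \<le>
      (\<Sum>w\<in>?S. card \<T> powr \<rho> * (case w of (x, y) \<Rightarrow> ?Pn x y * real (num_guesses d D (gs t) x (fs t y)) powr \<rho>))"
    proof (rule sum_mono)
      fix w assume "w \<in> ?S"
      then obtain x y where w: "w = (x, y)" "length x = n" "length y = n" "count_list y = t" by auto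
      have "real (num_guesses d D g x (f y)) powr \<rho> \<le> (real (card \<T>) * real (num_guesses d D (gs t) x (fs t y))) powr \<rho>"
        using G[OF w(2,3)] rho unfolding w(4) of_nat_mult[symmetric] by (intro powr_mono2) (simp_all only: of_nat_le_iff of_nat_0_le_iff less_imp_le)
      also have "\<dots> = card \<T> powr \<rho> * real (num_guesses d D (gs t) x (fs t y)) powr \<rho>" by (simp add: powr_mult)
      finally have "?Pn x y * real (num_guesses d D g x (f y)) powr \<rho> \<le>
          ?Pn x y * (card \<T> powr \<rho> * real (num_guesses d D (gs t) x (fs t y)) powr \<rho>)"
        by (rule mult_left_mono) (rule Pn)
      then show "?Pn (fst w) (snd w) * real (num_guesses d D g (fst w) (f (snd w))) powr \<rho> \<le>
        card \<T> powr \<rho> * (case w of (x, y) \<Rightarrow> ?Pn x y * real (num_guesses d D (gs t) x (fs t y)) powr \<rho>)"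
        by (simp add: w(1) mult_ac)
    qed
    moreover have "\<dots> \<le> card \<T> powr \<rho> * X"
      unfolding sum_distrib_left[symmetric] by (intro mult_left_mono mom t) simp
    ultimately show "(\<Sum>w\<in>{w\<in>{x. length x = n} \<times> {y. length y = n}. count_list (snd w) = t}.
      ?Pn (fst w) (snd w) * real (num_guesses d D g (fst w) (f (snd w))) powr \<rho>) \<le> card \<T> powr \<rho> * X" by simp
  qed
  also have "\<dots> = card \<T> powr (1 + \<rho>) * X"
    using \<T>_ne fin\<T> by (simp add: powr_add card_gt_0_iff)
  also have "\<dots> \<le> ((real n + 1) ^ CARD('y)) powr (1 + \<rho>) * X"
  proof (intro mult_right_mono powr_mono2)
    show "real (card \<T>) \<le> (real n + 1) ^ CARD('y)"
      using card\<T> by (metis (no_types, lifting) of_nat_1 of_nat_add of_nat_le_iff of_nat_power)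
  qed (use rho X in auto)
  finally show ?thesis using f strat by blast
qed

text \<open>The number of guesses is at least 1 and the law has total mass 1. The bound passes to
  the optimum and keeps the logarithms below monotone.\<close>

lemma guess_moment_ge_1:
  fixes P :: "'x::finite \<times> 'y::finite \<Rightarrow> real" and d :: "'x \<Rightarrow> 'xh::finite \<Rightarrow> real"
  assumes P: "pmf_on UNIV P" and rho: "0 < \<rho>"
    and feas: "\<And>x :: 'x list. length x = n \<Longrightarrow> \<exists>xh. length xh = n \<and> dbar d x xh \<le> D"
    and f: "is_helper n R f" and g: "is_guessing_strategy n R g"
  shows "1 \<le> guess_moment P d D \<rho> n f g"
proof -
  have Pnn: "0 \<le> P z" for z using P unfolding pmf_on_def by blast
  have "(\<Sum>xs\<in>{xs. length xs = n}. \<Sum>ys\<in>{ys. length ys = n}. \<Prod>i<n. P (xs ! i, ys ! i)) =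
    (\<Sum>xs\<in>{xs. length xs = n}. \<Prod>i<n. \<Sum>y\<in>UNIV. P (xs ! i, y))"
    using sum_lists_prod[of n "\<lambda>_. UNIV" "\<lambda>i y. P (xs ! i, y)" for xs] by simp
  also have "\<dots> = (\<Prod>i<n. \<Sum>x\<in>UNIV. \<Sum>y\<in>UNIV. P (x, y))"
    using sum_lists_prod[of n "\<lambda>_. UNIV" "\<lambda>i x. \<Sum>y\<in>UNIV. P (x, y)"] by simp
  also have "\<dots> = 1" using P by (simp add: pmf_on_def sum.cartesian_product)
  finally have "1 = (\<Sum>xs\<in>{xs. length xs = n}. \<Sum>ys\<in>{ys. length ys = n}. (\<Prod>i<n. P (xs ! i, ys ! i)) * 1)" by simp
  also have "\<dots> \<le> guess_moment P d D \<rho> n f g"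
    unfolding guess_moment_def
  proof (intro sum_mono mult_left_mono prod_nonneg ballI Pnn)
    fix xs ys assume "xs \<in> {xs :: 'x list. length xs = n}" "ys \<in> {ys :: 'y list. length ys = n}"
    then have len: "length xs = n" "length ys = n" by auto
    obtain xh :: "'xh list" where xh: "length xh = n" "dbar d xs xh \<le> D" using feas[OF len(1)] by blast
    have "f ys < num_desc n R" using f len by (simp add: is_helper_def)
    from num_guesses_spec(1)[OF g this xh] rho
    show "1 \<le> real (num_guesses d D g xs (f ys)) powr \<rho>" by (intro ge_one_powr_ge_zero) auto
  qed
  finally show ?thesis .
qed

text \<open>Guarantees that the set under the infimum in \<open>opt_guess_moment\<close> is
  nonempty.\<close>

lemma ex_code: "\<exists>f g. is_helper n R f \<and> is_guessing_strategy n R (g :: nat \<Rightarrow> nat \<Rightarrow> 'xh::finite list)"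
proof -
  obtain h where "bij_betw h {1..card {xs :: 'xh list. length xs = n}} {xs :: 'xh list. length xs = n}"
    using ex_bij_betw_nat_finite_1[OF finite_lists_UNIV[where 'a='xh and n=n]] by blast
  then have "is_guessing_strategy n R (\<lambda>_. h)" by (simp add: is_guessing_strategy_def card_lists_UNIV)
  moreover have "is_helper n R (\<lambda>_. 0)" by (simp add: is_helper_def num_desc_def)
  ultimately show ?thesis by blast
qed

lemma opt_guess_moment_ge:
  fixes P :: "'x::finite \<times> 'y::finite \<Rightarrow> real" and d :: "'x \<Rightarrow> 'xh::finite \<Rightarrow> real"
  assumes "\<And>f g. is_helper n R f \<Longrightarrow> is_guessing_strategy n R g \<Longrightarrow> b \<le> guess_moment P d D \<rho> n f g"
  shows "b \<le> opt_guess_moment P d D R \<rho> n"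
  unfolding opt_guess_moment_def by (rule cInf_greatest) (use assms ex_code[where 'xh='xh] in blast)+

lemma opt_guess_moment_le:
  assumes P: "\<And>z. 0 \<le> P z" and "is_helper n R f" "is_guessing_strategy n R g"
  shows "opt_guess_moment P d D R \<rho> n \<le> guess_moment P d D \<rho> n f g"
  unfolding opt_guess_moment_def
proof (rule cInf_lower)
  show "bdd_below {guess_moment P d D \<rho> n f g |f g. is_helper n R f \<and> is_guessing_strategy n R g}"
    by (rule bdd_belowI[of _ 0]) (auto simp: guess_moment_def intro!: sum_nonneg mult_nonneg_nonneg prod_nonneg P)
qed (use assms in blast)

theorem theorem1:
  fixes P :: "'x::finite \<times> 'y::finite \<Rightarrow> real"
    and d :: "'x \<Rightarrow> 'xh::finite \<Rightarrow> real"
    and D R \<rho> :: real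
  assumes P_pmf: "pmf_on UNIV P"
    and PX_pos: "\<forall>x. (\<Sum>y\<in>UNIV. P (x, y)) > 0"
    and PY_pos: "\<forall>y. (\<Sum>x\<in>UNIV. P (x, y)) > 0"
    and d_nonneg: "\<forall>x xh. 0 \<le> d x xh"
    and D_pos: "D > 0" and R_nonneg: "R \<ge> 0" and rho_pos: "\<rho> > 0"
    and feasible: "\<forall>n \<ge> 1. \<forall>xs :: 'x list. length xs = n \<longrightarrow>
                     (\<exists>xhs :: 'xh list. length xhs = n \<and> dbar d xs xhs \<le> D)"
  shows "(\<lambda>n. ereal (log 2 (opt_guess_moment P d D R \<rho> n) / real n)) \<longlonglongrightarrow>
    (SUP QY \<in> {QY :: 'y \<Rightarrow> real. pmf_on UNIV QY}.
      INF kV \<in> {(k, V :: 'y \<Rightarrow> nat \<Rightarrow> real). 1 \<le> k \<and>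
                   (\<forall>y. pmf_on {..<k} (V y)) \<and>
                   mutual_info UNIV {..<k} (\<lambda>y u. QY y * V y u) \<le> R}.
        (case kV of (k, V) \<Rightarrow>
          SUP W \<in> {W :: 'y \<Rightarrow> nat \<Rightarrow> 'x \<Rightarrow> real. \<forall>y. \<forall>u\<in>{..<k}. pmf_on UNIV (W y u)}.
            ereal \<rho> * cond_rd d D {..<k} (\<lambda>x u. \<Sum>y\<in>UNIV. QY y * V y u * W y u x)
            - rel_entropy (UNIV \<times> UNIV \<times> {..<k})
                (\<lambda>(x, y, u). QY y * V y u * W y u x)
                (\<lambda>(x, y, u). P (x, y) * V y u)))"
proof -
  define Vs where "Vs QY = {(k, V :: 'y \<Rightarrow> nat \<Rightarrow> real). 1 \<le> k \<and> (\<forall>y. pmf_on {..<k} (V y)) \<and>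
                   mutual_info UNIV {..<k} (\<lambda>y u. QY y * V y u) \<le> R}" for QY :: "'y \<Rightarrow> real"
  define Ws where "Ws k = {W :: 'y \<Rightarrow> nat \<Rightarrow> 'x \<Rightarrow> real. \<forall>y. \<forall>u\<in>{..<k}. pmf_on UNIV (W y u)}" for k :: nat
  define val where "val QY = (INF kV \<in> Vs QY. case kV of (k, V) \<Rightarrow> SUP W \<in> Ws k. guess_exponent P d D \<rho> QY k V W)" for QY
  define F where "F = (SUP QY \<in> {QY :: 'y \<Rightarrow> real. pmf_on UNIV QY}. val QY)"
  define opt where "opt n = opt_guess_moment P d D R \<rho> n" for n
  have P: "0 \<le> P z" for z using P_pmf unfolding pmf_on_def by blast
  have feas: "\<exists>xh. length xh = n \<and> dbar d x xh \<le> D" if "1 \<le> n" "length x = n" for n and x :: "'x list"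
    using feasible that by blast
  have opt_ge1: "1 \<le> opt n" if "1 \<le> n" for n
    unfolding opt_def
    by (rule opt_guess_moment_ge, rule guess_moment_ge_1[OF P_pmf rho_pos feas[OF that]]) auto
  define h where "h n = 1 + n * ln (real CARD('xh))" for n :: nat
  have h_ge1: "1 \<le> h n" for n by (simp add: h_def)
  \<comment> \<open>With m = 0 the covering overhead reduces to \<open>h\<close>.\<close>
  have h_lim: "(\<lambda>n. log 2 (h n) / n) \<longlonglongrightarrow> 0"
    using cover_overhead_tendsto[of "CARD('xh)" 0] by (simp add: cover_overhead_def h_def add.commute Suc_le_eq)
  have "(\<lambda>n. ereal (log 2 (opt n) / n)) \<longlonglongrightarrow> F"
  proof (rule order_tendstoI)
    \<comment> \<open>The value F is an extended real not yet known to be finite, so both halves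
      pass through real numbers strictly between a and the value; here the gap from c1 to c2 absorbs
      the loss of order log n / n.\<close>
    fix a assume "a < F"
    then obtain QY where QY: "pmf_on UNIV QY" "a < val QY" unfolding F_def less_SUP_iff by blast
    obtain c2 where c2: "a < ereal c2" "ereal c2 < val QY" using ereal_dense2[OF QY(2)] by blast
    obtain c1 where c1: "a < ereal c1" "ereal c1 < ereal c2" using ereal_dense2[OF c2(1)] by blast
    have lower: "c2 - \<rho> * (log 2 (h n) / n) \<le> log 2 (opt n) / n" if n: "1 \<le> n" for n
    proof -
      have "2 powr (n * c2 - \<rho> * log 2 (h n)) \<le> opt n"
        unfolding opt_def
      proof (rule opt_guess_moment_ge)
        fix f :: "'y list \<Rightarrow> nat" and g :: "nat \<Rightarrow> nat \<Rightarrow> 'xh list"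
        assume fg: "is_helper n R f" "is_guessing_strategy n R g"
        have gm1: "1 \<le> guess_moment P d D \<rho> n f g"
          by (rule guess_moment_ge_1[OF P_pmf rho_pos feas[OF n] fg])
        obtain k V where kV: "(k, V) \<in> Vs QY"
          "\<And>W. W \<in> Ws k \<Longrightarrow> guess_exponent P d D \<rho> QY k V W \<le> ereal ((log 2 (guess_moment P d D \<rho> n f g) + \<rho> * log 2 (h n)) / n)"
          using converse_bound[where P=P, OF P R_nonneg rho_pos feas[OF n] n fg QY(1)]
          unfolding Vs_def Ws_def h_def by auto
        have "val QY \<le> (SUP W \<in> Ws k. guess_exponent P d D \<rho> QY k V W)"
          unfolding val_def by (rule INF_lower2[OF kV(1)]) simp
        also have "\<dots> \<le> ereal ((log 2 (guess_moment P d D \<rho> n f g) + \<rho> * log 2 (h n)) / n)"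
          by (rule SUP_least) (rule kV(2))
        finally have "ereal c2 < ereal ((log 2 (guess_moment P d D \<rho> n f g) + \<rho> * log 2 (h n)) / n)"
          using c2(2) by (rule less_le_trans[rotated])
        then have "n * c2 - \<rho> * log 2 (h n) \<le> log 2 (guess_moment P d D \<rho> n f g)"
          using n by (simp add: less_divide_eq mult.commute)
        then show "2 powr (n * c2 - \<rho> * log 2 (h n)) \<le> guess_moment P d D \<rho> n f g"
          using gm1 by (simp add: le_log_iff)
      qed
      then have "n * c2 - \<rho> * log 2 (h n) \<le> log 2 (opt n)" using opt_ge1[OF n] by (simp add: le_log_iff)
      then have "(n * c2 - \<rho> * log 2 (h n)) / n \<le> log 2 (opt n) / n" by (rule divide_right_mono) simp
      then show ?thesis using n by (simp add: diff_divide_distrib)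
    qed
    have "(\<lambda>n. c2 - \<rho> * (log 2 (h n) / n)) \<longlonglongrightarrow> c2 - \<rho> * 0"
      by (intro tendsto_intros h_lim)
    then have "\<forall>\<^sub>F n in sequentially. c1 < c2 - \<rho> * (log 2 (h n) / n)"
      using c1(2) by (intro order_tendstoD(1)) auto
    then show "\<forall>\<^sub>F n in sequentially. a < ereal (log 2 (opt n) / n)"
      using eventually_ge_at_top[of 1]
    proof eventually_elim
      case (elim n)
      then have "ereal c1 < ereal (log 2 (opt n) / n)" using lower[of n] by simp
      with c1(1) show ?case by (rule less_trans)
    qed
  next
    fix a assume "F < a"
    \<comment> \<open>Three levels: c1 bounds the exponents, the strict step to c2 is the gap that
      \<open>type_achievability\<close> requires, and c3 leaves room for the polynomial factor of
      \<open>combine_types\<close>.\<close>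
    then obtain c3 where c3: "F < ereal c3" "ereal c3 < a" using ereal_dense2 by blast
    obtain c2 where c2: "F < ereal c2" "ereal c2 < ereal c3" using ereal_dense2[OF c3(1)] by blast
    obtain c1 where c1: "F < ereal c1" "ereal c1 < ereal c2" using ereal_dense2[OF c2(1)] by blast
    have good: "\<exists>k V c'. 1 \<le> k \<and> (\<forall>y. pmf_on {..<k} (V y)) \<and>
      mutual_info UNIV {..<k} (\<lambda>y u. QY y * V y u) \<le> R \<and> c' < c2 \<and>
      (\<forall>W. (\<forall>y. \<forall>u\<in>{..<k}. pmf_on UNIV (W y u)) \<longrightarrow> guess_exponent P d D \<rho> QY k V W \<le> ereal c')" if QY: "pmf_on UNIV QY" for QY
    proof -
      have "val QY \<le> F" unfolding F_def by (rule SUP_upper) (use QY in simp)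
      then have "val QY < ereal c1" using c1(1) by (rule le_less_trans)
      then obtain kV where kV: "kV \<in> Vs QY" "(case kV of (k, V) \<Rightarrow> SUP W \<in> Ws k. guess_exponent P d D \<rho> QY k V W) < ereal c1"
        unfolding val_def INF_less_iff by blast
      obtain k V where kV_eq: "kV = (k, V)" by (cases kV)
      have "guess_exponent P d D \<rho> QY k V W \<le> ereal c1" if "W \<in> Ws k" for W
        using SUP_upper[OF that, of "guess_exponent P d D \<rho> QY k V"] kV(2) unfolding kV_eq by (simp add: less_imp_le order_trans)
      then show ?thesis
        using kV(1) c1(2) unfolding kV_eq Vs_def Ws_def by (intro exI[of _ k] exI[of _ V] exI[of _ c1]) auto
    qed
    \<comment> \<open>Feasibility at blocklength 1 shows that the cheapest reconstruction letter of
      each x already meets the distortion level D.\<close>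
    have "\<exists>b. (\<forall>b'. d x b \<le> d x b') \<and> d x b \<le> D" for x
    proof -
      have "Min (range (d x)) \<in> range (d x)" by (rule Min_in) auto
      then obtain b where b: "d x b = Min (range (d x))" by force
      then have min: "d x b \<le> d x b'" for b' by simp
      obtain xh where "length xh = 1" "dbar d [x] xh \<le> D" using feas[of 1 "[x]"] by auto
      then have "d x (xh ! 0) \<le> D" by (simp add: dbar_def)
      then show ?thesis using min order_trans by blast
    qed
    then obtain x0 where x0: "\<And>x b. d x (x0 x) \<le> d x b" "\<And>x. d x (x0 x) \<le> D" by metis
    obtain n0 where n0: "\<And>n yl :: 'y list. n0 \<le> n \<Longrightarrow> length yl = n \<Longrightarrow> \<exists>f g. is_helper n R f \<and> is_guessing_strategy n R g \<and>
      (\<Sum>(x, y)\<in>{(x, y). length x = n \<and> length y = n \<and> count_list y = count_list yl}.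
        (\<Prod>i<n. P (x ! i, y ! i)) * real (num_guesses d D g x (f y)) powr \<rho>) \<le> 2 powr (n * c2)"
      using type_achievability[where P=P and d=d and c=c2, OF P R_nonneg rho_pos feas x0 good] by blast
    define b where "b n = c2 + (1 + \<rho>) * (CARD('y) * (log 2 (real n + 1) / n))" for n
    have "log 2 (opt n) / n \<le> b n" if n: "max 1 n0 \<le> n" for n
    proof -
      have n1: "1 \<le> n" and "n0 \<le> n" using n by auto
      obtain f g where fg: "is_helper n R f" "is_guessing_strategy n R g"
        "guess_moment P d D \<rho> n f g \<le> ((real n + 1) ^ CARD('y)) powr (1 + \<rho>) * 2 powr (n * c2)"
        using combine_types[where P=P, OF P rho_pos feas[OF n1] n0[OF \<open>n0 \<le> n\<close>]] by auto
      have "opt n \<le> ((real n + 1) ^ CARD('y)) powr (1 + \<rho>) * 2 powr (n * c2)"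
        using opt_guess_moment_le[OF P fg(1,2)] fg(3) unfolding opt_def by (rule order_trans)
      then have "log 2 (opt n) \<le> log 2 (((real n + 1) ^ CARD('y)) powr (1 + \<rho>) * 2 powr (n * c2))"
        using opt_ge1[OF n1] by (intro log_mono) auto
      also have "\<dots> = (1 + \<rho>) * (CARD('y) * log 2 (real n + 1)) + n * c2"
        by (simp add: log_mult_pos log_powr log_nat_power)
      finally have "log 2 (opt n) / n \<le> ((1 + \<rho>) * (CARD('y) * log 2 (real n + 1)) + n * c2) / n"
        by (rule divide_right_mono) simp
      then show ?thesis using n1 by (simp add: b_def add_divide_distrib)
    qed
    then have upper: "\<forall>\<^sub>F n in sequentially. log 2 (opt n) / n \<le> b n"
      by (intro eventually_sequentiallyI)
    have "b \<longlonglongrightarrow> c2 + (1 + \<rho>) * (real CARD('y) * 0)"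
      unfolding b_def by (intro tendsto_intros log_Suc_over_n)
    then have "\<forall>\<^sub>F n in sequentially. b n < c3"
      using c2(2) by (intro order_tendstoD(2)) auto
    then show "\<forall>\<^sub>F n in sequentially. ereal (log 2 (opt n) / n) < a"
      using upper
    proof eventually_elim
      case (elim n)
      then have "ereal (log 2 (opt n) / n) < ereal c3" by simp
      then show ?case using c3(2) by (rule less_trans)
    qed
  qed
  then show ?thesis unfolding F_def val_def Vs_def Ws_def guess_exponent_def opt_def .
qed

end
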